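(* For every integer $n\geq 2$, there are convex bodies of revolution $K,L\subset\mathbb{R}^n$, both containing the origin in their interiors and neither origin-symmetric, such that \[ |K\cap\xi^\perp|_{n-1}<|L\cap\xi^\perp|_{n-1} \quad\text{and}\quad |K\mid\xi^\perp|_{n-1}<|L\mid\xi^\perp|_{n-1} \qquad\text{for all }\xi\in\mathbb{S}^{n-1}, \] but $|K|_n>|L|_n$. Moreover, $K$ and $L$ may be chosen with all these properties and such that, in addition, $K$ is a nontrivial translate of a Euclidean ball (i.e. of an origin-centered ball by a nonzero vector), while $L$ is not centrally symmetric about any point.
   Context: A convex body in $\mathbb{R}^n$ is a compact convex set with nonempty interior; it is origin-symmetric if $K=-K$, and centrally symmetric about a point $p$ if $K-p=-(K-p)$. $\mathbb{S}^{n-1}$ is the Euclidean unit sphere, $\xi^\perp$ is the hyperplane through the origin orthogonal to $\xi$, $K\mid\xi^\perp$ is the orthogonal projection of $K$ onto $\xi^\perp$, and $|A|_k$ denotes $k$-dimensional volume. A body of revolution is a body invariant under every orthogonal transformation that fixes a distinguished axis (a line through the origin) pointwise. *)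

theory Defs
  imports "HOL-Analysis.Analysis"
begin

definition convex_body :: "'a::euclidean_space set \<Rightarrow> bool" where
  "convex_body K \<longleftrightarrow> compact K \<and> convex K \<and> interior K \<noteq> {}"

definition origin_symmetric :: "'a::euclidean_space set \<Rightarrow> bool" where
  "origin_symmetric K \<longleftrightarrow> K = uminus ` K"

definition centrally_symmetric_about :: "'a::euclidean_space \<Rightarrow> 'a set \<Rightarrow> bool" where
  "centrally_symmetric_about p K \<longleftrightarrow> origin_symmetric ((\<lambda>x. x - p) ` K)"

text \<open>The axis is the line spanned by \<open>u\<close>. All orthogonal transformations fixing it pointwise
  are admitted, including those of determinant \<open>-1\<close>; in the plane the condition is therefore
  symmetry under reflection in the axis.\<close>

definition body_of_revolution :: "'a::euclidean_space set \<Rightarrow> bool" where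
  "body_of_revolution K \<longleftrightarrow>
     (\<exists>u. u \<noteq> 0 \<and>
       (\<forall>f. orthogonal_transformation f \<and> (\<forall>x\<in>span {u}. f x = x) \<longrightarrow> f ` K = K))"

definition orth_projection :: "'a::euclidean_space set \<Rightarrow> 'a set \<Rightarrow> 'a set" where
  "orth_projection S K = {y \<in> S. \<exists>x\<in>K. \<forall>z\<in>S. orthogonal (x - y) z}"

definition orthonormal_basis :: "'a::euclidean_space set \<Rightarrow> 'a set \<Rightarrow> bool" where
  "orthonormal_basis S B \<longleftrightarrow>
     B \<subseteq> S \<and> pairwise orthogonal B \<and> (\<forall>b\<in>B. norm b = 1) \<and> span B = S"

text \<open>The \<open>k\<close>-dimensional volume of a (Borel) set \<open>A\<close> contained in a \<open>k\<close>-dimensional linear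
  subspace \<open>S\<close>: the Lebesgue measure of the set of coordinate vectors of the points of \<open>A\<close> with
  respect to an orthonormal basis of \<open>S\<close>, where the coordinate space is the \<open>k\<close>-fold product of
  the Lebesgue measure on the line, indexed by the basis vectors. Such a basis exists
  by \<open>orthonormal_basis_subspace\<close>, and the value does not depend on which one is chosen, since
  a change of basis is an orthogonal transformation of the coordinates.\<close>

definition subspace_volume :: "'a::euclidean_space set \<Rightarrow> 'a set \<Rightarrow> real" where
  "subspace_volume S A =
     (let B = (SOME B. orthonormal_basis S B);
          M = (\<Pi>\<^sub>M b\<in>B. (lborel :: real measure))
      in measure M {c \<in> space M. (\<Sum>b\<in>B. c b *\<^sub>R b) \<in> A})"

definition smaller_sections_and_projections ::
    "'a::euclidean_space set \<Rightarrow> 'a set \<Rightarrow> bool" where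
  "smaller_sections_and_projections K L \<longleftrightarrow>
     (\<forall>\<xi>\<in>sphere 0 1.
        subspace_volume ({\<xi>}\<^sup>\<bottom>) (K \<inter> {\<xi>}\<^sup>\<bottom>) < subspace_volume ({\<xi>}\<^sup>\<bottom>) (L \<inter> {\<xi>}\<^sup>\<bottom>) \<and>
        subspace_volume ({\<xi>}\<^sup>\<bottom>) (orth_projection ({\<xi>}\<^sup>\<bottom>) K)
          < subspace_volume ({\<xi>}\<^sup>\<bottom>) (orth_projection ({\<xi>}\<^sup>\<bottom>) L))"

end

theory Submission
  imports Defs "HOL-Real_Asymp.Real_Asymp"
begin

text \<open>Let \<open>m = n - 1\<close>. A body of revolution whose equator is the unit sphere of the hyperplane
  orthogonal to the axis is described by two profiles: for every slope \<open>p > 0\<close>, the radii \<open>a p\<close>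
  and \<open>a' p\<close> at which the upper and the lower half attain the slope \<open>p\<close>; for the unit ball both
  are \<open>p / sqrt (1 + p\<^sup>2)\<close>. Slicing a shadow by planes parallel to the axis, writing the width of
  each slice as an integral over slopes and integrating first over the position, one finds that
  all shadow volumes depend on the profiles only through \<open>(a p) ^ m + (a' p) ^ m\<close>, because the
  integrand is homogeneous of degree 0 in the position. The volume, in contrast, is a decreasing
  function of \<open>\<integral> (a p) ^ (m + 1) + (a' p) ^ (m + 1) dp\<close>. Take for \<open>a'\<close> the profile of a half
  ellipsoid of height \<open>sqrt (3/2)\<close> and define \<open>a\<close> by \<open>a ^ m + a' ^ m = 2 (p / sqrt (1 + p\<^sup>2)) ^ m\<close>.
  The resulting body \<open>L\<close> has the same shadow volumes as the unit ball but, by strict convexity,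
  smaller volume.

  A section containing the axis is also a shadow. Since both profiles are bounded below by that of
  the ellipsoid, the function \<open>\<psi> r\<^sup>2 + 3/2 r\<^sup>2\<close> of the radius is nondecreasing for the height \<open>\<psi>\<close> of each half,
  so that tilting the section by an angle with sine \<open>c\<close> decreases its volume at most by the
  factor \<open>1 / sqrt (1 + c\<^sup>2 / 2)\<close>. A ball of radius \<open>r < 1\<close> close to 1 with centre at distance
  \<open>r / sqrt 2\<close> from the origin loses more than that.\<close>

section \<open>Orthonormal coordinates on hyperplanes\<close>

text \<open>The squared height \<open>b = 3/2\<close> lies in the middle of an admissible range.
  \<open>b > 1\<close> separates the two profiles and makes the volume drop.
  \<open>b \<le> 2\<close> is forced by steep slopes: the radicand in \<open>upper\<close> is about
  \<open>1 - (m/2) (2 - b) / p^2\<close> for large \<open>p\<close> and must stay at most 1. For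
  general \<open>b\<close> a tilted section loses at most the factor
  \<open>1 / sqrt (1 + (b - 1) c^2)\<close>, while a ball with centre at distance
  \<open>r sqrt t\<close> from the origin has section radius \<open>r sqrt (1 - t c^2)\<close>. With
  \<open>t = b - 1\<close> the product of \<open>1 + t c^2\<close> and \<open>1 - t c^2\<close> is
  at most 1, and \<open>t < 1\<close> keeps the origin inside the ball.

  The upper height function has no convenient closed form, so it is never differentiated. It is
  given as an integral over slopes; exchanging integrals replaces the fundamental theorem of
  calculus, and difference estimates replace derivative bounds.

  For sections and shadows of \<open>L\<close> only lower bounds are proved. Strictness in both
  comparisons comes from \<open>r < 1\<close>, and the strict volume drop of \<open>L\<close> leaves
  room for such an \<open>r\<close>.\<close>

interpretation lebesgue_prod: product_sigma_finite "\<lambda>_. lborel :: real measure"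
  by (simp add: product_sigma_finite_def lborel.sigma_finite_measure_axioms)

section \<open>Orthogonal invariance of Lebesgue measure\<close>

lemma borel_measurable_orthogonal:
  fixes f :: "'a::euclidean_space \<Rightarrow> 'a"
  assumes "orthogonal_transformation f"
  shows "f \<in> borel_measurable borel"
  using orthogonal_transformation_linear[OF assms]
  by (intro borel_measurable_continuous_onI linear_continuous_on) (simp add: linear_conv_bounded_linear)

lemma borel_measurable_vec_lambda:
  fixes f :: "'n::finite \<Rightarrow> 'a \<Rightarrow> real"
  assumes "\<And>k. f k \<in> borel_measurable M"
  shows "(\<lambda>x. \<chi> k. f k x) \<in> borel_measurable M"
  by (subst borel_measurable_euclidean_space) (auto simp: Basis_vec_def inner_axis assms)

text \<open>The image measure \<open>?N\<close> is again translation invariant and agrees with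
  \<open>lborel\<close> on the unit ball, because \<open>f\<close> preserves norms. Translation
  invariant measures are proportional: integrating over the pairs with \<open>y\<close> in
  \<open>?B\<close> and \<open>x + y\<close> in \<open>A\<close> in both orders gives the product
  equation \<open>eq\<close>, and the common ball volume cancels.\<close>

lemma distr_lborel_orthogonal:
  fixes f :: "'a::euclidean_space \<Rightarrow> 'a"
  assumes f: "orthogonal_transformation f"
  shows "distr lborel borel f = lborel"
proof (rule measure_eqI)
  let ?N = "distr lborel borel f" and ?B = "ball (0::'a) 1"
  have lin: "linear f" using f by (rule orthogonal_transformation_linear)
  have [measurable]: "f \<in> borel_measurable borel"
    using f by (rule borel_measurable_orthogonal)
  have bij: "bij f" using f by (rule orthogonal_transformation_bij)
  have shift: "(\<integral>\<^sup>+x. g (x + c) \<partial>?N) = (\<integral>\<^sup>+x. g x \<partial>?N)"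
    if [measurable]: "g \<in> borel_measurable borel" for g :: "'a \<Rightarrow> ennreal" and c
  proof -
    obtain d where d: "f d = c" using bij by (metis bij_pointE)
    have "(\<integral>\<^sup>+x. g (x + c) \<partial>?N) = (\<integral>\<^sup>+x. g (f (d + x)) \<partial>lborel)"
      by (simp add: nn_integral_distr d[symmetric] linear_add[OF lin] add.commute)
    also have "\<dots> = (\<integral>\<^sup>+x. g (f x) \<partial>distr lborel borel ((+) d))"
      by (subst nn_integral_distr) auto
    finally show ?thesis by (simp add: lborel_distr_plus nn_integral_distr)
  qed
  have shiftl: "(\<integral>\<^sup>+x. g (x + c) \<partial>lborel) = (\<integral>\<^sup>+x. g x \<partial>lborel)"
    if [measurable]: "g \<in> borel_measurable borel" for g :: "'a \<Rightarrow> ennreal" and c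
  proof -
    have "(\<integral>\<^sup>+x. g x \<partial>lborel) = (\<integral>\<^sup>+x. g x \<partial>distr lborel borel ((+) c))"
      by (simp add: lborel_distr_plus)
    also have "\<dots> = (\<integral>\<^sup>+x. g (x + c) \<partial>lborel)"
      by (subst nn_integral_distr) (auto simp: add.commute)
    finally show ?thesis by simp
  qed
  have "f -` ?B \<inter> space lborel = ?B"
    using orthogonal_transformation_norm[OF f] by auto
  then have NB: "emeasure ?N ?B = emeasure lborel ?B"
    by (simp add: emeasure_distr)
  interpret N: sigma_finite_measure ?N
  proof
    have fin: "emeasure ?N (ball 0 (real n)) \<noteq> top" for n
    proof -
      have "f -` ball 0 (real n) \<inter> space lborel = ball 0 (real n)"
        using orthogonal_transformation_norm[OF f] by auto
      then show ?thesis by (simp add: emeasure_distr less_imp_neq[OF emeasure_lborel_ball_finite, unfolded infinity_ennreal_def])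
    qed
    have un: "\<Union> (range (\<lambda>n. ball (0::'a) (real n))) = space ?N"
      by (auto simp: reals_Archimedean2)
    show "\<exists>A. countable A \<and> A \<subseteq> sets ?N \<and> \<Union>A = space ?N \<and> (\<forall>a\<in>A. emeasure ?N a \<noteq> \<infinity>)"
      using fin un by (intro exI[of _ "range (\<lambda>n. ball (0::'a) (real n))"]) auto
  qed
  interpret P: pair_sigma_finite ?N lborel ..
  have sets_P: "sets (?N \<Otimes>\<^sub>M lborel) = sets (borel \<Otimes>\<^sub>M borel)"
    by (intro sets_pair_measure_cong) auto
  have [measurable]: "?B \<in> sets borel" by simp
  fix A assume "A \<in> sets ?N"
  then have [measurable]: "A \<in> sets borel" by simp
  have "emeasure ?N A * emeasure lborel ?B = (\<integral>\<^sup>+y. indicator ?B y * (\<integral>\<^sup>+x. indicator A x \<partial>?N) \<partial>lborel)"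
    by (subst nn_integral_multc) (auto intro!: borel_measurable_indicator simp: mult.commute)
  also have "\<dots> = (\<integral>\<^sup>+y. (\<integral>\<^sup>+x. indicator ?B y * indicator A (x + y) \<partial>?N) \<partial>lborel)"
    by (simp add: shift nn_integral_cmult)
  also have "\<dots> = (\<integral>\<^sup>+x. (\<integral>\<^sup>+y. indicator ?B y * indicator A (x + y) \<partial>lborel) \<partial>?N)"
    by (rule P.Fubini') (subst measurable_cong_sets[OF sets_P refl], measurable)
  also have "\<dots> = (\<integral>\<^sup>+x. (\<integral>\<^sup>+y. indicator ?B (y - x) * indicator A y \<partial>lborel) \<partial>?N)"
  proof (rule nn_integral_cong)
    fix x
    show "(\<integral>\<^sup>+y. indicator ?B y * indicator A (x + y) \<partial>lborel)
        = (\<integral>\<^sup>+y. indicator ?B (y - x) * indicator A y \<partial>lborel)"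
      using shiftl[of "\<lambda>y. indicator ?B (y - x) * indicator A y" x] by (simp add: add.commute)
  qed
  also have "\<dots> = (\<integral>\<^sup>+y. (\<integral>\<^sup>+x. indicator ?B (y - x) * indicator A y \<partial>?N) \<partial>lborel)"
    by (rule P.Fubini'[symmetric]) (subst measurable_cong_sets[OF sets_P refl], measurable)
  also have "\<dots> = (\<integral>\<^sup>+y. emeasure ?N ?B * indicator A y \<partial>lborel)"
  proof (rule nn_integral_cong)
    fix y
    have "(\<integral>\<^sup>+x. indicator ?B (y - x) \<partial>?N) = (\<integral>\<^sup>+x. indicator ?B (x + - y) \<partial>?N)"
      by (intro nn_integral_cong) (auto simp: indicator_def norm_minus_commute)
    also have "\<dots> = emeasure ?N ?B" by (subst shift) auto
    finally show "(\<integral>\<^sup>+x. indicator ?B (y - x) * indicator A y \<partial>?N) = emeasure ?N ?B * indicator A y"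
      by (simp add: nn_integral_multc)
  qed
  also have "\<dots> = emeasure lborel A * emeasure lborel ?B"
    by (subst nn_integral_cmult) (simp_all add: NB mult.commute)
  finally have eq: "emeasure ?N A * emeasure lborel ?B = emeasure lborel A * emeasure lborel ?B" .
  have "emeasure lborel ?B \<noteq> 0" "emeasure lborel ?B \<noteq> top"
    using emeasure_lborel_ball_finite[of "0::'a" 1] less_imp_neq[OF unit_ball_vol_pos[of "real DIM('a)"]]
    by (auto simp: emeasure_ball less_imp_le)
  with eq show "emeasure ?N A = emeasure lborel A"
    by (simp add: ennreal_mult_cancel_left mult.commute[of _ "emeasure lborel ?B"])
qed simp

section \<open>Coordinates and volume on a hyperplane\<close>

lemma lborel_vec_PiM:
  "(lborel :: (real^'n) measure) = distr (\<Pi>\<^sub>M k\<in>UNIV. lborel) borel (\<lambda>f. \<chi> k. f k)"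
proof (rule lborel_eqI)
  fix l u :: "real^'n"
  assume le: "\<And>b. b \<in> Basis \<Longrightarrow> l \<bullet> b \<le> u \<bullet> b"
  then have le': "l $ k \<le> u $ k" for k
    by (metis axis_in_Basis_iff cart_eq_inner_axis real_inner_1_right inner_real_def Basis_real_def insertI1)
  have [measurable]: "(\<lambda>f. \<chi> k. f k) \<in> (\<Pi>\<^sub>M k\<in>(UNIV::'n set). (lborel::real measure)) \<rightarrow>\<^sub>M borel"
    by (rule borel_measurable_vec_lambda) simp
  have "(\<lambda>f. \<chi> k. f k) -` box l u \<inter> space (\<Pi>\<^sub>M k\<in>(UNIV::'n set). (lborel::real measure)) = (\<Pi>\<^sub>E k\<in>UNIV. {l$k<..<u$k})"
    by (auto simp: mem_box_cart space_PiM PiE_UNIV_domain Pi_iff)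
  moreover have B: "(\<Prod>b\<in>Basis. (u - l) \<bullet> b) = (\<Prod>k\<in>UNIV. u $ k - l $ k)"
  proof -
    have "Basis = range (\<lambda>k. axis k 1 :: real^'n)" by (auto simp: Basis_vec_def)
    show ?thesis unfolding \<open>Basis = _\<close> by (simp add: prod.reindex inj_on_def axis_eq_axis inner_axis)
  qed
  ultimately show "emeasure (distr (\<Pi>\<^sub>M k\<in>UNIV. lborel) borel (\<lambda>f. \<chi> k. f k)) (box l u)
      = ennreal (\<Prod>b\<in>Basis. (u - l) \<bullet> b)"
    using le' B by (simp add: emeasure_distr lebesgue_prod.emeasure_PiM prod_ennreal)
qed simp

abbreviation EM :: "'n set \<Rightarrow> ('n \<Rightarrow> real) measure" where
  "EM I \<equiv> \<Pi>\<^sub>M k\<in>I. lborel"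

text \<open>The axial coordinate \<open>z\<close> is split off. The value of \<open>x\<close> at
  \<open>i\<close> is ignored, so points of \<open>EM (UNIV - {i})\<close>, which are
  \<open>undefined\<close> there, can be inserted directly.\<close>

definition vec1 :: "'n::finite \<Rightarrow> real \<Rightarrow> ('n \<Rightarrow> real) \<Rightarrow> real^'n" where
  "vec1 i z x = (\<chi> k. if k = i then z else x k)"

lemma sigma_finite_EM: "finite I \<Longrightarrow> sigma_finite_measure (EM I)"
  by (rule lebesgue_prod.sigma_finite)

lemma measurable_vec1 [measurable (raw)]:
  assumes "f \<in> M \<rightarrow>\<^sub>M borel" "g \<in> M \<rightarrow>\<^sub>M EM (UNIV - {i})"
  shows "(\<lambda>y. vec1 i (f y) (g y)) \<in> borel_measurable M"
proof -
  note assms[measurable]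
  have "(\<lambda>y. if k = i then f y else g y k) \<in> borel_measurable M" for k
  proof (cases "k = i")
    case False
    then have "(\<lambda>y. g y k) \<in> M \<rightarrow>\<^sub>M lborel"
      by (intro measurable_compose[OF assms(2) measurable_component_singleton]) auto
    then show ?thesis using False by simp
  qed simp
  then show ?thesis unfolding vec1_def by (rule borel_measurable_vec_lambda)
qed

lemma nn_integral_lborel_vec1:
  fixes f :: "real^'n \<Rightarrow> ennreal"
  assumes [measurable]: "f \<in> borel_measurable borel"
  shows "(\<integral>\<^sup>+y. f y \<partial>lborel) = (\<integral>\<^sup>+x. (\<integral>\<^sup>+z. f (vec1 i z x) \<partial>lborel) \<partial>EM (UNIV - {i}))"
proof -
  have [measurable]: "(\<lambda>f. \<chi> k. f k) \<in> (\<Pi>\<^sub>M k\<in>(UNIV::'n set). (lborel::real measure)) \<rightarrow>\<^sub>M borel"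
    by (rule borel_measurable_vec_lambda) simp
  have ins: "insert i (UNIV - {i}) = UNIV" by auto
  have m: "(\<lambda>x. f (\<chi> k. x k)) \<in> borel_measurable (\<Pi>\<^sub>M k\<in>insert i (UNIV - {i}). lborel)"
    using ins by simp
  have "(\<integral>\<^sup>+y. f y \<partial>lborel) = (\<integral>\<^sup>+x. f (\<chi> k. x k) \<partial>(\<Pi>\<^sub>M k\<in>UNIV. lborel))"
    by (subst lborel_vec_PiM) (simp add: nn_integral_distr)
  also have "\<dots> = (\<integral>\<^sup>+x. f (\<chi> k. x k) \<partial>(\<Pi>\<^sub>M k\<in>insert i (UNIV - {i}). lborel))"
    using ins by simp
  also have "\<dots> = (\<integral>\<^sup>+x. (\<integral>\<^sup>+z. f (vec1 i z x) \<partial>lborel) \<partial>EM (UNIV - {i}))"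
    by (subst lebesgue_prod.product_nn_integral_insert[OF _ _ m]) (simp_all add: vec1_def fun_upd_def)
  finally show ?thesis .
qed

lemma nn_integral_lborel_orthogonal:
  fixes f :: "real^'n \<Rightarrow> ennreal" and G :: "real^'n \<Rightarrow> real^'n"
  assumes [measurable]: "f \<in> borel_measurable borel" and G: "orthogonal_transformation G"
  shows "(\<integral>\<^sup>+y. f y \<partial>lborel) = (\<integral>\<^sup>+x. (\<integral>\<^sup>+z. f (G (vec1 i z x)) \<partial>lborel) \<partial>EM (UNIV - {i}))"
proof -
  have [measurable]: "G \<in> borel_measurable borel"
    using G by (rule borel_measurable_orthogonal)
  have "(\<integral>\<^sup>+y. f y \<partial>lborel) = (\<integral>\<^sup>+y. f y \<partial>distr lborel borel G)"
    by (simp add: distr_lborel_orthogonal[OF G])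
  also have "\<dots> = (\<integral>\<^sup>+y. f (G y) \<partial>lborel)"
    by (simp add: nn_integral_distr)
  finally show ?thesis by (simp add: nn_integral_lborel_vec1[of _ i])
qed

lemma vec1_split: "vec1 i z x = vec1 i 0 x + z *\<^sub>R axis i 1"
  by (simp add: vec1_def vec_eq_iff axis_def)

text \<open>Both sides are the volume of the prism over \<open>A\<close> with edge \<open>\<xi>\<close>.\<close>

lemma emeasure_hyperplane_coords:
  fixes A :: "(real^'n) set" and G H :: "real^'n \<Rightarrow> real^'n"
  assumes A[measurable]: "A \<in> sets borel"
    and G: "orthogonal_transformation G" "G (axis i 1) = \<xi>"
    and H: "orthogonal_transformation H" "H (axis i 1) = \<xi>"
  shows "emeasure (EM (UNIV - {i})) {x \<in> space (EM (UNIV - {i})). G (vec1 i 0 x) \<in> A}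
       = emeasure (EM (UNIV - {i})) {x \<in> space (EM (UNIV - {i})). H (vec1 i 0 x) \<in> A}"
proof -
  let ?M = "EM (UNIV - {i})"
  let ?f = "\<lambda>y. indicator A (y - (y \<bullet> \<xi>) *\<^sub>R \<xi>) * indicator {0..1} (y \<bullet> \<xi>) :: ennreal"
  have f: "?f \<in> borel_measurable borel" by measurable
  have *: "(\<integral>\<^sup>+y. ?f y \<partial>lborel) = emeasure ?M {x \<in> space ?M. G (vec1 i 0 x) \<in> A}"
    if G: "orthogonal_transformation G" "G (axis i 1) = \<xi>" for G :: "real^'n \<Rightarrow> real^'n"
  proof -
    have lin: "linear G" using G(1) by (rule orthogonal_transformation_linear)
    have [measurable]: "G \<in> borel_measurable borel"
      using G(1) by (rule borel_measurable_orthogonal)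
    have spl: "G (vec1 i z x) = G (vec1 i 0 x) + z *\<^sub>R \<xi>" for z x
      using lin by (simp add: vec1_split[of i z] linear_add linear_scale G(2))
    have inn: "G (vec1 i z x) \<bullet> \<xi> = z" for z x
    proof -
      have "G (vec1 i z x) \<bullet> \<xi> = vec1 i z x \<bullet> axis i 1"
        using G by (metis orthogonal_transformation_def)
      then show ?thesis by (simp add: inner_axis vec1_def)
    qed
    have "?f (G (vec1 i z x)) = indicator A (G (vec1 i 0 x)) * indicator {0..1} z" for z x
      unfolding inn by (simp add: spl[of z])
    then have "(\<integral>\<^sup>+y. ?f y \<partial>lborel)
        = (\<integral>\<^sup>+x. (\<integral>\<^sup>+z. indicator A (G (vec1 i 0 x)) * indicator {0..1} (z::real) \<partial>lborel) \<partial>?M)"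
      by (subst nn_integral_lborel_orthogonal[OF f G(1), of i]) (simp only:)
    also have "\<dots> = (\<integral>\<^sup>+x. indicator A (G (vec1 i 0 x)) \<partial>?M)"
      by (simp add: nn_integral_cmult)
    also have "\<dots> = (\<integral>\<^sup>+x. indicator {x \<in> space ?M. G (vec1 i 0 x) \<in> A} x \<partial>?M)"
      by (intro nn_integral_cong) (auto simp: indicator_def)
    also have "\<dots> = emeasure ?M {x \<in> space ?M. G (vec1 i 0 x) \<in> A}"
      by (subst nn_integral_indicator) measurable
    finally show ?thesis .
  qed
  from *[OF G] *[OF H] show ?thesis by simp
qed

text \<open>\<open>subspace_volume\<close> indexes coordinates by the basis vectors themselves; this
  transports them to the fixed index set \<open>UNIV - {i}\<close>.\<close>

lemma EM_reindex:
  assumes bij: "bij_betw \<phi> I J" and fin: "finite I"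
  shows "distr (EM J) (EM I) (\<lambda>c. \<lambda>k\<in>I. c (\<phi> k)) = EM I"
proof (rule lebesgue_prod.PiM_eqI[OF fin])
  have J: "J = \<phi> ` I" and inj: "inj_on \<phi> I" using bij by (auto simp: bij_betw_def)
  have m: "(\<lambda>c. \<lambda>k\<in>I. c (\<phi> k)) \<in> EM J \<rightarrow>\<^sub>M EM I"
    using J by (intro measurable_restrict measurable_component_singleton) auto
  fix A :: "'a \<Rightarrow> real set" assume A: "\<And>k. k \<in> I \<Longrightarrow> A k \<in> sets lborel"
  have "(\<lambda>c. \<lambda>k\<in>I. c (\<phi> k)) -` Pi\<^sub>E I A \<inter> space (EM J) = Pi\<^sub>E J (\<lambda>b. A (the_inv_into I \<phi> b))"
    using inj unfolding J by (auto simp: space_PiM PiE_iff the_inv_into_f_f)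
  moreover have "A (the_inv_into I \<phi> b) \<in> sets lborel" if "b \<in> J" for b
    using that A inj unfolding J by (auto simp: the_inv_into_f_f)
  ultimately have "emeasure (distr (EM J) (EM I) (\<lambda>c. \<lambda>k\<in>I. c (\<phi> k))) (Pi\<^sub>E I A)
      = (\<Prod>b\<in>J. emeasure lborel (A (the_inv_into I \<phi> b)))"
    using A fin J by (subst emeasure_distr[OF m]) (auto simp: lebesgue_prod.emeasure_PiM)
  also have "\<dots> = (\<Prod>k\<in>I. emeasure lborel (A k))"
    unfolding J using inj by (simp add: prod.reindex the_inv_into_f_f)
  finally show "emeasure (distr (EM J) (EM I) (\<lambda>c. \<lambda>k\<in>I. c (\<phi> k))) (Pi\<^sub>E I A)
      = (\<Prod>k\<in>I. emeasure lborel (A k))" .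
qed simp

lemma orthonormal_basis_hyperplane:
  fixes \<xi> :: "'a::euclidean_space"
  assumes "norm \<xi> = 1" and B: "orthonormal_basis ({\<xi>}\<^sup>\<bottom>) B"
  shows "finite B" "card B = DIM('a) - 1" "\<And>b. b \<in> B \<Longrightarrow> b \<bullet> \<xi> = 0"
    "\<And>b b'. b \<in> B \<Longrightarrow> b' \<in> B \<Longrightarrow> b \<bullet> b' = (if b = b' then 1 else 0)"
proof -
  have orth: "pairwise orthogonal B" and n: "\<forall>b\<in>B. norm b = 1" and sp: "span B = {\<xi>}\<^sup>\<bottom>"
    and sub: "B \<subseteq> {\<xi>}\<^sup>\<bottom>"
    using B by (auto simp: orthonormal_basis_def)
  have ind: "independent B"
    using n by (intro pairwise_orthogonal_independent[OF orth]) auto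
  show fin: "finite B" using ind independent_imp_finite by blast
  have "{\<xi>}\<^sup>\<bottom> = {x. \<xi> \<bullet> x = 0}"
    by (auto simp: orthogonal_comp_def orthogonal_def)
  moreover have "\<xi> \<noteq> 0" using assms(1) by auto
  ultimately have "dim ({\<xi>}\<^sup>\<bottom>) = DIM('a) - 1" by (simp add: dim_hyperplane)
  then show "card B = DIM('a) - 1"
    using sp ind by (metis dim_eq_card_independent dim_span)
  show "b \<bullet> \<xi> = 0" if "b \<in> B" for b
    using sub that by (auto simp: orthogonal_comp_def orthogonal_def inner_commute)
  show "b \<bullet> b' = (if b = b' then 1 else 0)" if "b \<in> B" "b' \<in> B" for b b'
    using orth n that by (auto simp: pairwise_def orthogonal_def norm_eq_1)
qed

lemma orthogonal_transformation_frame: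
  fixes \<phi> :: "'n::finite \<Rightarrow> real^'n"
  assumes "\<And>k l. \<phi> k \<bullet> \<phi> l = (if k = l then 1 else 0)"
  shows "orthogonal_transformation (\<lambda>y. \<Sum>k\<in>UNIV. (y $ k) *\<^sub>R \<phi> k)"
  unfolding orthogonal_transformation_def
proof (intro conjI allI)
  show "linear (\<lambda>y. \<Sum>k\<in>UNIV. (y $ k) *\<^sub>R \<phi> k)"
    by (rule linearI) (simp_all add: scaleR_add_left sum.distrib scaleR_right.sum)
  fix v w :: "real^'n"
  have "(v $ k) *\<^sub>R \<phi> k \<bullet> (\<Sum>l\<in>UNIV. (w $ l) *\<^sub>R \<phi> l) = v $ k * w $ k" for k
    by (simp add: inner_sum_right assms if_distrib[of "(*) _"] cong: if_cong)
  then have "(\<Sum>k\<in>UNIV. (v $ k) *\<^sub>R \<phi> k \<bullet> (\<Sum>l\<in>UNIV. (w $ l) *\<^sub>R \<phi> l)) = (\<Sum>k\<in>UNIV. v $ k * w $ k)"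
    by (intro sum.cong refl)
  then show "(\<Sum>k\<in>UNIV. (v $ k) *\<^sub>R \<phi> k) \<bullet> (\<Sum>k\<in>UNIV. (w $ k) *\<^sub>R \<phi> k) = v \<bullet> w"
    unfolding inner_sum_left by (simp add: inner_vec_def)
qed

text \<open>The basis chosen inside \<open>subspace_volume\<close> is unknown, but together with
  \<open>\<xi>\<close> it is an orthonormal frame. The transformation \<open>H\<close> of this frame
  computes the volume, and \<open>emeasure_hyperplane_coords\<close> exchanges \<open>H\<close> for
  any convenient \<open>G\<close>.\<close>

lemma subspace_volume_coords:
  fixes \<xi> :: "real^'n" and G :: "real^'n \<Rightarrow> real^'n"
  assumes A: "A \<in> sets borel"
    and G: "orthogonal_transformation G" "G (axis i 1) = \<xi>"
  shows "subspace_volume ({\<xi>}\<^sup>\<bottom>) A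
       = measure (EM (UNIV - {i})) {x \<in> space (EM (UNIV - {i})). G (vec1 i 0 x) \<in> A}"
proof -
  let ?M = "EM (UNIV - {i})"
  note [measurable] = A
  have n\<xi>: "norm \<xi> = 1"
    using orthogonal_transformation_norm[OF G(1), of "axis i 1"] G(2) by simp
  define B where "B = (SOME B. orthonormal_basis ({\<xi>}\<^sup>\<bottom>) B)"
  have "\<exists>B. orthonormal_basis ({\<xi>}\<^sup>\<bottom>) B"
    using orthonormal_basis_subspace[OF subspace_orthogonal_comp[of "{\<xi>}"]]
    unfolding orthonormal_basis_def by metis
  then have B: "orthonormal_basis ({\<xi>}\<^sup>\<bottom>) B"
    unfolding B_def by (rule someI_ex)
  note B' = orthonormal_basis_hyperplane[OF n\<xi> B]
  have "card (UNIV - {i}) = card B" by (simp add: B'(2) card_Diff_singleton)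
  then obtain \<phi> where \<phi>: "bij_betw \<phi> (UNIV - {i}) B"
    using B'(1) by (metis finite finite_same_card_bij)
  define \<psi> where "\<psi> k = (if k = i then \<xi> else \<phi> k)" for k
  have \<phi>B: "\<phi> k \<in> B" if "k \<noteq> i" for k using \<phi> that by (auto simp: bij_betw_def)
  have \<phi>inj: "\<phi> k = \<phi> l \<longleftrightarrow> k = l" if "k \<noteq> i" "l \<noteq> i" for k l
    using \<phi> that by (auto simp: bij_betw_def inj_on_def)
  have "\<xi> \<bullet> \<xi> = 1" using n\<xi> by (simp add: norm_eq_1)
  then have \<psi>: "\<psi> k \<bullet> \<psi> l = (if k = l then 1 else 0)" for k l
    using B'(3)[OF \<phi>B[of k]] B'(3)[OF \<phi>B[of l]] B'(4)[OF \<phi>B[of k] \<phi>B[of l]] \<phi>inj[of k l]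
    by (auto simp add: \<psi>_def inner_commute[of \<xi> "\<phi> l"])
  define H where "H y = (\<Sum>k\<in>UNIV. (y $ k) *\<^sub>R \<psi> k)" for y
  have "orthogonal_transformation H"
    unfolding H_def[abs_def] by (rule orthogonal_transformation_frame[OF \<psi>])
  moreover have "H (axis i 1) = (\<Sum>k\<in>{i}. (axis i 1 $ k) *\<^sub>R \<psi> k)"
    unfolding H_def by (rule sum.mono_neutral_right) (auto simp: axis_def)
  ultimately have H: "orthogonal_transformation H" "H (axis i 1) = \<xi>"
    by (auto simp: axis_def \<psi>_def)
  have [measurable]: "H \<in> borel_measurable borel" by (rule borel_measurable_orthogonal[OF H(1)])
  let ?r = "\<lambda>c. \<lambda>k\<in>UNIV - {i}. c (\<phi> k)"
  have r: "?r \<in> EM B \<rightarrow>\<^sub>M ?M"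
    using \<phi>B by (intro measurable_restrict measurable_component_singleton) auto
  have Hr: "H (vec1 i 0 (?r c)) = (\<Sum>b\<in>B. c b *\<^sub>R b)" for c
  proof -
    have "H (vec1 i 0 (?r c)) = (\<Sum>k\<in>UNIV - {i}. c (\<phi> k) *\<^sub>R \<phi> k)"
      unfolding H_def by (rule sum.mono_neutral_cong_right) (auto simp: vec1_def \<psi>_def)
    also have "\<dots> = (\<Sum>b\<in>B. c b *\<^sub>R b)"
      using sum.reindex_bij_betw[OF \<phi>] by simp
    finally show ?thesis .
  qed
  have "emeasure (EM B) {c \<in> space (EM B). (\<Sum>b\<in>B. c b *\<^sub>R b) \<in> A}
      = emeasure ?M {x \<in> space ?M. H (vec1 i 0 x) \<in> A}"
    (is "_ = emeasure _ ?X")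
  proof -
    have X: "?X \<in> sets ?M" by measurable
    have "emeasure ?M ?X = emeasure (distr (EM B) ?M ?r) ?X"
      by (simp only: EM_reindex[OF \<phi> finite])
    also have "\<dots> = emeasure (EM B) (?r -` ?X \<inter> space (EM B))"
      by (rule emeasure_distr[OF r X])
    also have "?r -` ?X \<inter> space (EM B) = {c \<in> space (EM B). (\<Sum>b\<in>B. c b *\<^sub>R b) \<in> A}"
      using measurable_space[OF r] by (auto simp: Hr)
    finally show ?thesis by simp
  qed
  then have "measure (EM B) {c \<in> space (EM B). (\<Sum>b\<in>B. c b *\<^sub>R b) \<in> A}
      = measure ?M {x \<in> space ?M. H (vec1 i 0 x) \<in> A}"
    by (simp add: measure_def)
  then show ?thesis
    unfolding subspace_volume_def Let_def B_def[symmetric]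
    using emeasure_hyperplane_coords[OF A G H] by (simp add: measure_def)
qed

section \<open>Position of a hyperplane relative to the axis\<close>

lemma exists_reflection:
  fixes a b :: "'a::euclidean_space"
  assumes "norm a = norm b"
  obtains f :: "'a \<Rightarrow> 'a" where "orthogonal_transformation f" "f a = b"
    "\<And>y. y \<bullet> a = 0 \<Longrightarrow> y \<bullet> b = 0 \<Longrightarrow> f y = y"
proof
  \<comment> \<open>The reflection in the hyperplane orthogonal to \<open>a - b\<close>; for
    \<open>a = b\<close> it is the identity.\<close>
  define d where "d = a - b"
  define f where "f y = y - (2 * (y \<bullet> d) / (d \<bullet> d)) *\<^sub>R d" for y
  have "linear f"
    unfolding f_def[abs_def]
    by (rule linearI) (simp_all add: inner_add_left algebra_simps add_divide_distrib)
  moreover have "f v \<bullet> f w = v \<bullet> w" for v w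
  proof (cases "d = 0")
    case False
    have "(v - \<alpha> *\<^sub>R d) \<bullet> (w - \<beta> *\<^sub>R d) = v \<bullet> w - \<beta> * (v \<bullet> d) - \<alpha> * (w \<bullet> d) + \<alpha> * \<beta> * (d \<bullet> d)" for \<alpha> \<beta>
      by (simp add: inner_diff_left inner_diff_right inner_commute[of d w] algebra_simps)
    then show ?thesis using False unfolding f_def by simp
  qed (simp add: f_def)
  ultimately show "orthogonal_transformation f" by (simp add: orthogonal_transformation_def)
  show "f a = b"
  proof (cases "d = 0")
    case False
    have "a \<bullet> a = b \<bullet> b" using assms by (simp add: norm_eq)
    then have "2 * (a \<bullet> d) = d \<bullet> d"
      by (simp add: d_def inner_diff_left inner_diff_right inner_commute)
    then show ?thesis using False by (simp add: f_def) (simp add: d_def)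
  qed (simp add: d_def f_def)
  show "f y = y" if "y \<bullet> a = 0" "y \<bullet> b = 0" for y
    using that by (simp add: f_def d_def inner_diff_right)
qed

lemma orthogonal_transformation_rotation:
  fixes i j :: "'n::finite"
  assumes "i \<noteq> j" "c\<^sup>2 + s\<^sup>2 = (1::real)"
  shows "orthogonal_transformation (\<lambda>y :: real^'n. y + ((c - 1) * y $ i + s * y $ j) *\<^sub>R axis i 1
             + ((c - 1) * y $ j - s * y $ i) *\<^sub>R axis j 1)" (is "orthogonal_transformation ?R")
  unfolding orthogonal_transformation
proof (intro conjI allI)
  show "linear ?R" by (rule linearI) (simp_all add: algebra_simps)
  fix v :: "real^'n"
  have ab: "(v + \<alpha> *\<^sub>R a + \<beta> *\<^sub>R b) \<bullet> (v + \<alpha> *\<^sub>R a + \<beta> *\<^sub>R b)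
      = v \<bullet> v + 2 * \<alpha> * (v \<bullet> a) + 2 * \<beta> * (v \<bullet> b) + \<alpha>\<^sup>2 + \<beta>\<^sup>2"
    if "a \<bullet> a = 1" "b \<bullet> b = 1" "a \<bullet> b = 0" for \<alpha> \<beta> :: real and a b :: "real^'n"
    using that by (simp add: inner_add_left inner_add_right inner_commute[of a v] inner_commute[of b v] inner_commute[of b a]
        power2_eq_square algebra_simps)
  have "axis i (1::real) \<bullet> axis j 1 = 0" using assms(1) by (simp add: inner_axis_axis)
  then have "?R v \<bullet> ?R v = v \<bullet> v + (c\<^sup>2 + s\<^sup>2 - 1) * ((v$i)\<^sup>2 + (v$j)\<^sup>2)"
    by (subst ab) (simp_all add: inner_axis_axis inner_axis power2_eq_square algebra_simps)
  then show "norm (?R v) = norm v" using assms(2) by (simp add: norm_eq)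
qed

text \<open>A body of revolution sees only the angle between \<open>\<xi>\<close> and the axis.
  \<open>G\<close> rotates by this angle in the coordinate plane of \<open>i\<close> and
  \<open>j\<close> and then applies an \<open>F\<close> that fixes the axis and will be absorbed by
  the symmetry of the body. Replacing \<open>\<xi>\<close> by \<open>- \<xi>\<close> makes
  \<open>c\<close> nonnegative and does not change the hyperplane.\<close>

lemma hyperplane_frame:
  fixes \<xi> :: "real^'n"
  assumes "i \<noteq> j" "norm \<xi> = 1"
  obtains c s :: real and F G :: "real^'n \<Rightarrow> real^'n"
  where "0 \<le> c" "0 \<le> s" "c\<^sup>2 + s\<^sup>2 = 1" "orthogonal_transformation F" "F (axis i 1) = axis i 1"
    "orthogonal_transformation G" "G (axis i 1) = \<xi> \<or> G (axis i 1) = - \<xi>"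
    "\<And>z x. G (vec1 i z x) = F (vec1 i (z * c + x j * s) (x(j := x j * c - z * s)))"
proof -
  define e :: "real^'n" where "e = axis i 1"
  define c where "c = \<bar>\<xi> \<bullet> e\<bar>"
  define \<xi>' where "\<xi>' = (if \<xi> \<bullet> e \<ge> 0 then \<xi> else - \<xi>)"
  have \<xi>': "\<xi>' \<bullet> \<xi>' = 1" "\<xi>' \<bullet> e = c" and ee: "e \<bullet> e = 1"
    using assms(2) by (auto simp: \<xi>'_def c_def norm_eq_1 e_def inner_axis)
  have c1: "c \<le> 1"
    using Cauchy_Schwarz_ineq2[of \<xi> e] assms(2) by (simp add: c_def e_def)
  define s where "s = sqrt (1 - c\<^sup>2)"
  have c0: "0 \<le> c" by (simp add: c_def)
  then have c2: "c\<^sup>2 \<le> 1" using c1 by (simp add: power_le_one)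
  have s: "0 \<le> s" "c\<^sup>2 + s\<^sup>2 = 1" using c2 by (auto simp: s_def)
  \<comment> \<open>The unit vector orthogonal to the axis with
    \<open>\<xi>' = c *\<^sub>R e - s *\<^sub>R \<eta>\<close>; if \<open>\<xi>'\<close> is the axis
    itself, any such unit vector will do. The reflection taking \<open>axis j 1\<close> to
    \<open>\<eta>\<close> fixes \<open>e\<close>, which is orthogonal to both.\<close>
  define \<eta> where "\<eta> = (if s = 0 then axis j 1 else (1 / s) *\<^sub>R (c *\<^sub>R e - \<xi>'))"
  have ex: "(c *\<^sub>R e - \<xi>') \<bullet> (c *\<^sub>R e - \<xi>') = s\<^sup>2"
    using \<xi>' ee s(2) by (simp add: inner_diff_left inner_diff_right inner_commute[of e \<xi>'] power2_eq_square algebra_simps)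
  have dec: "\<xi>' = c *\<^sub>R e - s *\<^sub>R \<eta>"
    using ex by (auto simp: \<eta>_def)
  have ej: "e \<bullet> axis j 1 = 0" using assms(1) by (simp add: e_def inner_axis_axis)
  have \<eta>: "norm \<eta> = 1" "e \<bullet> \<eta> = 0"
    subgoal using ex s(1) by (auto simp: \<eta>_def norm_eq_sqrt_inner power2_eq_square)
    subgoal using \<xi>' ee ej by (simp add: \<eta>_def inner_diff_right inner_commute[of e \<xi>'])
    done
  have "norm (axis j 1 :: real^'n) = norm \<eta>" using \<eta>(1) by simp
  then obtain F :: "real^'n \<Rightarrow> real^'n" where F: "orthogonal_transformation F" "F (axis j 1) = \<eta>"
    and fix_: "\<And>y. y \<bullet> axis j 1 = 0 \<Longrightarrow> y \<bullet> \<eta> = 0 \<Longrightarrow> F y = y"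
    by (rule exists_reflection) blast
  have Fe: "F e = e"
    using ej \<eta>(2) by (rule fix_)
  define R :: "real^'n \<Rightarrow> real^'n" where "R = (\<lambda>y. y + ((c - 1) * y $ i + s * y $ j) *\<^sub>R axis i 1
             + ((c - 1) * y $ j - s * y $ i) *\<^sub>R axis j 1)"
  have R: "orthogonal_transformation R"
    unfolding R_def by (rule orthogonal_transformation_rotation[OF assms(1) s(2)])
  have Rv: "R (vec1 i z x) = vec1 i (z * c + x j * s) (x(j := x j * c - z * s))" for z x
    using assms(1) by (auto simp: R_def vec1_def vec_eq_iff axis_def algebra_simps)
  have linF: "linear F" using F(1) by (rule orthogonal_transformation_linear)
  have "R (axis i 1) = c *\<^sub>R e - s *\<^sub>R axis j 1"
    using assms(1) by (auto simp: R_def e_def vec_eq_iff axis_def)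
  then have "F (R (axis i 1)) = \<xi>'"
    by (simp add: linear_diff[OF linF] linear_scale[OF linF] Fe F(2) dec)
  then have "(F \<circ> R) (axis i 1) = \<xi> \<or> (F \<circ> R) (axis i 1) = - \<xi>" by (simp add: \<xi>'_def)
  moreover have "orthogonal_transformation (F \<circ> R)"
    using F(1) R by (rule orthogonal_transformation_compose)
  ultimately show ?thesis
    using c0 s F(1) Fe Rv by (intro that[of c s F "F \<circ> R"]) (simp_all add: e_def)
qed

definition revolution_about :: "'n::finite \<Rightarrow> (real^'n) set \<Rightarrow> bool" where
  "revolution_about i L \<longleftrightarrow>
     (\<forall>f. orthogonal_transformation f \<and> f (axis i 1) = axis i 1 \<longrightarrow> f ` L = L)"

text \<open>The numbers \<open>c\<close> and \<open>s\<close> depend on \<open>\<xi>\<close> alone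
  and serve every \<open>L\<close>, so that two bodies can be compared in the same coordinates. Here
  \<open>z\<close> is the coordinate along the normal: a section sets it to 0, a projection
  quantifies over it.\<close>

lemma revolution_volumes:
  fixes \<xi> :: "real^'n"
  assumes "i \<noteq> j" "norm \<xi> = 1"
  obtains c s :: real
  where "0 \<le> c" "0 \<le> s" "c\<^sup>2 + s\<^sup>2 = 1"
    "\<And>L. compact L \<Longrightarrow> revolution_about i L \<Longrightarrow>
       {x \<in> space (EM (UNIV - {i})). vec1 i (x j * s) (x(j := x j * c)) \<in> L} \<in> sets (EM (UNIV - {i})) \<and>
       subspace_volume ({\<xi>}\<^sup>\<bottom>) (L \<inter> {\<xi>}\<^sup>\<bottom>) = measure (EM (UNIV - {i}))
         {x \<in> space (EM (UNIV - {i})). vec1 i (x j * s) (x(j := x j * c)) \<in> L}"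
    "\<And>L. compact L \<Longrightarrow> revolution_about i L \<Longrightarrow>
       {x \<in> space (EM (UNIV - {i})). \<exists>z. vec1 i (z * c + x j * s) (x(j := x j * c - z * s)) \<in> L} \<in> sets (EM (UNIV - {i})) \<and>
       subspace_volume ({\<xi>}\<^sup>\<bottom>) (orth_projection ({\<xi>}\<^sup>\<bottom>) L) = measure (EM (UNIV - {i}))
         {x \<in> space (EM (UNIV - {i})). \<exists>z. vec1 i (z * c + x j * s) (x(j := x j * c - z * s)) \<in> L}"
proof -
  let ?M = "EM (UNIV - {i})"
  obtain c s :: real and F G :: "real^'n \<Rightarrow> real^'n"
  where cs: "0 \<le> c" "0 \<le> s" "c\<^sup>2 + s\<^sup>2 = 1"
    and F: "orthogonal_transformation F" "F (axis i 1) = axis i 1"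
    and G: "orthogonal_transformation G" "G (axis i 1) = \<xi> \<or> G (axis i 1) = - \<xi>"
    and GF: "\<And>z x. G (vec1 i z x) = F (vec1 i (z * c + x j * s) (x(j := x j * c - z * s)))"
    using hyperplane_frame[OF assms] by metis
  define \<zeta> where "\<zeta> = G (axis i 1)"
  have \<zeta>\<zeta>: "\<zeta> \<bullet> \<zeta> = 1"
    using G(2) assms(2) by (auto simp: \<zeta>_def norm_eq_1)
  have perp: "{\<xi>}\<^sup>\<bottom> = {x. x \<bullet> \<zeta> = 0}"
    using G(2) by (auto simp: \<zeta>_def orthogonal_comp_def orthogonal_def inner_commute)
  then have perp': "{\<xi>}\<^sup>\<bottom> = {\<zeta>}\<^sup>\<bottom>"
    by (auto simp: orthogonal_comp_def orthogonal_def inner_commute)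
  have lin: "linear G" using G(1) by (rule orthogonal_transformation_linear)
  have [measurable]: "G \<in> borel_measurable borel" by (rule borel_measurable_orthogonal[OF G(1)])
  have Gi: "G (vec1 i z x) \<bullet> \<zeta> = z" for z x
  proof -
    have "G (vec1 i z x) \<bullet> \<zeta> = vec1 i z x \<bullet> axis i 1"
      using G(1) unfolding \<zeta>_def by (metis orthogonal_transformation_def)
    then show ?thesis by (simp add: inner_axis vec1_def)
  qed
  have Gs: "G (vec1 i z x) = G (vec1 i 0 x) + z *\<^sub>R \<zeta>" for z x
    using lin by (simp add: vec1_split[of i z] linear_add linear_scale \<zeta>_def)
  have FL: "F y \<in> L \<longleftrightarrow> y \<in> L" if "revolution_about i L" for y L
  proof -
    have "F ` L = L" using that F by (simp add: revolution_about_def)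
    then show ?thesis using orthogonal_transformation_inj[OF F(1)] by (metis inj_image_mem_iff)
  qed
  show ?thesis
  proof (rule that[OF cs])
    fix L :: "(real^'n) set" assume L: "compact L" "revolution_about i L"
    have [measurable]: "L \<in> sets borel" using L(1) by (simp add: borel_compact)
    have "closed ({\<xi>}\<^sup>\<bottom>)" unfolding perp by (intro closed_Collect_eq continuous_intros)
    then have [measurable]: "L \<inter> {\<xi>}\<^sup>\<bottom> \<in> sets borel" by (simp add: borel_closed)
    have eq: "G (vec1 i 0 x) \<in> L \<inter> {\<xi>}\<^sup>\<bottom> \<longleftrightarrow> vec1 i (x j * s) (x(j := x j * c)) \<in> L" for x
      using Gi[of 0 x] GF[of 0 x] FL[OF L(2)] by (simp add: perp)
    have "{x \<in> space ?M. G (vec1 i 0 x) \<in> L \<inter> {\<xi>}\<^sup>\<bottom>} \<in> sets ?M"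
      by measurable
    moreover have "subspace_volume ({\<xi>}\<^sup>\<bottom>) (L \<inter> {\<xi>}\<^sup>\<bottom>) = measure ?M
         {x \<in> space ?M. G (vec1 i 0 x) \<in> L \<inter> {\<xi>}\<^sup>\<bottom>}"
      unfolding perp' by (rule subspace_volume_coords[OF _ G(1) \<zeta>_def[symmetric]]) (simp add: perp'[symmetric])
    ultimately show "{x \<in> space ?M. vec1 i (x j * s) (x(j := x j * c)) \<in> L} \<in> sets ?M \<and>
       subspace_volume ({\<xi>}\<^sup>\<bottom>) (L \<inter> {\<xi>}\<^sup>\<bottom>) = measure ?M
         {x \<in> space ?M. vec1 i (x j * s) (x(j := x j * c)) \<in> L}"
      unfolding eq by simp
  next
    fix L :: "(real^'n) set" assume L: "compact L" "revolution_about i L"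
    let ?\<pi> = "\<lambda>p. p - (p \<bullet> \<zeta>) *\<^sub>R \<zeta>"
    have op: "orth_projection ({\<xi>}\<^sup>\<bottom>) L = ?\<pi> ` L"
    proof safe
      fix y assume "y \<in> orth_projection ({\<xi>}\<^sup>\<bottom>) L"
      then obtain p where y: "y \<bullet> \<zeta> = 0" and p: "p \<in> L" and
        o: "\<And>z. z \<bullet> \<zeta> = 0 \<Longrightarrow> (p - y) \<bullet> z = 0"
        by (auto simp: orth_projection_def perp orthogonal_def)
      \<comment> \<open>The component of \<open>p - y\<close> in the hyperplane. Since
        \<open>p - y\<close> is orthogonal to the whole hyperplane, \<open>q\<close> is orthogonal
        to itself.\<close>
      define q where "q = ?\<pi> (p - y)"
      have q: "q \<bullet> \<zeta> = 0" using \<zeta>\<zeta> by (simp add: q_def inner_diff_left)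
      have "q \<bullet> q = (p - y) \<bullet> q - ((p - y) \<bullet> \<zeta>) * (q \<bullet> \<zeta>)"
        unfolding inner_commute[of q \<zeta>] by (subst (1) q_def) (simp only: inner_diff_left[of "p - y"] inner_scaleR_left)
      then have "q = 0" using q o[OF q] by simp
      then have "y = ?\<pi> p" using y by (simp add: q_def inner_diff_left algebra_simps)
      then show "y \<in> ?\<pi> ` L" using p by auto
    next
      fix p assume p: "p \<in> L"
      have "?\<pi> p \<bullet> \<zeta> = 0" using \<zeta>\<zeta> by (simp add: inner_diff_left)
      then show "?\<pi> p \<in> orth_projection ({\<xi>}\<^sup>\<bottom>) L"
        using p inner_commute[of \<zeta>] by (auto simp: orth_projection_def perp orthogonal_def intro!: bexI[of _ p])
    qed
    have "compact (?\<pi> ` L)"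
      by (intro compact_continuous_image continuous_intros L)
    then have [measurable]: "?\<pi> ` L \<in> sets borel" by (simp add: borel_compact)
    have eq: "G (vec1 i 0 x) \<in> ?\<pi> ` L \<longleftrightarrow> (\<exists>z. vec1 i (z * c + x j * s) (x(j := x j * c - z * s)) \<in> L)" for x
    proof
      assume "G (vec1 i 0 x) \<in> ?\<pi> ` L"
      then obtain p where p: "p \<in> L" "G (vec1 i 0 x) = ?\<pi> p" by auto
      then have "G (vec1 i (p \<bullet> \<zeta>) x) \<in> L" by (simp add: Gs[of "p \<bullet> \<zeta>"])
      then show "\<exists>z. vec1 i (z * c + x j * s) (x(j := x j * c - z * s)) \<in> L"
        using GF FL[OF L(2)] by auto
    next
      assume "\<exists>z. vec1 i (z * c + x j * s) (x(j := x j * c - z * s)) \<in> L"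
      then obtain z where "G (vec1 i z x) \<in> L" using GF FL[OF L(2)] by auto
      moreover have "G (vec1 i 0 x) = ?\<pi> (G (vec1 i z x))" unfolding Gi by (simp add: Gs[of z])
      ultimately show "G (vec1 i 0 x) \<in> ?\<pi> ` L" by auto
    qed
    have "{x \<in> space ?M. G (vec1 i 0 x) \<in> ?\<pi> ` L} \<in> sets ?M"
      by measurable
    moreover have "subspace_volume ({\<xi>}\<^sup>\<bottom>) (?\<pi> ` L) = measure ?M
         {x \<in> space ?M. G (vec1 i 0 x) \<in> ?\<pi> ` L}"
      unfolding perp' by (rule subspace_volume_coords[OF _ G(1) \<zeta>_def[symmetric]]) simp
    ultimately show "{x \<in> space ?M. \<exists>z. vec1 i (z * c + x j * s) (x(j := x j * c - z * s)) \<in> L} \<in> sets ?M \<and>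
       subspace_volume ({\<xi>}\<^sup>\<bottom>) (orth_projection ({\<xi>}\<^sup>\<bottom>) L) = measure ?M
         {x \<in> space ?M. \<exists>z. vec1 i (z * c + x j * s) (x(j := x j * c - z * s)) \<in> L}"
      unfolding op eq by simp
  qed
qed

section \<open>Scaling and balls in coordinate space\<close>

lemma nn_integral_EM_affine:
  fixes f :: "('n \<Rightarrow> real) \<Rightarrow> ennreal"
  assumes "finite I" "0 < a" "f \<in> borel_measurable (EM I)"
  shows "(\<integral>\<^sup>+x. f x \<partial>EM I) = ennreal (a ^ card I) * (\<integral>\<^sup>+x. f (\<lambda>k\<in>I. b k + a * x k) \<partial>EM I)"
  using assms(1,3)
proof (induction I arbitrary: f rule: finite_induct)
  case empty
  then show ?case by (simp add: PiM_empty restrict_def nn_integral_count_space_finite)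
next
  case (insert k I)
  note [measurable] = insert.prems
  interpret I: sigma_finite_measure "EM I" using insert.hyps(1) by (rule sigma_finite_EM)
  have upd[measurable]: "(\<lambda>(x, y). x(k := y)) \<in> EM I \<Otimes>\<^sub>M lborel \<rightarrow>\<^sub>M EM (insert k I)"
    using measurable_add_dim by simp
  have [measurable]: "(\<lambda>x. \<lambda>l\<in>insert k I. b l + a * x l) \<in> EM (insert k I) \<rightarrow>\<^sub>M EM (insert k I)"
    by (intro measurable_restrict) measurable
  have upd1[measurable]: "(\<lambda>y. x(k := y)) \<in> borel \<rightarrow>\<^sub>M EM (insert k I)" if "x \<in> space (EM I)" for x
    using that measurable_fun_upd[of "insert k I" I k "\<lambda>_. x" borel "\<lambda>_. lborel" "\<lambda>y. y"] by simp
  define g where "g x = (\<integral>\<^sup>+y. f (x(k := b k + a * y)) \<partial>lborel)" for x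
  have [measurable]: "(\<lambda>(x, y). f (x(k := b k + a * y))) \<in> borel_measurable (EM I \<Otimes>\<^sub>M lborel)"
  proof -
    have "(\<lambda>(x, y). (x, b k + a * y)) \<in> EM I \<Otimes>\<^sub>M lborel \<rightarrow>\<^sub>M EM I \<Otimes>\<^sub>M lborel" by measurable
    from measurable_compose[OF measurable_compose[OF this upd] insert.prems] show ?thesis
      by (simp add: case_prod_beta)
  qed
  have g[measurable]: "g \<in> borel_measurable (EM I)"
    unfolding g_def by measurable
  have "(\<integral>\<^sup>+x. f x \<partial>EM (insert k I)) = (\<integral>\<^sup>+x. (\<integral>\<^sup>+y. f (x(k := y)) \<partial>lborel) \<partial>EM I)"
    using insert.hyps insert.prems by (rule lebesgue_prod.product_nn_integral_insert)
  also have "\<dots> = (\<integral>\<^sup>+x. ennreal a * g x \<partial>EM I)"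
  proof (rule nn_integral_cong)
    fix x assume x: "x \<in> space (EM I)"
    have m: "(\<lambda>y. f (x(k := y))) \<in> borel_measurable borel"
      by (rule measurable_compose[OF upd1[OF x] insert.prems])
    show "(\<integral>\<^sup>+y. f (x(k := y)) \<partial>lborel) = ennreal a * g x"
      unfolding g_def by (subst nn_integral_real_affine[OF m, of a "b k"]) (use assms(2) in simp_all)
  qed
  also have "\<dots> = ennreal a * (ennreal (a ^ card I) * (\<integral>\<^sup>+x. g (\<lambda>l\<in>I. b l + a * x l) \<partial>EM I))"
    unfolding insert.IH[OF g, symmetric] by (rule nn_integral_cmult[OF g])
  also have "(\<integral>\<^sup>+x. g (\<lambda>l\<in>I. b l + a * x l) \<partial>EM I)
      = (\<integral>\<^sup>+x. (\<integral>\<^sup>+y. f (\<lambda>l\<in>insert k I. b l + a * (x(k := y)) l) \<partial>lborel) \<partial>EM I)"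
  proof -
    have "(\<lambda>l\<in>I. b l + a * x l)(k := b k + a * y) = (\<lambda>l\<in>insert k I. b l + a * (x(k := y)) l)" for x y
      using insert.hyps(2) by (auto simp: restrict_def fun_eq_iff)
    then show ?thesis unfolding g_def by (simp only:)
  qed
  also have "\<dots> = (\<integral>\<^sup>+x. f (\<lambda>l\<in>insert k I. b l + a * x l) \<partial>EM (insert k I))"
    using insert.hyps by (intro lebesgue_prod.product_nn_integral_insert[symmetric]) measurable
  moreover have "ennreal (a ^ card (insert k I)) = ennreal a * ennreal (a ^ card I)"
    using insert.hyps assms(2) by (simp add: ennreal_mult')
  ultimately show ?case by (simp only: mult.assoc)
qed

definition sq :: "'n set \<Rightarrow> ('n \<Rightarrow> real) \<Rightarrow> real" where
  "sq I x = (\<Sum>k\<in>I. (x k)\<^sup>2)"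

lemma sq_nonneg [simp]: "0 \<le> sq I x"
  by (simp add: sq_def sum_nonneg)

lemma sq_measurable [measurable]: "sq I \<in> borel_measurable (EM I)"
  unfolding sq_def[abs_def] by (intro borel_measurable_sum borel_measurable_power) (simp add: measurable_component_singleton)

lemma sq_insert: "finite I \<Longrightarrow> j \<notin> I \<Longrightarrow> sq (insert j I) x = (x j)\<^sup>2 + sq I x"
  by (simp add: sq_def)

lemma sq_upd [simp]: "j \<notin> I \<Longrightarrow> sq I (x(j := t)) = sq I x"
  unfolding sq_def by (intro sum.cong) auto

definition vball :: "'n set \<Rightarrow> ennreal" where
  "vball I = emeasure (EM I) {x \<in> space (EM I). sq I x \<le> 1}"

lemma vball_finite:
  assumes "finite I"
  shows "vball I < top"
proof -
  have "vball I \<le> emeasure (EM I) (Pi\<^sub>E I (\<lambda>_. {-1..1}))"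
    unfolding vball_def
  proof (rule emeasure_mono)
    show "{x \<in> space (EM I). sq I x \<le> 1} \<subseteq> Pi\<^sub>E I (\<lambda>_. {-1..1})"
    proof
      fix x assume x: "x \<in> {x \<in> space (EM I). sq I x \<le> 1}"
      have "(x k)\<^sup>2 \<le> 1" if "k \<in> I" for k
        using member_le_sum[OF that, of "\<lambda>k. (x k)\<^sup>2"] assms x by (auto simp: sq_def)
      then have "- 1 \<le> x k \<and> x k \<le> 1" if "k \<in> I" for k
        using that by (metis abs_le_iff abs_square_le_1 minus_le_iff)
      then show "x \<in> Pi\<^sub>E I (\<lambda>_. {-1..1})" using x by (simp add: space_PiM PiE_iff)
    qed
  qed (use assms in \<open>auto intro!: sets_PiM_I_finite\<close>)
  also have "\<dots> = ennreal (2 ^ card I)"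
    using assms by (simp add: lebesgue_prod.emeasure_PiM flip: ennreal_power)
  also have "\<dots> < top" by simp
  finally show ?thesis .
qed

lemma vball_pos:
  assumes "finite I"
  shows "0 < vball I"
proof -
  \<comment> \<open>Small enough for the cube with edge \<open>d\<close> to fit into the ball: each
    squared coordinate is at most \<open>d\<close>, and \<open>card I\<close> of them add up to at
    most 1.\<close>
  define d where "d = 1 / (real (card I) + 1)"
  have d: "0 < d" "d \<le> 1" "real (card I) * d \<le> 1" by (auto simp: d_def field_simps)
  have "(0::ennreal) < ennreal (d ^ card I)" using d by simp
  also have "\<dots> = emeasure (EM I) (Pi\<^sub>E I (\<lambda>_. {0..d}))"
    using assms d by (simp add: lebesgue_prod.emeasure_PiM ennreal_power)
  also have "\<dots> \<le> vball I"
    unfolding vball_def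
  proof (rule emeasure_mono)
    show "Pi\<^sub>E I (\<lambda>_. {0..d}) \<subseteq> {x \<in> space (EM I). sq I x \<le> 1}"
    proof
      fix x assume x: "x \<in> Pi\<^sub>E I (\<lambda>_. {0..d})"
      have "(x k)\<^sup>2 \<le> d" if "k \<in> I" for k
      proof -
        have "0 \<le> x k" "x k \<le> d" using x that by (auto simp: PiE_iff)
        then have "x k * x k \<le> d * 1" using d by (intro mult_mono) auto
        then show ?thesis by (simp add: power2_eq_square)
      qed
      then have "sq I x \<le> (\<Sum>k\<in>I. d)" unfolding sq_def by (rule sum_mono)
      also have "\<dots> \<le> 1" using d by simp
      finally show "x \<in> {x \<in> space (EM I). sq I x \<le> 1}" using x by (auto simp: space_PiM PiE_iff)
    qed
  qed measurable
  finally show ?thesis .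
qed

lemma emeasure_shifted_ball:
  assumes I: "finite I" "j \<notin> I" and r: "0 < r"
  shows "emeasure (EM (insert j I)) {x \<in> space (EM (insert j I)). (x j - d)\<^sup>2 + sq I x \<le> r\<^sup>2}
       = ennreal (r ^ Suc (card I)) * vball (insert j I)"
proof -
  let ?J = "insert j I"
  let ?A = "{x \<in> space (EM ?J). (x j - d)\<^sup>2 + sq I x \<le> r\<^sup>2}"
  let ?b = "\<lambda>k. if k = j then d else 0"
  have sqI: "sq I \<in> borel_measurable (EM ?J)"
    unfolding sq_def[abs_def] by (intro borel_measurable_sum borel_measurable_power)
      (simp add: measurable_component_singleton)
  have A[measurable]: "?A \<in> sets (EM ?J)" using sqI by measurable
  have "emeasure (EM ?J) ?A = (\<integral>\<^sup>+x. indicator ?A x \<partial>EM ?J)" by simp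
  also have "\<dots> = ennreal (r ^ card ?J) * (\<integral>\<^sup>+x. indicator ?A (\<lambda>k\<in>?J. ?b k + r * x k) \<partial>EM ?J)"
    using I r by (intro nn_integral_EM_affine) auto
  also have "(\<integral>\<^sup>+x. indicator ?A (\<lambda>k\<in>?J. ?b k + r * x k) \<partial>EM ?J)
      = (\<integral>\<^sup>+x. indicator {x \<in> space (EM ?J). sq ?J x \<le> 1} x \<partial>EM ?J)"
  proof (rule nn_integral_cong)
    fix x assume x: "x \<in> space (EM ?J)"
    let ?y = "\<lambda>k\<in>?J. ?b k + r * x k"
    have "sq I ?y = r\<^sup>2 * sq I x"
      unfolding sq_def sum_distrib_left using I(2) by (intro sum.cong) (auto simp: power_mult_distrib)
    then have "(?y j - d)\<^sup>2 + sq I ?y = r\<^sup>2 * sq ?J x"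
      by (simp add: sq_insert[OF I] power_mult_distrib algebra_simps)
    then have "(?y j - d)\<^sup>2 + sq I ?y \<le> r\<^sup>2 \<longleftrightarrow> sq ?J x \<le> 1" using r by simp
    moreover have "?y \<in> space (EM ?J)" by (simp add: space_PiM)
    ultimately show "indicator ?A ?y = (indicator {x \<in> space (EM ?J). sq ?J x \<le> 1} x :: ennreal)"
      using x unfolding indicator_def by (simp only: mem_Collect_eq simp_thms)
  qed
  also have "\<dots> = vball ?J"
    unfolding vball_def by (rule nn_integral_indicator) measurable
  finally show ?thesis using I by simp
qed

text \<open>Slicing along \<open>j\<close>. Empty slices need no separate term: for a negative
  radicand \<open>sqrt\<close> is negative, and \<open>ennreal\<close> turns this into 0.\<close>

lemma vball_insert:
  assumes I: "finite I" "j \<notin> I"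
  shows "vball (insert j I) = (\<integral>\<^sup>+w. ennreal (2 * sqrt (1 - sq I w)) \<partial>EM I)"
proof -
  let ?J = "insert j I"
  have "vball ?J = (\<integral>\<^sup>+x. indicator {x \<in> space (EM ?J). sq ?J x \<le> 1} x \<partial>EM ?J)"
    unfolding vball_def by (rule nn_integral_indicator[symmetric]) measurable
  also have "\<dots> = (\<integral>\<^sup>+w. (\<integral>\<^sup>+t. indicator {x \<in> space (EM ?J). sq ?J x \<le> 1} (w(j := t)) \<partial>lborel) \<partial>EM I)"
    using I by (intro lebesgue_prod.product_nn_integral_insert) measurable
  also have "\<dots> = (\<integral>\<^sup>+w. ennreal (2 * sqrt (1 - sq I w)) \<partial>EM I)"
  proof (rule nn_integral_cong)
    fix w assume w: "w \<in> space (EM I)"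
    have sp: "w(j := t) \<in> space (EM ?J)" for t
      using w by (auto simp: space_PiM PiE_iff extensional_def)
    have "(indicator {x \<in> space (EM ?J). sq ?J x \<le> 1} (w(j := t)) :: ennreal)
        = indicator {- sqrt (1 - sq I w) .. sqrt (1 - sq I w)} t" for t
    proof -
      have "t\<^sup>2 + sq I w \<le> 1 \<longleftrightarrow> t\<^sup>2 \<le> 1 - sq I w" by auto
      also have "\<dots> \<longleftrightarrow> sqrt (t\<^sup>2) \<le> sqrt (1 - sq I w)" by (rule real_sqrt_le_iff[symmetric])
      also have "\<dots> \<longleftrightarrow> - sqrt (1 - sq I w) \<le> t \<and> t \<le> sqrt (1 - sq I w)" by (auto simp: abs_le_iff)
      finally show ?thesis using sp I by (simp add: indicator_def sq_insert)
    qed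
    then show "(\<integral>\<^sup>+t. indicator {x \<in> space (EM ?J). sq ?J x \<le> 1} (w(j := t)) \<partial>lborel)
        = ennreal (2 * sqrt (1 - sq I w))"
      by (cases "sq I w \<le> 1") (simp_all add: ennreal_neg)
  qed
  finally show ?thesis .
qed

section \<open>Graphs of revolution with a prescribed slope profile\<close>

lemma nn_integral_half_line_split:
  fixes f :: "real \<Rightarrow> ennreal"
  assumes [measurable]: "f \<in> borel_measurable borel" and "0 \<le> b"
  shows "(\<integral>\<^sup>+p. f p * indicator {0<..} p \<partial>lborel)
       = (\<integral>\<^sup>+p. f p * indicator {0<..<b} p \<partial>lborel) + (\<integral>\<^sup>+p. f p * indicator {b..} p \<partial>lborel)"
proof -
  have "(\<integral>\<^sup>+p. f p * indicator {0<..} p \<partial>lborel)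
      = (\<integral>\<^sup>+p. (f p * indicator {0<..<b} p + f p * indicator {b..} p) \<partial>lborel)"
  proof (rule nn_integral_cong_AE)
    show "AE p in lborel. f p * indicator {0<..} p = f p * indicator {0<..<b} p + f p * indicator {b..} p"
      by (rule AE_mp[OF AE_lborel_singleton[of 0]]) (use assms(2) in \<open>auto intro!: AE_I2 simp: indicator_def\<close>)
  qed
  then show ?thesis by (simp add: nn_integral_add)
qed

text \<open>The height over radius \<open>r\<close> is the integral of the slope over the radii from
  \<open>r\<close> to 1. Slicing by the values \<open>p\<close> of the slope turns it into the
  integral of \<open>1 - max r (a p)\<close>, the length of the set of radii beyond \<open>r\<close>
  at which the slope exceeds \<open>p\<close>.\<close>

lemma ellipse_profile_integral:
  assumes \<beta>: "0 < \<beta>" and r: "0 \<le> r" "r \<le> 1"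
  shows "(\<integral>\<^sup>+p. ennreal (1 - max r (p / sqrt (\<beta>\<^sup>2 + p\<^sup>2))) * indicator {0<..} p \<partial>lborel)
       = ennreal (\<beta> * sqrt (1 - r\<^sup>2))"
proof (cases "r = 1")
  case True
  then show ?thesis by (simp add: ennreal_neg)
next
  case False
  define \<sigma> where "\<sigma> = sqrt (1 - r\<^sup>2)"
  have r1: "r < 1" using False r by simp
  then have "r\<^sup>2 < 1" using r by (simp add: power_less_one_iff abs_square_less_1)
  then have \<sigma>: "0 < \<sigma>" "\<sigma>\<^sup>2 = 1 - r\<^sup>2" by (auto simp: \<sigma>_def)
  \<comment> \<open>The slope of the half ellipsoid at radius \<open>r\<close>, where the maximum
    switches from its first to its second argument.\<close>
  define P where "P = \<beta> * r / \<sigma>"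
  let ?e = "\<lambda>p. p / sqrt (\<beta>\<^sup>2 + p\<^sup>2)"
  have pos: "0 < \<beta>\<^sup>2 + p\<^sup>2" for p using \<beta> by (simp add: add_pos_nonneg)
  have P0: "0 \<le> P" using \<beta> r \<sigma> by (simp add: P_def)
  have "\<beta>\<^sup>2 + P\<^sup>2 = \<beta>\<^sup>2 * (\<sigma>\<^sup>2 + r\<^sup>2) / \<sigma>\<^sup>2"
    using \<sigma>(1) by (simp add: P_def power_divide power_mult_distrib field_simps)
  also have "\<dots> = (\<beta> / \<sigma>)\<^sup>2" by (simp add: \<sigma>(2) power_divide)
  finally have "\<beta>\<^sup>2 + P\<^sup>2 = (\<beta> / \<sigma>)\<^sup>2" .
  then have sP: "sqrt (\<beta>\<^sup>2 + P\<^sup>2) = \<beta> / \<sigma>" using \<beta> \<sigma> by simp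
  have e_le: "?e p \<le> r \<longleftrightarrow> p \<le> P" if "0 \<le> p" for p
  proof -
    have "?e p \<le> r \<longleftrightarrow> p \<le> r * sqrt (\<beta>\<^sup>2 + p\<^sup>2)" using pos[of p] by (simp add: field_simps)
    also have "\<dots> \<longleftrightarrow> p\<^sup>2 \<le> (r * sqrt (\<beta>\<^sup>2 + p\<^sup>2))\<^sup>2"
      using that r pos[of p] by (simp add: abs_le_square_iff[symmetric] less_imp_le)
    also have "\<dots> \<longleftrightarrow> (p * \<sigma>)\<^sup>2 \<le> (r * \<beta>)\<^sup>2"
      using pos[of p] unfolding power_mult_distrib \<sigma>(2) by (simp add: algebra_simps)
    also have "\<dots> \<longleftrightarrow> p * \<sigma> \<le> r * \<beta>"
      using that r \<beta> \<sigma> by (simp add: abs_le_square_iff[symmetric])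
    also have "\<dots> \<longleftrightarrow> p \<le> P" using \<sigma> by (simp add: P_def field_simps)
    finally show ?thesis .
  qed
  have [measurable]: "(\<lambda>p. ennreal (1 - max r (?e p))) \<in> borel_measurable borel" by measurable
  have "(\<integral>\<^sup>+p. ennreal (1 - max r (?e p)) * indicator {0<..<P} p \<partial>lborel)
      = (\<integral>\<^sup>+p. ennreal (1 - r) * indicator {0<..<P} p \<partial>lborel)"
  proof -
    have "max r (?e p) = r" if "0 < p" "p < P" for p using e_le[of p] that by simp
    then show ?thesis by (intro nn_integral_cong) (simp add: indicator_def)
  qed
  also have "\<dots> = ennreal ((1 - r) * P)"
    using P0 r by (simp add: nn_integral_cmult ennreal_mult)
  finally have 1: "(\<integral>\<^sup>+p. ennreal (1 - max r (?e p)) * indicator {0<..<P} p \<partial>lborel) = ennreal ((1 - r) * P)" .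
  have e_ge: "max r (?e p) = ?e p" if "P \<le> p" for p
  proof (cases "p = P")
    case True
    have "?e P = r" unfolding sP using \<beta> \<sigma> by (simp add: P_def)
    then show ?thesis using True by simp
  next
    case False
    then show ?thesis using e_le[of p] that P0 by auto
  qed
  have e1: "?e p \<le> 1" for p
  proof -
    have "\<bar>p\<bar> \<le> sqrt (\<beta>\<^sup>2 + p\<^sup>2)" by (rule real_le_rsqrt) simp
    then show ?thesis using pos[of p] by (simp add: field_simps)
  qed
  have "(\<integral>\<^sup>+p. ennreal (1 - max r (?e p)) * indicator {P..} p \<partial>lborel)
      = (\<integral>\<^sup>+p. ennreal (1 - ?e p) * indicator {P..} p \<partial>lborel)"
    by (intro nn_integral_cong) (simp add: indicator_def e_ge)
  also have "\<dots> = ennreal (0 - (P - sqrt (\<beta>\<^sup>2 + P\<^sup>2)))"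
  proof (rule nn_integral_FTC_atLeast)
    show "(\<lambda>p. 1 - ?e p) \<in> borel_measurable borel" by measurable
    show "((\<lambda>p. p - sqrt (\<beta>\<^sup>2 + p\<^sup>2)) has_real_derivative 1 - ?e p) (at p)" for p
      using pos[of p] by (auto intro!: derivative_eq_intros simp: field_simps)
    show "0 \<le> 1 - ?e p" for p using e1[of p] by simp
    show "((\<lambda>p. p - sqrt (\<beta>\<^sup>2 + p\<^sup>2)) \<longlongrightarrow> 0) at_top"
      using \<beta> by real_asymp
  qed
  finally have 2: "(\<integral>\<^sup>+p. ennreal (1 - max r (?e p)) * indicator {P..} p \<partial>lborel) = ennreal (\<beta> / \<sigma> - P)"
    by (simp add: sP)
  have "\<beta> / \<sigma> - P = \<beta> * (1 - r) / \<sigma>" by (simp add: P_def right_diff_distrib diff_divide_distrib)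
  then have "0 \<le> \<beta> / \<sigma> - P" using \<beta> r \<sigma> by simp
  moreover have "(1 - r) * P + (\<beta> / \<sigma> - P) = \<beta> * \<sigma>"
  proof -
    have "(1 - r) * P + (\<beta> / \<sigma> - P) = \<beta> * (1 - r\<^sup>2) / \<sigma>"
      by (simp add: P_def power2_eq_square left_diff_distrib right_diff_distrib diff_divide_distrib)
    also have "\<dots> = \<beta> * \<sigma>" using \<sigma>(1) unfolding \<sigma>(2)[symmetric] by (simp add: power2_eq_square)
    finally show ?thesis .
  qed
  ultimately show ?thesis
    using P0 r by (subst nn_integral_half_line_split[OF _ P0], measurable)
      (simp add: 1 2 ennreal_plus[symmetric] \<sigma>_def[symmetric] del: ennreal_plus)
qed

text \<open>A profile gives, for each slope \<open>p\<close>, the radius \<open>a p\<close> at which a concave graph of revolution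
  over the unit ball, vanishing on its boundary, attains that slope; \<open>\<psi>\<close> is the height of this
  graph. The profile \<open>p / sqrt (\<beta>\<^sup>2 + p\<^sup>2)\<close> belongs to the half ellipsoid of height \<open>\<beta>\<close>.\<close>

locale profile =
  fixes a :: "real \<Rightarrow> real" and \<beta> :: real
  assumes \<beta>: "0 < \<beta>"
    and a_measurable [measurable]: "a \<in> borel_measurable borel"
    and a_mono: "\<And>p q. 0 < p \<Longrightarrow> p \<le> q \<Longrightarrow> a p \<le> a q"
    and a_le_1: "\<And>p. 0 < p \<Longrightarrow> a p \<le> 1"
    and a_ge: "\<And>p. 0 < p \<Longrightarrow> p / sqrt (\<beta>\<^sup>2 + p\<^sup>2) \<le> a p"
begin

definition \<psi> :: "real \<Rightarrow> real" where
  "\<psi> r = enn2real (\<integral>\<^sup>+p. ennreal (1 - max r (a p)) * indicator {0<..} p \<partial>lborel)"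

lemma a_nonneg: "0 < p \<Longrightarrow> 0 \<le> a p"
  using a_ge[of p] by (rule order_trans[rotated]) (auto intro!: divide_nonneg_nonneg)

text \<open>A larger profile means a smaller integrand. The comparison with the ellipsoid is also
  what makes the integral finite, so that \<open>enn2real\<close> loses no information.\<close>

lemma \<psi>_le_aux:
  assumes "0 \<le> r" "r \<le> 1"
  shows "(\<integral>\<^sup>+p. ennreal (1 - max r (a p)) * indicator {0<..} p \<partial>lborel) \<le> ennreal (\<beta> * sqrt (1 - r\<^sup>2))"
  unfolding ellipse_profile_integral[OF \<beta> assms, symmetric]
proof (intro nn_integral_mono)
  fix p :: real
  show "ennreal (1 - max r (a p)) * indicator {0<..} p
      \<le> ennreal (1 - max r (p / sqrt (\<beta>\<^sup>2 + p\<^sup>2))) * indicator {0<..} p"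
  proof (cases "0 < p")
    case True
    have "1 - max r (a p) \<le> 1 - max r (p / sqrt (\<beta>\<^sup>2 + p\<^sup>2))"
      using a_ge[OF True] by (auto simp: max_def)
    then show ?thesis by (intro mult_right_mono ennreal_leI) auto
  qed simp
qed

lemma ennreal_\<psi>:
  assumes "0 \<le> r" "r \<le> 1"
  shows "ennreal (\<psi> r) = (\<integral>\<^sup>+p. ennreal (1 - max r (a p)) * indicator {0<..} p \<partial>lborel)"
  unfolding \<psi>_def using order.strict_trans1[OF \<psi>_le_aux[OF assms] ennreal_less_top] by (intro ennreal_enn2real)

lemma \<psi>_nonneg: "0 \<le> \<psi> r"
  by (simp add: \<psi>_def)

lemma \<psi>_le:
  assumes "0 \<le> r" "r \<le> 1"
  shows "\<psi> r \<le> \<beta> * sqrt (1 - r\<^sup>2)"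
proof -
  have "0 \<le> \<beta> * sqrt (1 - r\<^sup>2)" using assms \<beta> by (simp add: power_le_one)
  then show ?thesis
    using \<psi>_le_aux[OF assms] unfolding ennreal_\<psi>[OF assms, symmetric] by (simp only: ennreal_le_iff)
qed

lemma \<psi>_1 [simp]: "\<psi> 1 = 0"
  using \<psi>_le[of 1] \<psi>_nonneg[of 1] by simp

lemma \<psi>_antimono:
  assumes "0 \<le> r" "r \<le> r'" "r' \<le> 1"
  shows "\<psi> r' \<le> \<psi> r"
proof -
  have "ennreal (\<psi> r') \<le> ennreal (\<psi> r)"
    unfolding ennreal_\<psi>[OF assms(1) order_trans[OF assms(2,3)]] ennreal_\<psi>[OF order_trans[OF assms(1,2)] assms(3)]
    using assms by (intro nn_integral_mono mult_right_mono ennreal_leI) auto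
  then show ?thesis by (simp add: \<psi>_nonneg)
qed

text \<open>For each slope \<open>p\<close> the integrand \<open>1 - max r (a p)\<close> is concave
  in \<open>r\<close>.\<close>

lemma \<psi>_concave:
  assumes "0 \<le> r" "r \<le> 1" "0 \<le> r'" "r' \<le> 1" "0 \<le> u" "0 \<le> v" "u + v = 1"
  shows "u * \<psi> r + v * \<psi> r' \<le> \<psi> (u * r + v * r')"
proof -
  have c: "0 \<le> u * r + v * r'" "u * r + v * r' \<le> 1"
    using assms convex_bound_le[of r 1 r' u v] by auto
  have "ennreal (u * \<psi> r + v * \<psi> r') = ennreal u * ennreal (\<psi> r) + ennreal v * ennreal (\<psi> r')"
    using assms \<psi>_nonneg by (simp add: ennreal_mult)
  also have "\<dots> = (\<integral>\<^sup>+p. (ennreal u * (ennreal (1 - max r (a p)) * indicator {0<..} p)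
      + ennreal v * (ennreal (1 - max r' (a p)) * indicator {0<..} p)) \<partial>lborel)"
    using assms by (simp add: ennreal_\<psi> nn_integral_add nn_integral_cmult)
  also have "\<dots> \<le> ennreal (\<psi> (u * r + v * r'))"
    unfolding ennreal_\<psi>[OF c]
  proof (intro nn_integral_mono)
    fix p :: real
    show "ennreal u * (ennreal (1 - max r (a p)) * indicator {0<..} p)
      + ennreal v * (ennreal (1 - max r' (a p)) * indicator {0<..} p)
      \<le> ennreal (1 - max (u * r + v * r') (a p)) * indicator {0<..} p"
    proof (cases "0 < p")
      case True
      have n: "0 \<le> 1 - max r (a p)" "0 \<le> 1 - max r' (a p)" using a_le_1[OF True] assms by auto
      have "max (u * r + v * r') (a p) \<le> u * max r (a p) + v * max r' (a p)"
      proof (rule max.boundedI)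
        show "u * r + v * r' \<le> u * max r (a p) + v * max r' (a p)"
          using assms by (intro add_mono mult_left_mono) auto
        have "a p = u * a p + v * a p" using assms(7) by (simp flip: distrib_right)
        also have "\<dots> \<le> u * max r (a p) + v * max r' (a p)"
          using assms by (intro add_mono mult_left_mono) auto
        finally show "a p \<le> u * max r (a p) + v * max r' (a p)" .
      qed
      then have "u * (1 - max r (a p)) + v * (1 - max r' (a p)) \<le> 1 - max (u * r + v * r') (a p)"
        using assms(7) by (simp add: algebra_simps)
      then show ?thesis
        using True n assms by (simp add: ennreal_mult[symmetric] ennreal_plus[symmetric] ennreal_leI del: ennreal_plus)
    qed simp
  qed
  finally show ?thesis by (simp add: \<psi>_nonneg)
qed

text \<open>Only slopes with \<open>a p < r'\<close> contribute to the difference, each by at most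
  \<open>r' - r\<close>. By \<open>a_ge\<close> these slopes do not exceed the slope of the
  ellipsoid at \<open>r'\<close>, which is the factor in parentheses.\<close>

lemma \<psi>_lipschitz:
  assumes "0 \<le> r" "r \<le> r'" "r' < 1"
  shows "\<psi> r \<le> \<psi> r' + (r' - r) * (\<beta> * r' / sqrt (1 - r'\<^sup>2))"
proof -
  define \<sigma> where "\<sigma> = \<beta> * r' / sqrt (1 - r'\<^sup>2)"
  have sq: "0 < 1 - r'\<^sup>2" using assms by (simp add: abs_square_less_1)
  have \<sigma>0: "0 \<le> \<sigma>" using assms \<beta> sq by (simp add: \<sigma>_def)
  have small: "p \<le> \<sigma>" if "0 < p" "a p < r'" for p
  proof -
    have pos: "0 < \<beta>\<^sup>2 + p\<^sup>2" using \<beta> by (simp add: add_pos_nonneg)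
    have "p / sqrt (\<beta>\<^sup>2 + p\<^sup>2) < r'" using a_ge[OF that(1)] that(2) by simp
    then have "p \<le> r' * sqrt (\<beta>\<^sup>2 + p\<^sup>2)" using pos by (simp add: field_simps)
    then have "p\<^sup>2 \<le> (r' * sqrt (\<beta>\<^sup>2 + p\<^sup>2))\<^sup>2" using that by (intro power_mono) auto
    then have "p\<^sup>2 * (1 - r'\<^sup>2) \<le> (\<beta> * r')\<^sup>2" using pos by (simp add: power_mult_distrib algebra_simps)
    then have "sqrt (p\<^sup>2 * (1 - r'\<^sup>2)) \<le> sqrt ((\<beta> * r')\<^sup>2)" by (rule real_sqrt_le_mono)
    then have "p * sqrt (1 - r'\<^sup>2) \<le> \<beta> * r'" using that assms \<beta> by (simp add: real_sqrt_mult)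
    then show ?thesis using sq by (simp add: \<sigma>_def field_simps)
  qed
  have "ennreal (\<psi> r) \<le> (\<integral>\<^sup>+p. (ennreal (1 - max r' (a p)) * indicator {0<..} p
      + ennreal (r' - r) * indicator {0..\<sigma>} p) \<partial>lborel)"
    unfolding ennreal_\<psi>[OF assms(1) less_imp_le[OF order.strict_trans1[OF assms(2,3)]]]
  proof (intro nn_integral_mono)
    fix p :: real
    show "ennreal (1 - max r (a p)) * indicator {0<..} p
        \<le> ennreal (1 - max r' (a p)) * indicator {0<..} p + ennreal (r' - r) * indicator {0..\<sigma>} p"
    proof (cases "0 < p")
      case True
      have n: "0 \<le> 1 - max r' (a p)" using a_le_1[OF True] assms by auto
      show ?thesis
      proof (cases "a p < r'")
        case le: True
        have "1 - max r (a p) \<le> (1 - max r' (a p)) + (r' - r)" using assms by auto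
        then show ?thesis using True n assms small[OF True le]
          by (simp add: ennreal_plus[symmetric] ennreal_leI del: ennreal_plus)
      next
        case False
        then have "max r (a p) = max r' (a p)" using assms by auto
        then show ?thesis using True by simp
      qed
    qed simp
  qed
  also have "\<dots> = ennreal (\<psi> r') + ennreal (r' - r) * ennreal \<sigma>"
    using assms \<sigma>0 by (simp add: nn_integral_add nn_integral_cmult ennreal_\<psi>)
  also have "\<dots> = ennreal (\<psi> r' + (r' - r) * \<sigma>)"
    using assms \<sigma>0 by (simp add: ennreal_mult ennreal_plus \<psi>_nonneg)
  finally have "ennreal (\<psi> r) \<le> ennreal (\<psi> r' + (r' - r) * \<sigma>)" .
  moreover have "0 \<le> \<psi> r' + (r' - r) * \<sigma>" using assms \<sigma>0 by (simp add: \<psi>_nonneg)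
  ultimately show ?thesis by (simp only: ennreal_le_iff \<sigma>_def)
qed

end

text \<open>A substitute for a nonnegative derivative: over \<open>M\<close> equal steps the defects
  add up to \<open>C * (b - a)\<^sup>2 / M\<close>, which is arbitrarily small.\<close>

lemma le_if_quadratic_defect:
  fixes g :: "real \<Rightarrow> real"
  assumes "a \<le> b" and g: "\<And>x y. a \<le> x \<Longrightarrow> x \<le> y \<Longrightarrow> y \<le> b \<Longrightarrow> g x \<le> g y + C * (y - x)\<^sup>2"
  shows "g a \<le> g b"
proof (rule ccontr)
  assume "\<not> g a \<le> g b"
  then have pos: "0 < g a - g b" by simp
  obtain N :: nat where N: "C * (b - a)\<^sup>2 / (g a - g b) < real N" using reals_Archimedean2 by blast
  define M where "M = real (Suc N)"
  define d where "d = (b - a) / M"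
  have M: "0 < M" "C * (b - a)\<^sup>2 < M * (g a - g b)"
    using N pos by (auto simp: M_def field_simps)
  have d: "0 \<le> d" "M * d = b - a" using assms(1) M by (auto simp: d_def)
  have "g a \<le> g (a + real k * d) + real k * (C * d\<^sup>2)" if "k \<le> Suc N" for k
    using that
  proof (induction k)
    case (Suc k)
    have "real (Suc k) * d \<le> M * d" using Suc.prems d by (intro mult_right_mono) (auto simp: M_def)
    then have "g (a + real k * d) \<le> g (a + real (Suc k) * d) + C * (a + real (Suc k) * d - (a + real k * d))\<^sup>2"
      using d by (intro g) (auto simp: algebra_simps)
    then show ?case using Suc by (simp add: algebra_simps)
  qed simp
  from this[of "Suc N"] have "g a \<le> g (a + M * d) + M * (C * d\<^sup>2)" by (simp add: M_def)
  then have "g a - g b \<le> M * (C * d\<^sup>2)" using d by simp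
  then have "M * (g a - g b) \<le> M * (M * (C * d\<^sup>2))"
    using M by (intro mult_left_mono) auto
  also have "\<dots> = C * (M * d)\<^sup>2" by (simp add: power2_eq_square)
  finally show False using M unfolding d(2) by simp
qed

lemma nn_integral_radius_derivative:
  assumes "0 \<le> u" "0 \<le> t" "t \<le> \<rho>"
  shows "(\<integral>\<^sup>+\<tau>. ennreal (\<tau> / sqrt (\<tau>\<^sup>2 + u)) * indicator {t..\<rho>} \<tau> \<partial>lborel)
       = ennreal (sqrt (\<rho>\<^sup>2 + u) - sqrt (t\<^sup>2 + u))"
proof (rule nn_integral_has_integral_lebesgue')
  show "0 \<le> \<tau> / sqrt (\<tau>\<^sup>2 + u)" if "\<tau> \<in> {t..\<rho>}" for \<tau> using that assms by (auto intro!: divide_nonneg_nonneg)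
  show "((\<lambda>\<tau>. \<tau> / sqrt (\<tau>\<^sup>2 + u)) has_integral sqrt (\<rho>\<^sup>2 + u) - sqrt (t\<^sup>2 + u)) {t..\<rho>}"
  \<comment> \<open>Only interior points may be differentiated: for \<open>u = 0\<close> the radius
    has no derivative at 0.\<close>
  proof (rule fundamental_theorem_of_calculus_interior)
    show "continuous_on {t..\<rho>} (\<lambda>\<tau>. sqrt (\<tau>\<^sup>2 + u))" by (intro continuous_intros)
    show "((\<lambda>\<tau>. sqrt (\<tau>\<^sup>2 + u)) has_vector_derivative \<tau> / sqrt (\<tau>\<^sup>2 + u)) (at \<tau>)" if "\<tau> \<in> {t<..<\<rho>}" for \<tau>
    proof -
      have "0 < \<tau>\<^sup>2 + u" using that assms by (simp add: add_pos_nonneg)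
      then show ?thesis
        unfolding has_real_derivative_iff_has_vector_derivative[symmetric]
        by (auto intro!: derivative_eq_intros simp: field_simps)
    qed
  qed (use assms in auto)
qed

context profile
begin

text \<open>Heuristically, \<open>\<psi>\<close> is at most
  \<open>\<beta> * sqrt (1 - r\<^sup>2)\<close> and its slope at most
  \<open>\<beta> * r / sqrt (1 - r\<^sup>2)\<close>, so their product is at most
  \<open>\<beta>\<^sup>2 * r\<close>. The bound from \<open>\<psi>_lipschitz\<close> makes this
  rigorous with a quadratic error. At \<open>r' = 1\<close> the slope bound degenerates, and the
  ellipsoid bound on the height suffices.\<close>

lemma \<psi>_sq_mono:
  assumes "0 \<le> r" "r \<le> r'" "r' \<le> 1"
  shows "(\<psi> r)\<^sup>2 + \<beta>\<^sup>2 * r\<^sup>2 \<le> (\<psi> r')\<^sup>2 + \<beta>\<^sup>2 * r'\<^sup>2"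
proof (cases "r' = 1")
  case True
  have "(\<psi> r)\<^sup>2 \<le> (\<beta> * sqrt (1 - r\<^sup>2))\<^sup>2"
    using \<psi>_le[of r] assms \<psi>_nonneg[of r] by (intro power_mono) auto
  also have "\<dots> = \<beta>\<^sup>2 * (1 - r\<^sup>2)"
    using assms by (simp add: power_mult_distrib power_le_one)
  finally show ?thesis using True by (simp add: algebra_simps)
next
  case False
  then have r'1: "r' < 1" using assms by simp
  define \<sigma> where "\<sigma> y = \<beta> * y / sqrt (1 - y\<^sup>2)" for y
  show ?thesis
  proof (rule le_if_quadratic_defect[where g = "\<lambda>r. (\<psi> r)\<^sup>2 + \<beta>\<^sup>2 * r\<^sup>2" and C = "\<beta>\<^sup>2 + (\<sigma> r')\<^sup>2", OF assms(2)])
    fix x y assume xy: "r \<le> x" "x \<le> y" "y \<le> r'"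
    have y: "0 \<le> x" "0 \<le> y" "y < 1" using xy assms r'1 by auto
    have sy: "0 < 1 - y\<^sup>2" "0 < 1 - r'\<^sup>2" using y assms r'1 by (simp_all add: abs_square_less_1)
    have "y\<^sup>2 \<le> r'\<^sup>2" using xy y by (intro power_mono) auto
    then have \<sigma>y: "0 \<le> \<sigma> y" "\<sigma> y \<le> \<sigma> r'"
      unfolding \<sigma>_def using xy y \<beta> sy by (auto intro!: frac_le mult_left_mono)
    \<comment> \<open>This controls the first-order term: in a step of length \<open>D\<close> the
      square of the height drops by at most \<open>2 * D * (\<beta>\<^sup>2 * y)\<close> up to order
      \<open>D\<^sup>2\<close>, which the growth of \<open>\<beta>\<^sup>2 * r\<^sup>2\<close>
      compensates.\<close>
    have prod: "\<sigma> y * \<psi> y \<le> \<beta>\<^sup>2 * y"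
    proof -
      have "\<sigma> y * \<psi> y \<le> \<sigma> y * (\<beta> * sqrt (1 - y\<^sup>2))"
        using \<psi>_le[of y] y \<sigma>y by (intro mult_left_mono) auto
      also have "\<dots> = \<beta>\<^sup>2 * y" using sy by (simp add: \<sigma>_def power2_eq_square)
      finally show ?thesis .
    qed
    define D where "D = y - x"
    have D: "0 \<le> D" "y = x + D" using xy by (auto simp: D_def)
    have "\<psi> x \<le> \<psi> y + D * \<sigma> y"
      using \<psi>_lipschitz[of x y] xy y by (simp add: D_def \<sigma>_def)
    then have "(\<psi> x)\<^sup>2 \<le> (\<psi> y + D * \<sigma> y)\<^sup>2"
      using \<psi>_nonneg by (intro power_mono) auto
    also have "\<dots> = (\<psi> y)\<^sup>2 + 2 * D * (\<sigma> y * \<psi> y) + D\<^sup>2 * (\<sigma> y)\<^sup>2"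
      by (simp add: power2_eq_square algebra_simps)
    also have "\<dots> \<le> (\<psi> y)\<^sup>2 + 2 * D * (\<beta>\<^sup>2 * y) + D\<^sup>2 * (\<sigma> r')\<^sup>2"
    proof -
      have "2 * D * (\<sigma> y * \<psi> y) \<le> 2 * D * (\<beta>\<^sup>2 * y)"
        using D by (intro mult_left_mono[OF prod]) auto
      moreover have "D\<^sup>2 * (\<sigma> y)\<^sup>2 \<le> D\<^sup>2 * (\<sigma> r')\<^sup>2"
        using \<sigma>y by (intro mult_left_mono power_mono) auto
      ultimately show ?thesis by simp
    qed
    finally show "(\<psi> x)\<^sup>2 + \<beta>\<^sup>2 * x\<^sup>2 \<le> (\<psi> y)\<^sup>2 + \<beta>\<^sup>2 * y\<^sup>2 + (\<beta>\<^sup>2 + (\<sigma> r')\<^sup>2) * (y - x)\<^sup>2"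
      unfolding D_def[symmetric] by (simp add: D(2) power2_eq_square algebra_simps)
  qed
qed

section \<open>Widths of the slices of a shadow\<close>

text \<open>For \<open>c < 0\<close> the last condition is void and the integral is \<open>w\<close> times the slope at radius \<open>h\<close>.\<close>

definition K :: "real \<Rightarrow> real \<Rightarrow> real \<Rightarrow> ennreal" where
  "K c w h = (\<integral>\<^sup>+p. (if 0 < p \<and> a p < h \<and> c < p * w then ennreal w else 0) \<partial>lborel)"

lemma K_measurable [measurable]:
  assumes [measurable]: "f \<in> borel_measurable M" "g \<in> borel_measurable M"
  shows "(\<lambda>x. K c (f x) (g x)) \<in> borel_measurable M"
  unfolding K_def by measurable

text \<open>The slopes are divided at \<open>p * w = c\<close>. With \<open>K_le\<close> and
  \<open>K_eq\<close> this identifies \<open>K c w h\<close> as the positive part of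
  \<open>K (-1) w h - c\<close>.\<close>

lemma K_split:
  assumes "0 \<le> w" "0 \<le> c"
  shows "K (-1) w h = (\<integral>\<^sup>+p. (if 0 < p \<and> a p < h \<and> p * w \<le> c then ennreal w else 0) \<partial>lborel) + K c w h"
proof -
  have "K (-1) w h = (\<integral>\<^sup>+p. ((if 0 < p \<and> a p < h \<and> p * w \<le> c then ennreal w else 0)
      + (if 0 < p \<and> a p < h \<and> c < p * w then ennreal w else 0)) \<partial>lborel)"
    unfolding K_def
  proof (intro nn_integral_cong)
    fix p :: real
    have "0 < p \<Longrightarrow> - 1 < p * w" using assms(1) by (smt (verit) mult_nonneg_nonneg)
    then show "(if 0 < p \<and> a p < h \<and> - 1 < p * w then ennreal w else 0)
      = (if 0 < p \<and> a p < h \<and> p * w \<le> c then ennreal w else 0)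
      + (if 0 < p \<and> a p < h \<and> c < p * w then ennreal w else 0)" by auto
  qed
  also have "\<dots> = (\<integral>\<^sup>+p. (if 0 < p \<and> a p < h \<and> p * w \<le> c then ennreal w else 0) \<partial>lborel) + K c w h"
    unfolding K_def by (rule nn_integral_add) measurable
  finally show ?thesis .
qed

lemma nn_integral_truncated_slope:
  assumes "0 < w" "0 \<le> c"
  shows "(\<integral>\<^sup>+p. (if 0 < p \<and> p * w \<le> c then ennreal w else 0) \<partial>lborel) = ennreal c"
proof -
  have "(\<integral>\<^sup>+p. (if 0 < p \<and> p * w \<le> c then ennreal w else 0) \<partial>lborel)
      = (\<integral>\<^sup>+p. ennreal w * indicator {0<..c / w} p \<partial>lborel)"
    using assms by (intro nn_integral_cong) (auto simp: indicator_def field_simps)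
  also have "\<dots> = ennreal w * ennreal (c / w)"
    using assms by (simp add: nn_integral_cmult)
  also have "\<dots> = ennreal c" using assms by (simp add: ennreal_mult[symmetric])
  finally show ?thesis .
qed

lemma K_le:
  assumes "0 \<le> w" "0 \<le> c"
  shows "K (-1) w h \<le> ennreal c + K c w h"
proof (cases "w = 0")
  case False
  then have "(\<integral>\<^sup>+p. (if 0 < p \<and> a p < h \<and> p * w \<le> c then ennreal w else 0) \<partial>lborel)
      \<le> (\<integral>\<^sup>+p. (if 0 < p \<and> p * w \<le> c then ennreal w else 0) \<partial>lborel)"
    by (intro nn_integral_mono) auto
  also have "\<dots> = ennreal c" using False assms by (intro nn_integral_truncated_slope) auto
  finally show ?thesis unfolding K_split[OF assms] by (rule add_right_mono)
qed (simp add: K_def if_distrib cong: if_cong)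

text \<open>The witness \<open>q\<close> shows that the slope at radius \<open>h\<close> exceeds
  \<open>c / w\<close>. As \<open>a\<close> is nondecreasing, every slope up to \<open>c / w\<close>
  is then attained before radius \<open>h\<close>, and the truncated part has its full value
  \<open>c\<close>.\<close>

lemma K_eq:
  assumes "0 \<le> w" "0 \<le> c" "0 < q" "a q < h" "c < q * w"
  shows "K (-1) w h = ennreal c + K c w h"
proof -
  have w: "0 < w" using assms by (cases "w = 0") auto
  have "a p < h" if "0 < p" "p * w \<le> c" for p
  proof -
    have "p * w < q * w" using that assms by simp
    then have "p \<le> q" using w by simp
    then show ?thesis using a_mono[OF that(1)] assms(4) by fastforce
  qed
  then have "(\<integral>\<^sup>+p. (if 0 < p \<and> a p < h \<and> p * w \<le> c then ennreal w else 0) \<partial>lborel)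
      = (\<integral>\<^sup>+p. (if 0 < p \<and> p * w \<le> c then ennreal w else 0) \<partial>lborel)"
    by (intro nn_integral_cong) auto
  then show ?thesis unfolding K_split[OF assms(1,2)] by (simp add: nn_integral_truncated_slope[OF w assms(2)])
qed

lemma K_eq_0:
  assumes "\<And>q. 0 < q \<Longrightarrow> a q < h \<Longrightarrow> q * w \<le> c"
  shows "K c w h = 0"
proof -
  have "K c w h = (\<integral>\<^sup>+p. 0 \<partial>(lborel :: real measure))"
    unfolding K_def using assms by (intro nn_integral_cong) (auto simp: not_less[symmetric])
  then show ?thesis by simp
qed

lemma nn_integral_radius_derivative_truncated:
  assumes u: "0 \<le> u" and t: "0 \<le> t" "t \<le> sqrt (1 - u)" and A: "0 \<le> A" "A \<le> 1"
  shows "(\<integral>\<^sup>+\<tau>. (if A < sqrt (\<tau>\<^sup>2 + u) then ennreal (\<tau> / sqrt (\<tau>\<^sup>2 + u)) else 0) * indicator {t..sqrt (1 - u)} \<tau> \<partial>lborel)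
       = ennreal (1 - max (sqrt (t\<^sup>2 + u)) A)"
proof -
  have "0 \<le> sqrt (1 - u)" using t by linarith
  then have u1: "u \<le> 1" by simp
  \<comment> \<open>The radius passes \<open>A\<close> at \<open>sqrt b\<close>, or starts beyond
    \<open>A\<close> if \<open>b = 0\<close>; the truncated integral therefore begins at
    \<open>t0\<close>, the later of \<open>t\<close> and \<open>sqrt b\<close>.\<close>
  define b where "b = max 0 (A\<^sup>2 - u)"
  define t0 where "t0 = max t (sqrt b)"
  have b: "0 \<le> b" "b \<le> 1 - u" using A u1 by (auto simp: b_def power_le_one)
  have t0: "0 \<le> t0" "t0 \<le> sqrt (1 - u)" "t \<le> t0" using t b by (auto simp: t0_def)
  have "t0\<^sup>2 = max (t\<^sup>2) b"
    using t b by (auto simp: t0_def max_def real_le_rsqrt real_sqrt_le_iff' dest: real_sqrt_le_mono)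
      (smt (verit) real_sqrt_unique real_le_lsqrt real_le_rsqrt)+
  then have "t0\<^sup>2 + u = max (t\<^sup>2 + u) (A\<^sup>2)"
    using zero_le_power2[of t] unfolding b_def by linarith
  then have h0: "sqrt (t0\<^sup>2 + u) = max (sqrt (t\<^sup>2 + u)) A"
    using A max_of_mono[of sqrt "t\<^sup>2 + u" "A\<^sup>2"] by (simp add: mono_def)
  have iff: "A < sqrt (\<tau>\<^sup>2 + u) \<longleftrightarrow> A\<^sup>2 - u < \<tau>\<^sup>2" for \<tau>
  proof -
    have "A < sqrt (\<tau>\<^sup>2 + u) \<longleftrightarrow> sqrt (A\<^sup>2) < sqrt (\<tau>\<^sup>2 + u)" using A by simp
    then show ?thesis unfolding real_sqrt_less_iff by auto
  qed
  have "(\<integral>\<^sup>+\<tau>. (if A < sqrt (\<tau>\<^sup>2 + u) then ennreal (\<tau> / sqrt (\<tau>\<^sup>2 + u)) else 0) * indicator {t..sqrt (1 - u)} \<tau> \<partial>lborel)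
      = (\<integral>\<^sup>+\<tau>. ennreal (\<tau> / sqrt (\<tau>\<^sup>2 + u)) * indicator {t0..sqrt (1 - u)} \<tau> \<partial>lborel)"
  proof (rule nn_integral_cong_AE, rule AE_mp[OF AE_lborel_singleton[of t0]], rule AE_I2, rule impI)
    fix \<tau> assume ne: "\<tau> \<noteq> t0"
    show "(if A < sqrt (\<tau>\<^sup>2 + u) then ennreal (\<tau> / sqrt (\<tau>\<^sup>2 + u)) else 0) * indicator {t..sqrt (1 - u)} \<tau>
        = ennreal (\<tau> / sqrt (\<tau>\<^sup>2 + u)) * indicator {t0..sqrt (1 - u)} \<tau>"
    proof (cases "t \<le> \<tau>")
      case True
      show ?thesis
      proof (cases "t0 < \<tau>")
        case gt: True
        then have "sqrt b < \<tau>" by (simp add: t0_def)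
        then have "(sqrt b)\<^sup>2 < \<tau>\<^sup>2" using b by (intro power_strict_mono) auto
        then have "A\<^sup>2 - u < \<tau>\<^sup>2" using b by (simp add: b_def)
        then show ?thesis using gt True iff by (simp add: indicator_def)
      next
        case False
        then have lt: "\<tau> < t0" using ne by simp
        then have "\<tau> < sqrt b" using True by (simp add: t0_def less_max_iff_disj)
        then have "\<tau>\<^sup>2 < (sqrt b)\<^sup>2" using True t by (intro power_strict_mono) auto
        then have "\<not> A\<^sup>2 - u < \<tau>\<^sup>2" using b by (auto simp: b_def max_def split: if_splits)
        then show ?thesis using lt iff by (simp add: indicator_def)
      qed
    next
      case False
      then show ?thesis using t0 by (simp add: indicator_def)
    qed
  qed
  also have "\<dots> = ennreal (sqrt ((sqrt (1 - u))\<^sup>2 + u) - sqrt (t0\<^sup>2 + u))"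
    using u t0 by (intro nn_integral_radius_derivative)
  also have "\<dots> = ennreal (1 - max (sqrt (t\<^sup>2 + u)) A)"
    using u1 by (simp add: h0)
  finally show ?thesis .
qed

text \<open>The fundamental theorem of calculus along a line at squared distance \<open>u\<close>
  from the axis, with boundary value \<open>\<psi> 1 = 0\<close>. It is obtained by exchanging
  position and slope, since for a fixed slope the integrand is the derivative of the radius.\<close>

lemma \<psi>_integral:
  assumes u: "0 \<le> u" and t: "0 \<le> t" "t \<le> sqrt (1 - u)" and s: "0 \<le> s"
  shows "ennreal (s * \<psi> (sqrt (t\<^sup>2 + u)))
    = (\<integral>\<^sup>+\<tau>. K (-1) (s * \<tau> / sqrt (\<tau>\<^sup>2 + u)) (sqrt (\<tau>\<^sup>2 + u)) * indicator {t..sqrt (1 - u)} \<tau> \<partial>lborel)"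
proof -
  let ?I = "indicator {t..sqrt (1 - u)} :: real \<Rightarrow> ennreal"
  have "0 \<le> sqrt (1 - u)" using t by linarith
  then have u1: "u \<le> 1" by simp
  have "t\<^sup>2 \<le> (sqrt (1 - u))\<^sup>2" using t by (intro power_mono)
  then have "t\<^sup>2 + u \<le> 1" using u1 by simp
  then have h: "0 \<le> sqrt (t\<^sup>2 + u)" "sqrt (t\<^sup>2 + u) \<le> 1" using u by auto
  have "(\<integral>\<^sup>+\<tau>. K (-1) (s * \<tau> / sqrt (\<tau>\<^sup>2 + u)) (sqrt (\<tau>\<^sup>2 + u)) * ?I \<tau> \<partial>lborel)
      = (\<integral>\<^sup>+\<tau>. (\<integral>\<^sup>+p. ennreal s * (indicator {0<..} p * ((if a p < sqrt (\<tau>\<^sup>2 + u) then ennreal (\<tau> / sqrt (\<tau>\<^sup>2 + u)) else 0) * ?I \<tau>)) \<partial>lborel) \<partial>lborel)"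
  proof (rule nn_integral_cong)
    fix \<tau> :: real
    show "K (-1) (s * \<tau> / sqrt (\<tau>\<^sup>2 + u)) (sqrt (\<tau>\<^sup>2 + u)) * ?I \<tau>
      = (\<integral>\<^sup>+p. ennreal s * (indicator {0<..} p * ((if a p < sqrt (\<tau>\<^sup>2 + u) then ennreal (\<tau> / sqrt (\<tau>\<^sup>2 + u)) else 0) * ?I \<tau>)) \<partial>lborel)"
    proof (cases "\<tau> \<in> {t..sqrt (1 - u)}")
      case True
      then have \<tau>: "0 \<le> \<tau>" using t by auto
      have w: "0 \<le> \<tau> / sqrt (\<tau>\<^sup>2 + u)" using \<tau> u by (auto intro!: divide_nonneg_nonneg)
      then have "0 < p \<Longrightarrow> - 1 < p * (s * \<tau> / sqrt (\<tau>\<^sup>2 + u))" for p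
        using s by (smt (verit) mult_nonneg_nonneg times_divide_eq_right)
      moreover have "ennreal (s * \<tau> / sqrt (\<tau>\<^sup>2 + u)) = ennreal s * ennreal (\<tau> / sqrt (\<tau>\<^sup>2 + u))"
        using s w by (simp flip: ennreal_mult)
      ultimately show ?thesis
        using True unfolding K_def by (simp add: indicator_def) (intro nn_integral_cong, auto)
    qed simp
  qed
  also have "\<dots> = (\<integral>\<^sup>+p. (\<integral>\<^sup>+\<tau>. ennreal s * (indicator {0<..} p * ((if a p < sqrt (\<tau>\<^sup>2 + u) then ennreal (\<tau> / sqrt (\<tau>\<^sup>2 + u)) else 0) * ?I \<tau>)) \<partial>lborel) \<partial>lborel)"
    by (rule lborel_pair.Fubini') measurable
  also have "\<dots> = (\<integral>\<^sup>+p. ennreal s * (ennreal (1 - max (sqrt (t\<^sup>2 + u)) (a p)) * indicator {0<..} p) \<partial>lborel)"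
  proof (rule nn_integral_cong)
    fix p :: real
    show "(\<integral>\<^sup>+\<tau>. ennreal s * (indicator {0<..} p * ((if a p < sqrt (\<tau>\<^sup>2 + u) then ennreal (\<tau> / sqrt (\<tau>\<^sup>2 + u)) else 0) * ?I \<tau>)) \<partial>lborel)
      = ennreal s * (ennreal (1 - max (sqrt (t\<^sup>2 + u)) (a p)) * indicator {0<..} p)"
    proof (cases "0 < p")
      case True
      then show ?thesis
        using nn_integral_radius_derivative_truncated[OF u t a_nonneg[OF True] a_le_1[OF True]]
        by (simp add: nn_integral_cmult)
    qed simp
  qed
  also have "\<dots> = ennreal s * ennreal (\<psi> (sqrt (t\<^sup>2 + u)))"
    by (simp add: nn_integral_cmult ennreal_\<psi>[OF h])
  finally show ?thesis using s by (simp add: ennreal_mult \<psi>_nonneg)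
qed

text \<open>The maximum of \<open>c t + s \<psi> (sqrt (t\<^sup>2 + u))\<close> over \<open>0 \<le> t \<le> sqrt (1 - u)\<close> is
  \<open>c sqrt (1 - u) + J c s u\<close>: the derivative in \<open>t\<close> changes sign at most once.\<close>

definition J :: "real \<Rightarrow> real \<Rightarrow> real \<Rightarrow> ennreal" where
  "J c s u = (\<integral>\<^sup>+\<tau>. K c (s * \<tau> / sqrt (\<tau>\<^sup>2 + u)) (sqrt (\<tau>\<^sup>2 + u)) * indicator {0..sqrt (1 - u)} \<tau> \<partial>lborel)"

text \<open>The left side is the shadow coordinate of the graph point with
  \<open>j\<close>-coordinate \<open>t\<close>. Moving on to the boundary of the base gains
  \<open>c\<close> per unit and loses \<open>K (-1)\<close>, so by \<open>K_le\<close> the value at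
  \<open>t\<close> exceeds the boundary value \<open>c * sqrt (1 - u)\<close> by at most the
  integral of the positive part.\<close>

lemma width_le:
  assumes u: "0 \<le> u" and t: "0 \<le> t" "t \<le> sqrt (1 - u)" and cs: "0 \<le> c" "0 \<le> s"
  shows "ennreal (c * t + s * \<psi> (sqrt (t\<^sup>2 + u))) \<le> ennreal (c * sqrt (1 - u)) + J c s u"
proof -
  let ?w = "\<lambda>\<tau>. s * \<tau> / sqrt (\<tau>\<^sup>2 + u)" and ?h = "\<lambda>\<tau>. sqrt (\<tau>\<^sup>2 + u)"
  let ?I = "indicator {t..sqrt (1 - u)} :: real \<Rightarrow> ennreal"
  have "ennreal (s * \<psi> (?h t)) \<le> (\<integral>\<^sup>+\<tau>. (ennreal c * ?I \<tau> + K c (?w \<tau>) (?h \<tau>) * indicator {0..sqrt (1 - u)} \<tau>) \<partial>lborel)"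
    unfolding \<psi>_integral[OF u t cs(2)]
  proof (rule nn_integral_mono)
    fix \<tau> :: real
    show "K (-1) (?w \<tau>) (?h \<tau>) * ?I \<tau> \<le> ennreal c * ?I \<tau> + K c (?w \<tau>) (?h \<tau>) * indicator {0..sqrt (1 - u)} \<tau>"
    proof (cases "\<tau> \<in> {t..sqrt (1 - u)}")
      case True
      then have "0 \<le> ?w \<tau>" using t u cs by (auto intro!: divide_nonneg_nonneg)
      then show ?thesis using True t K_le[OF _ cs(1)] by simp
    qed simp
  qed
  also have "\<dots> = ennreal (c * (sqrt (1 - u) - t)) + J c s u"
    unfolding J_def using t cs by (subst nn_integral_add) (simp_all add: nn_integral_cmult ennreal_mult)
  finally have "ennreal (c * t) + ennreal (s * \<psi> (?h t)) \<le> ennreal (c * t) + (ennreal (c * (sqrt (1 - u) - t)) + J c s u)"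
    by (rule add_left_mono)
  also have "\<dots> = ennreal (c * sqrt (1 - u)) + J c s u"
  proof -
    have "ennreal (c * t) + ennreal (c * (sqrt (1 - u) - t)) = ennreal (c * sqrt (1 - u))"
      using t cs by (subst ennreal_plus[symmetric]) (simp_all add: algebra_simps mult_left_mono)
    then show ?thesis by (simp only: add.assoc[symmetric])
  qed
  finally show ?thesis using t cs by (simp add: \<psi>_nonneg)
qed

text \<open>The optimal \<open>t\<close> is the threshold beyond which the loss exceeds the gain
  \<open>c\<close>. Both the radius and \<open>\<tau>\<close> divided by the radius increase with
  \<open>\<tau>\<close>, so the loss does too and the set \<open>T\<close> is upward closed.\<close>

lemma width_attained:
  assumes u: "0 \<le> u" "u \<le> 1" and cs: "0 \<le> c" "0 \<le> s"
  obtains t where "0 \<le> t" "t \<le> sqrt (1 - u)"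
    "ennreal (c * t + s * \<psi> (sqrt (t\<^sup>2 + u))) = ennreal (c * sqrt (1 - u)) + J c s u"
proof -
  let ?w = "\<lambda>\<tau>. s * \<tau> / sqrt (\<tau>\<^sup>2 + u)" and ?h = "\<lambda>\<tau>. sqrt (\<tau>\<^sup>2 + u)" and ?\<rho> = "sqrt (1 - u)"
  define T where "T = {\<tau>. 0 \<le> \<tau> \<and> \<tau> \<le> ?\<rho> \<and> (\<exists>q>0. a q < ?h \<tau> \<and> c < q * ?w \<tau>)}"
  \<comment> \<open>Inserting the right end point makes the infimum meaningful when \<open>T\<close>
    is empty; the maximum is then at the boundary of the base.\<close>
  define t where "t = Inf (insert ?\<rho> T)"
  have \<rho>0: "0 \<le> ?\<rho>" using u by simp
  have bdd: "bdd_below (insert ?\<rho> T)" by (rule bdd_belowI[of _ 0]) (use \<rho>0 in \<open>auto simp: T_def\<close>)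
  have t: "0 \<le> t" "t \<le> ?\<rho>"
    unfolding t_def using \<rho>0 bdd by (auto intro!: cInf_greatest cInf_lower simp: T_def)
  have below: "K c (?w \<tau>) (?h \<tau>) = 0" if "0 \<le> \<tau>" "\<tau> < t" for \<tau>
  proof -
    have "\<tau> \<notin> T"
      using that cInf_lower[OF _ bdd, of \<tau>] unfolding t_def[symmetric] by auto
    show ?thesis
    proof (rule K_eq_0, rule ccontr)
      fix q assume q: "0 < q" "a q < ?h \<tau>" "\<not> q * ?w \<tau> \<le> c"
      then have "c < q * ?w \<tau>" by (simp only: not_le)
      then have "\<tau> \<in> T" unfolding T_def mem_Collect_eq
        using q that t by (intro conjI exI[of _ q]) linarith+
      with \<open>\<tau> \<notin> T\<close> show False ..
    qed
  qed
  have above: "K (-1) (?w \<tau>) (?h \<tau>) = ennreal c + K c (?w \<tau>) (?h \<tau>)" if \<tau>: "t < \<tau>" "\<tau> \<le> ?\<rho>" for \<tau>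
  proof -
    obtain \<sigma> where \<sigma>: "\<sigma> \<in> insert ?\<rho> T" "\<sigma> < \<tau>"
      using cInf_lessD[of "insert ?\<rho> T" \<tau>] \<tau>(1) unfolding t_def[symmetric] by auto
    then have "\<sigma> \<in> T" using \<tau> by auto
    then obtain q where \<sigma>0: "0 \<le> \<sigma>" and q: "0 < q" "a q < ?h \<sigma>" "c < q * ?w \<sigma>" by (auto simp: T_def)
    have \<tau>0: "0 < \<tau>" using \<sigma>0 \<sigma>(2) by simp
    have sqle: "\<sigma>\<^sup>2 \<le> \<tau>\<^sup>2" using \<sigma>0 \<sigma>(2) by (intro power_mono) auto
    then have hle: "?h \<sigma> \<le> ?h \<tau>" by simp
    have "0 < \<sigma>" using q(3) cs \<sigma>0 by (cases "\<sigma> = 0") auto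
    then have pos: "0 < \<sigma>\<^sup>2 + u" "0 < \<tau>\<^sup>2 + u" using u \<tau>0 by (auto simp: add_pos_nonneg)
    have "(\<sigma> * ?h \<tau>)\<^sup>2 \<le> (\<tau> * ?h \<sigma>)\<^sup>2"
      using pos sqle u(1) by (simp add: power_mult_distrib algebra_simps mult_left_mono)
    then have "\<sigma> * ?h \<tau> \<le> \<tau> * ?h \<sigma>"
      by (rule power2_le_imp_le) (use \<tau>0 pos in simp)
    then have "\<sigma> / ?h \<sigma> \<le> \<tau> / ?h \<tau>" using pos by (simp add: field_simps)
    from mult_left_mono[OF this cs(2)] have "?w \<sigma> \<le> ?w \<tau>" by simp
    then have "q * ?w \<sigma> \<le> q * ?w \<tau>" using q(1) by (intro mult_left_mono) auto
    moreover have "0 \<le> ?w \<tau>" using \<tau>0 cs pos by (intro divide_nonneg_nonneg) auto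
    moreover have "c < q * ?w \<tau>" using q(3) \<open>q * ?w \<sigma> \<le> q * ?w \<tau>\<close> by (rule less_le_trans)
    moreover have "a q < ?h \<tau>" using q(2) hle by (rule less_le_trans)
    ultimately show ?thesis using q(1) cs(1) by (intro K_eq[of _ _ q])
  qed
  let ?I = "indicator {t..?\<rho>} :: real \<Rightarrow> ennreal"
  have "J c s u = (\<integral>\<^sup>+\<tau>. K c (?w \<tau>) (?h \<tau>) * ?I \<tau> \<partial>lborel)"
    unfolding J_def
  proof (rule nn_integral_cong)
    fix \<tau> :: real
    show "K c (?w \<tau>) (?h \<tau>) * indicator {0..?\<rho>} \<tau> = K c (?w \<tau>) (?h \<tau>) * ?I \<tau>"
      using below[of \<tau>] t by (cases "\<tau> < t") (auto simp: indicator_def)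
  qed
  then have "ennreal (c * (?\<rho> - t)) + J c s u = (\<integral>\<^sup>+\<tau>. (ennreal c * ?I \<tau> + K c (?w \<tau>) (?h \<tau>) * ?I \<tau>) \<partial>lborel)"
    using t cs by (subst nn_integral_add) (simp_all add: nn_integral_cmult ennreal_mult)
  also have "\<dots> = (\<integral>\<^sup>+\<tau>. K (-1) (?w \<tau>) (?h \<tau>) * ?I \<tau> \<partial>lborel)"
  proof (rule nn_integral_cong_AE, rule AE_mp[OF AE_lborel_singleton[of t]], rule AE_I2, rule impI)
    fix \<tau> assume "\<tau> \<noteq> t"
    then show "ennreal c * ?I \<tau> + K c (?w \<tau>) (?h \<tau>) * ?I \<tau> = K (-1) (?w \<tau>) (?h \<tau>) * ?I \<tau>"
      using above[of \<tau>] by (auto simp: indicator_def)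
  qed
  also have "\<dots> = ennreal (s * \<psi> (?h t))" by (rule \<psi>_integral[OF u(1) t cs(2), symmetric])
  finally have eq: "ennreal (s * \<psi> (?h t)) = ennreal (c * (?\<rho> - t)) + J c s u" by simp
  have "ennreal (c * t + s * \<psi> (?h t)) = ennreal (c * t) + (ennreal (c * (?\<rho> - t)) + J c s u)"
    using t cs eq by (simp add: \<psi>_nonneg)
  also have "\<dots> = ennreal (c * ?\<rho>) + J c s u"
  proof -
    have "ennreal (c * t) + ennreal (c * (?\<rho> - t)) = ennreal (c * ?\<rho>)"
      using t cs by (subst ennreal_plus[symmetric]) (simp_all add: algebra_simps mult_left_mono)
    then show ?thesis by (simp only: add.assoc[symmetric])
  qed
  finally show ?thesis using that t by blast
qed

end

section \<open>Integration over the base\<close>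

lemma sq_measurable_subset [measurable]:
  assumes "I \<subseteq> I'"
  shows "sq I \<in> borel_measurable (EM I')"
proof -
  have "(\<lambda>x. x k) \<in> borel_measurable (EM I')" if "k \<in> I" for k
    using measurable_component_singleton[of k I' "\<lambda>_. lborel"] that assms by auto
  then show ?thesis unfolding sq_def[abs_def] by (intro borel_measurable_sum borel_measurable_power)
qed

text \<open>The integrand of \<open>K\<close> within \<open>J\<close>, at slope \<open>p\<close> and
  base point \<open>x\<close>, without the condition that \<open>a p\<close> lies below the radius.
  That condition is the only one involving the profile.\<close>

definition cone :: "'n set \<Rightarrow> 'n \<Rightarrow> real \<Rightarrow> real \<Rightarrow> real \<Rightarrow> ('n \<Rightarrow> real) \<Rightarrow> ennreal" where
  "cone I j c s p x = (let w = s * x j / sqrt (sq I x) in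
     if sq I x \<le> 1 \<and> 0 \<le> x j \<and> c < p * w then ennreal w else 0)"

lemma cone_measurable [measurable]:
  assumes "j \<in> I" and [measurable]: "f \<in> borel_measurable M" "g \<in> M \<rightarrow>\<^sub>M EM I"
  shows "(\<lambda>y. cone I j c s (f y) (g y)) \<in> borel_measurable M"
proof -
  have [measurable]: "(\<lambda>y. g y j) \<in> borel_measurable M"
    using measurable_compose[OF assms(3) measurable_component_singleton[OF assms(1)]] by simp
  have [measurable]: "(\<lambda>y. sq I (g y)) \<in> borel_measurable M"
    by (rule measurable_compose[OF assms(3) sq_measurable])
  show ?thesis unfolding cone_def Let_def by measurable
qed

lemma cone_le:
  assumes "finite I" "j \<in> I" "0 \<le> s" "x \<in> space (EM I)"
  shows "cone I j c s p x \<le> ennreal s * indicator {x \<in> space (EM I). sq I x \<le> 1} x"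
proof (cases "sq I x \<le> 1 \<and> 0 \<le> x j")
  case True
  have "(x j)\<^sup>2 \<le> sq I x"
    unfolding sq_def using assms by (intro member_le_sum) auto
  then have "sqrt ((x j)\<^sup>2) \<le> sqrt (sq I x)" by (rule real_sqrt_le_mono)
  then have "x j \<le> sqrt (sq I x)" by simp
  then have "x j / sqrt (sq I x) \<le> 1"
    by (cases "sq I x = 0") (auto simp: divide_le_eq_1 less_le)
  from mult_left_mono[OF this assms(3)] have "s * x j / sqrt (sq I x) \<le> s" by simp
  then show ?thesis using True assms by (simp add: cone_def Let_def ennreal_leI)
qed (auto simp: cone_def Let_def)

text \<open>The cone integrand is homogeneous of degree 0 apart from its support condition.\<close>

lemma nn_integral_cone_annulus:
  assumes I: "finite I" "j \<in> I" and A: "0 \<le> A" "A \<le> 1" and cs: "0 \<le> c" "0 \<le> s"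
  shows "(\<integral>\<^sup>+x. (if A < sqrt (sq I x) then cone I j c s p x else 0) \<partial>EM I)
       = ennreal (1 - A ^ card I) * (\<integral>\<^sup>+x. cone I j c s p x \<partial>EM I)" (is "?X = _ * ?C")
proof -
  note [measurable] = cone_measurable[OF I(2)]
  have fin: "?C < top"
  proof -
    have "?C \<le> (\<integral>\<^sup>+x. ennreal s * indicator {x \<in> space (EM I). sq I x \<le> 1} x \<partial>EM I)"
      using cone_le[OF I cs(2)] by (rule nn_integral_mono)
    also have "\<dots> = ennreal s * vball I"
      unfolding vball_def by (rule nn_integral_cmult_indicator) measurable
    also have "\<dots> < top" using vball_finite[OF I(1)] by (simp add: ennreal_mult_less_top)
    finally show ?thesis .
  qed
  have inner: "(\<integral>\<^sup>+x. (if sqrt (sq I x) \<le> A then cone I j c s p x else 0) \<partial>EM I) = ennreal (A ^ card I) * ?C"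
  proof (cases "A = 0")
    case True
    have "(if sqrt (sq I x) \<le> A then cone I j c s p x else 0) = 0" for x
      using True cs by (auto simp: cone_def Let_def order_antisym[OF _ sq_nonneg])
    moreover have "card I \<noteq> 0" using I by auto
    ultimately show ?thesis using True by simp
  next
    case False
    then have A0: "0 < A" using A by simp
    have "(\<integral>\<^sup>+x. (if sqrt (sq I x) \<le> A then cone I j c s p x else 0) \<partial>EM I)
      = ennreal (A ^ card I) * (\<integral>\<^sup>+x. (if sqrt (sq I (\<lambda>k\<in>I. 0 + A * x k)) \<le> A
            then cone I j c s p (\<lambda>k\<in>I. 0 + A * x k) else 0) \<partial>EM I)"
      using I A0 by (intro nn_integral_EM_affine) measurable
    also have "(\<integral>\<^sup>+x. (if sqrt (sq I (\<lambda>k\<in>I. 0 + A * x k)) \<le> A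
            then cone I j c s p (\<lambda>k\<in>I. 0 + A * x k) else 0) \<partial>EM I) = ?C"
    proof (rule nn_integral_cong)
      fix x
      have sc: "sq I (\<lambda>k\<in>I. 0 + A * x k) = A\<^sup>2 * sq I x"
        unfolding sq_def sum_distrib_left by (intro sum.cong) (auto simp: power_mult_distrib)
      have sr: "sqrt (A\<^sup>2 * sq I x) = A * sqrt (sq I x)" using A0 by (simp add: real_sqrt_mult)
      have w: "s * (A * x j) / (A * sqrt (sq I x)) = s * x j / sqrt (sq I x)" using A0 by simp
      have xj: "(\<lambda>k\<in>I. 0 + A * x k) j = A * x j" using I by simp
      have 1: "A * sqrt (sq I x) \<le> A \<longleftrightarrow> sq I x \<le> 1" using A0 by simp
      have "A\<^sup>2 * sq I x \<le> 1 * 1" if "sq I x \<le> 1"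
        using A that by (intro mult_mono) (auto simp: power_le_one)
      then show "(if sqrt (sq I (\<lambda>k\<in>I. 0 + A * x k)) \<le> A
            then cone I j c s p (\<lambda>k\<in>I. 0 + A * x k) else 0) = cone I j c s p x"
        using A0 unfolding cone_def Let_def sc sr xj w 1 by (auto simp: zero_le_mult_iff)
    qed
    finally show ?thesis .
  qed
  have "?C = (\<integral>\<^sup>+x. ((if sqrt (sq I x) \<le> A then cone I j c s p x else 0)
      + (if A < sqrt (sq I x) then cone I j c s p x else 0)) \<partial>EM I)"
    by (intro nn_integral_cong) auto
  also have "\<dots> = ennreal (A ^ card I) * ?C + ?X"
    by (subst nn_integral_add) (measurable, simp only: inner)
  finally have eq: "?C = ennreal (A ^ card I) * ?C + ?X" .
  have Am: "0 \<le> A ^ card I" "A ^ card I \<le> 1" using A by (auto simp: power_le_one)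
  have "ennreal (A ^ card I) * ?C + ennreal (1 - A ^ card I) * ?C = ennreal (A ^ card I + (1 - A ^ card I)) * ?C"
    using Am by (subst ennreal_plus) (simp_all add: distrib_right)
  also have "\<dots> = ?C" by simp
  finally have "ennreal (A ^ card I) * ?C + ennreal (1 - A ^ card I) * ?C = ennreal (A ^ card I) * ?C + ?X"
    using eq by simp
  \<comment> \<open>Finiteness of the cone integral permits the cancellation in
    \<open>ennreal\<close>.\<close>
  moreover have "ennreal (A ^ card I) * ?C \<noteq> top"
    using fin by (simp add: ennreal_mult_eq_top_iff)
  ultimately show ?thesis by (simp add: ennreal_add_left_cancel)
qed

text \<open>The integrand is the length of the set of \<open>\<sigma>\<close> between
  \<open>A\<close> and 1 with \<open>x\<close> in the ball of radius \<open>\<sigma>\<close>.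
  Exchanging the integrals leaves the integral of the ball volumes
  \<open>vball I * \<sigma> ^ card I\<close>.\<close>

lemma nn_integral_truncated_radius:
  assumes I: "finite I" "j \<in> I" and A: "0 \<le> A" "A \<le> 1"
  shows "(\<integral>\<^sup>+x. ennreal (1 - max (sqrt (sq I x)) A) \<partial>EM I)
       = vball I * ennreal ((1 - A ^ Suc (card I)) / real (Suc (card I)))"
proof -
  let ?n = "card I"
  interpret E: sigma_finite_measure "EM I" using I(1) by (rule sigma_finite_EM)
  interpret P: pair_sigma_finite "EM I" "lborel :: real measure" ..
  have "(\<integral>\<^sup>+x. ennreal (1 - max (sqrt (sq I x)) A) \<partial>EM I)
      = (\<integral>\<^sup>+x. (\<integral>\<^sup>+\<sigma>. (if sqrt (sq I x) \<le> \<sigma> then 1 else 0) * indicator {A..1} \<sigma> \<partial>lborel) \<partial>EM I)"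
  proof (rule nn_integral_cong)
    fix x
    have "(\<integral>\<^sup>+\<sigma>. (if sqrt (sq I x) \<le> \<sigma> then 1 else 0) * indicator {A..1} \<sigma> \<partial>lborel)
        = (\<integral>\<^sup>+\<sigma>. indicator {max (sqrt (sq I x)) A..1} \<sigma> \<partial>lborel)"
      by (intro nn_integral_cong) (auto simp: indicator_def)
    also have "\<dots> = ennreal (1 - max (sqrt (sq I x)) A)"
    proof (cases "max (sqrt (sq I x)) A \<le> 1")
      case False
      then have gt: "1 < max (sqrt (sq I x)) A" by (simp only: not_le)
      then have "ennreal (1 - max (sqrt (sq I x)) A) = 0" by (intro ennreal_neg) linarith
      moreover have "{max (sqrt (sq I x)) A..1} = {}" using gt by (simp only: atLeastatMost_empty_iff not_le)
      ultimately show ?thesis by (simp only: emeasure_empty nn_integral_indicator sets.empty_sets)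
    qed simp
    finally show "ennreal (1 - max (sqrt (sq I x)) A)
      = (\<integral>\<^sup>+\<sigma>. (if sqrt (sq I x) \<le> \<sigma> then 1 else 0) * indicator {A..1} \<sigma> \<partial>lborel)" by simp
  qed
  also have "\<dots> = (\<integral>\<^sup>+\<sigma>. (\<integral>\<^sup>+x. (if sqrt (sq I x) \<le> \<sigma> then 1 else 0) * indicator {A..1} \<sigma> \<partial>EM I) \<partial>lborel)"
    by (rule P.Fubini'[symmetric]) measurable
  also have "\<dots> = (\<integral>\<^sup>+\<sigma>. vball I * (ennreal (\<sigma> ^ ?n) * indicator {A..1} \<sigma>) \<partial>lborel)"
  proof (rule nn_integral_cong_AE, rule AE_mp[OF AE_lborel_singleton[of 0]], rule AE_I2, rule impI)
    fix \<sigma> :: real assume ne: "\<sigma> \<noteq> 0"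
    show "(\<integral>\<^sup>+x. (if sqrt (sq I x) \<le> \<sigma> then 1 else 0) * indicator {A..1} \<sigma> \<partial>EM I)
        = vball I * (ennreal (\<sigma> ^ ?n) * indicator {A..1} \<sigma>)"
    proof (cases "\<sigma> \<in> {A..1}")
      case True
      then have \<sigma>: "0 < \<sigma>" using ne A by auto
      have I': "I = insert j (I - {j})" "finite (I - {j})" "j \<notin> I - {j}" using I by auto
      have sqI: "sq I x = (x j)\<^sup>2 + sq (I - {j}) x" for x
        using sq_insert[OF I'(2,3), of x] I'(1) by simp
      have "(\<integral>\<^sup>+x. (if sqrt (sq I x) \<le> \<sigma> then 1 else 0) * indicator {A..1} \<sigma> \<partial>EM I)
          = (\<integral>\<^sup>+x. indicator {x \<in> space (EM I). (x j - 0)\<^sup>2 + sq (I - {j}) x \<le> \<sigma>\<^sup>2} x \<partial>EM I)"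
      proof (rule nn_integral_cong)
        fix x assume "x \<in> space (EM I)"
        moreover have "sqrt (sq I x) \<le> \<sigma> \<longleftrightarrow> sq I x \<le> \<sigma>\<^sup>2"
          using \<sigma> real_sqrt_le_iff[of "sq I x" "\<sigma>\<^sup>2"] by simp
        ultimately show "(if sqrt (sq I x) \<le> \<sigma> then 1 else 0) * indicator {A..1} \<sigma>
          = (indicator {x \<in> space (EM I). (x j - 0)\<^sup>2 + sq (I - {j}) x \<le> \<sigma>\<^sup>2} x :: ennreal)"
          using True by (simp add: sqI)
      qed
      also have "\<dots> = emeasure (EM I) {x \<in> space (EM I). (x j - 0)\<^sup>2 + sq (I - {j}) x \<le> \<sigma>\<^sup>2}"
      proof (rule nn_integral_indicator)
        have "{x \<in> space (EM I). (x j - 0)\<^sup>2 + sq (I - {j}) x \<le> \<sigma>\<^sup>2} = {x \<in> space (EM I). sq I x \<le> \<sigma>\<^sup>2}"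
          by (simp add: sqI)
        also have "\<dots> \<in> sets (EM I)" by measurable
        finally show "{x \<in> space (EM I). (x j - 0)\<^sup>2 + sq (I - {j}) x \<le> \<sigma>\<^sup>2} \<in> sets (EM I)" .
      qed
      also have "\<dots> = ennreal (\<sigma> ^ ?n) * vball I"
        using emeasure_shifted_ball[OF I'(2,3) \<sigma>, of 0]
        unfolding I'(1)[symmetric] card_Suc_Diff1[OF I] .
      finally show ?thesis using True by (simp add: mult.commute)
    qed simp
  qed
  also have "\<dots> = vball I * (\<integral>\<^sup>+\<sigma>. ennreal (\<sigma> ^ ?n) * indicator {A..1} \<sigma> \<partial>lborel)"
    by (rule nn_integral_cmult) measurable
  also have "(\<integral>\<^sup>+\<sigma>. ennreal (\<sigma> ^ ?n) * indicator {A..1} \<sigma> \<partial>lborel) = ennreal ((1 - A ^ Suc ?n) / real (Suc ?n))"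
  proof -
    have "((\<lambda>\<sigma>. \<sigma> ^ ?n) has_integral (1 ^ Suc ?n / real (Suc ?n) - A ^ Suc ?n / real (Suc ?n))) {A..1}"
    proof (rule fundamental_theorem_of_calculus[OF A(2)])
      fix \<sigma> :: real
      have "((\<lambda>\<sigma>. \<sigma> ^ Suc ?n / real (Suc ?n)) has_real_derivative \<sigma> ^ ?n) (at \<sigma> within {A..1})"
        by (auto intro!: derivative_eq_intros simp del: power_Suc of_nat_Suc)
      then show "((\<lambda>\<sigma>. \<sigma> ^ Suc ?n / real (Suc ?n)) has_vector_derivative \<sigma> ^ ?n) (at \<sigma> within {A..1})"
        by (simp add: has_real_derivative_iff_has_vector_derivative)
    qed
    then show ?thesis
      using A by (subst nn_integral_has_integral_lebesgue') (auto simp: diff_divide_distrib)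
  qed
  finally show ?thesis .
qed

context profile
begin

text \<open>With the slope as outer variable, \<open>nn_integral_cone_annulus\<close> applies for
  each \<open>p\<close>. The profile then enters only through the power of \<open>a p\<close> whose
  exponent is the dimension of the base, and it enters linearly.\<close>

lemma nn_integral_J:
  assumes I: "finite I" "j \<notin> I" and cs: "0 \<le> c" "0 \<le> s"
  shows "(\<integral>\<^sup>+w. J c s (sq I w) \<partial>EM I)
       = (\<integral>\<^sup>+p. ennreal (1 - a p ^ Suc (card I)) * (\<integral>\<^sup>+x. cone (insert j I) j c s p x \<partial>EM (insert j I)) * indicator {0<..} p \<partial>lborel)"
proof -
  let ?J = "insert j I"
  note [measurable] = cone_measurable[OF insertI1]
  have finJ: "finite ?J" using I by simp
  interpret E: sigma_finite_measure "EM ?J" using finJ by (rule sigma_finite_EM)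
  interpret P: pair_sigma_finite "EM ?J" "lborel :: real measure" ..
  define F where "F x p = (if 0 < p then (if a p < sqrt (sq ?J x) then cone ?J j c s p x else 0) else 0)" for x p
  have F[measurable]: "(\<lambda>(x, p). F x p) \<in> borel_measurable (EM ?J \<Otimes>\<^sub>M lborel)"
    unfolding F_def by measurable
  have "(\<integral>\<^sup>+w. J c s (sq I w) \<partial>EM I) = (\<integral>\<^sup>+w. (\<integral>\<^sup>+\<tau>. (\<integral>\<^sup>+p. F (w(j := \<tau>)) p \<partial>lborel) \<partial>lborel) \<partial>EM I)"
  proof (rule nn_integral_cong)
    fix w
    have sq1: "sq ?J (w(j := \<tau>)) = \<tau>\<^sup>2 + sq I w" for \<tau> using I by (simp add: sq_insert)
    have rng: "\<tau> \<in> {0..sqrt (1 - sq I w)} \<longleftrightarrow> 0 \<le> \<tau> \<and> \<tau>\<^sup>2 + sq I w \<le> 1" for \<tau>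
    proof (cases "0 \<le> \<tau>")
      case True
      then have "\<tau> \<le> sqrt (1 - sq I w) \<longleftrightarrow> sqrt (\<tau>\<^sup>2) \<le> sqrt (1 - sq I w)" by simp
      also have "\<dots> \<longleftrightarrow> \<tau>\<^sup>2 + sq I w \<le> 1" unfolding real_sqrt_le_iff by auto
      finally show ?thesis using True by simp
    qed simp
    show "J c s (sq I w) = (\<integral>\<^sup>+\<tau>. (\<integral>\<^sup>+p. F (w(j := \<tau>)) p \<partial>lborel) \<partial>lborel)"
      unfolding J_def
    proof (rule nn_integral_cong)
      fix \<tau> :: real
      show "K c (s * \<tau> / sqrt (\<tau>\<^sup>2 + sq I w)) (sqrt (\<tau>\<^sup>2 + sq I w)) * indicator {0..sqrt (1 - sq I w)} \<tau>
          = (\<integral>\<^sup>+p. F (w(j := \<tau>)) p \<partial>lborel)"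
      proof (cases "\<tau> \<in> {0..sqrt (1 - sq I w)}")
        case True
        then have "0 \<le> \<tau> \<and> \<tau>\<^sup>2 + sq I w \<le> 1" by (simp only: rng)
        then show ?thesis
          using True unfolding K_def F_def cone_def Let_def sq1 by simp (intro nn_integral_cong, auto)
      next
        case False
        then have "\<not> (0 \<le> \<tau> \<and> \<tau>\<^sup>2 + sq I w \<le> 1)" by (simp only: rng not_False_eq_True)
        then have "F (w(j := \<tau>)) p = 0" for p unfolding F_def cone_def Let_def sq1 by auto
        then show ?thesis using False by simp
      qed
    qed
  qed
  also have "\<dots> = (\<integral>\<^sup>+x. (\<integral>\<^sup>+p. F x p \<partial>lborel) \<partial>EM ?J)"
    using I by (intro lebesgue_prod.product_nn_integral_insert[symmetric]) measurable
  also have "\<dots> = (\<integral>\<^sup>+p. (\<integral>\<^sup>+x. F x p \<partial>EM ?J) \<partial>lborel)"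
    by (rule P.Fubini'[symmetric]) measurable
  also have "\<dots> = (\<integral>\<^sup>+p. ennreal (1 - a p ^ Suc (card I)) * (\<integral>\<^sup>+x. cone ?J j c s p x \<partial>EM ?J) * indicator {0<..} p \<partial>lborel)"
  proof (rule nn_integral_cong)
    fix p :: real
    show "(\<integral>\<^sup>+x. F x p \<partial>EM ?J) = ennreal (1 - a p ^ Suc (card I)) * (\<integral>\<^sup>+x. cone ?J j c s p x \<partial>EM ?J) * indicator {0<..} p"
    proof (cases "0 < p")
      case True
      then show ?thesis
        using nn_integral_cone_annulus[OF finJ insertI1 a_nonneg[OF True] a_le_1[OF True] cs] I
        unfolding F_def by simp
    qed (simp add: F_def)
  qed
  finally show ?thesis .
qed

text \<open>Here \<open>I\<close> contains \<open>j\<close>, so it is the whole base and the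
  exponent is one higher than in \<open>nn_integral_J\<close>. This difference of exponents lets the
  volume change while the shadows are kept.\<close>

lemma nn_integral_\<psi>:
  assumes I: "finite I" "j \<in> I"
  shows "(\<integral>\<^sup>+x. ennreal (\<psi> (sqrt (sq I x))) * indicator {x. sq I x \<le> 1} x \<partial>EM I)
       = (\<integral>\<^sup>+p. vball I * ennreal ((1 - a p ^ Suc (card I)) / real (Suc (card I))) * indicator {0<..} p \<partial>lborel)"
proof -
  interpret E: sigma_finite_measure "EM I" using I(1) by (rule sigma_finite_EM)
  interpret P: pair_sigma_finite "EM I" "lborel :: real measure" ..
  have "(\<integral>\<^sup>+x. ennreal (\<psi> (sqrt (sq I x))) * indicator {x. sq I x \<le> 1} x \<partial>EM I)
      = (\<integral>\<^sup>+x. (\<integral>\<^sup>+p. ennreal (1 - max (sqrt (sq I x)) (a p)) * indicator {0<..} p \<partial>lborel) \<partial>EM I)"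
  proof (rule nn_integral_cong)
    fix x
    show "ennreal (\<psi> (sqrt (sq I x))) * indicator {x. sq I x \<le> 1} x
        = (\<integral>\<^sup>+p. ennreal (1 - max (sqrt (sq I x)) (a p)) * indicator {0<..} p \<partial>lborel)"
    proof (cases "sq I x \<le> 1")
      case True
      then show ?thesis by (simp add: ennreal_\<psi>)
    next
      case False
      then have "1 < sqrt (sq I x)" by simp
      then have "1 - max (sqrt (sq I x)) (a p) \<le> 0" for p by linarith
      then have "ennreal (1 - max (sqrt (sq I x)) (a p)) = 0" for p by (intro ennreal_neg)
      then show ?thesis using False by simp
    qed
  qed
  also have "\<dots> = (\<integral>\<^sup>+p. (\<integral>\<^sup>+x. ennreal (1 - max (sqrt (sq I x)) (a p)) * indicator {0<..} p \<partial>EM I) \<partial>lborel)"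
    by (rule P.Fubini'[symmetric]) measurable
  also have "\<dots> = (\<integral>\<^sup>+p. vball I * ennreal ((1 - a p ^ Suc (card I)) / real (Suc (card I))) * indicator {0<..} p \<partial>lborel)"
  proof (rule nn_integral_cong)
    fix p :: real
    show "(\<integral>\<^sup>+x. ennreal (1 - max (sqrt (sq I x)) (a p)) * indicator {0<..} p \<partial>EM I)
        = vball I * ennreal ((1 - a p ^ Suc (card I)) / real (Suc (card I))) * indicator {0<..} p"
    proof (cases "0 < p")
      case True
      then show ?thesis
        using nn_integral_truncated_radius[OF I a_nonneg[OF True] a_le_1[OF True]]
        by simp
    qed simp
  qed
  finally show ?thesis .
qed

end

section \<open>Bodies of revolution\<close>

text \<open>Each slice only has to contain an interval of the required length, so slices need not be
  determined exactly. Taking \<open>u < l\<close> serves for an empty slice.\<close>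

lemma emeasure_ge_slices:
  assumes I: "finite I" "j \<notin> I" and X: "X \<in> sets (EM (insert j I))"
    and sl: "\<And>w. w \<in> space (EM I) \<Longrightarrow> \<exists>l u. (\<forall>t. l \<le> t \<and> t \<le> u \<longrightarrow> w(j := t) \<in> X) \<and> f w \<le> ennreal (u - l)"
  shows "(\<integral>\<^sup>+w. f w \<partial>EM I) \<le> emeasure (EM (insert j I)) X"
proof -
  note X[measurable]
  have "(\<integral>\<^sup>+w. f w \<partial>EM I) \<le> (\<integral>\<^sup>+w. (\<integral>\<^sup>+t. indicator X (w(j := t)) \<partial>lborel) \<partial>EM I)"
  proof (rule nn_integral_mono)
    fix w assume "w \<in> space (EM I)"
    then obtain l u where lu: "\<And>t. l \<le> t \<Longrightarrow> t \<le> u \<Longrightarrow> w(j := t) \<in> X" and f: "f w \<le> ennreal (u - l)"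
      using sl by blast
    have "ennreal (u - l) \<le> (\<integral>\<^sup>+t. indicator {l..u} t \<partial>lborel)"
      by (cases "l \<le> u") (simp_all add: ennreal_neg)
    also have "\<dots> \<le> (\<integral>\<^sup>+t. indicator X (w(j := t)) \<partial>lborel)"
      using lu by (intro nn_integral_mono) (auto simp: indicator_def)
    finally show "f w \<le> (\<integral>\<^sup>+t. indicator X (w(j := t)) \<partial>lborel)" using f by (rule order_trans[rotated])
  qed
  also have "\<dots> = (\<integral>\<^sup>+x. indicator X x \<partial>EM (insert j I))"
    using I X by (intro lebesgue_prod.product_nn_integral_insert[symmetric]) measurable
  also have "\<dots> = emeasure (EM (insert j I)) X" using X by simp
  finally show ?thesis .
qed

section \<open>Cylindrical coordinates about the axis\<close>

lemma norm_vec1_sq: "(norm (vec1 i z x))\<^sup>2 = z\<^sup>2 + sq (UNIV - {i}) x"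
proof -
  have "(norm (vec1 i z x))\<^sup>2 = (\<Sum>k\<in>UNIV. (vec1 i z x $ k)\<^sup>2)"
    by (simp only: power2_norm_eq_inner inner_vec_def inner_real_def) (simp only: power2_eq_square)
  also have "\<dots> = z\<^sup>2 + (\<Sum>k\<in>UNIV - {i}. (vec1 i z x $ k)\<^sup>2)"
    by (subst sum.remove[of _ i]) (auto simp: vec1_def)
  also have "(\<Sum>k\<in>UNIV - {i}. (vec1 i z x $ k)\<^sup>2) = sq (UNIV - {i}) x"
    unfolding sq_def by (intro sum.cong) (auto simp: vec1_def)
  finally show ?thesis .
qed

definition nrm :: "'n::finite \<Rightarrow> real^'n \<Rightarrow> real" where
  "nrm i y = norm (y - (y $ i) *\<^sub>R axis i 1)"

lemma nrm_vec1: "nrm i (vec1 i z x) = sqrt (sq (UNIV - {i}) x)"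
proof -
  have "vec1 i z x - (vec1 i z x $ i) *\<^sub>R axis i 1 = vec1 i 0 x"
    by (auto simp: vec1_def vec_eq_iff axis_def)
  then have "(nrm i (vec1 i z x))\<^sup>2 = sq (UNIV - {i}) x"
    using norm_vec1_sq[of i 0 x] by (simp add: nrm_def)
  then show ?thesis by (metis abs_of_nonneg norm_ge_zero nrm_def real_sqrt_abs)
qed

lemma nrm_nonneg [simp]: "0 \<le> nrm i y"
  by (simp add: nrm_def)

lemma nrm_convex: "0 \<le> u \<Longrightarrow> 0 \<le> v \<Longrightarrow> nrm i (u *\<^sub>R x + v *\<^sub>R y) \<le> u * nrm i x + v * nrm i y"
proof -
  assume uv: "0 \<le> u" "0 \<le> v"
  have "u *\<^sub>R x + v *\<^sub>R y - ((u *\<^sub>R x + v *\<^sub>R y) $ i) *\<^sub>R axis i 1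
      = u *\<^sub>R (x - (x $ i) *\<^sub>R axis i 1) + v *\<^sub>R (y - (y $ i) *\<^sub>R axis i 1)"
    by (simp add: algebra_simps)
  then show ?thesis
    unfolding nrm_def using uv norm_triangle_ineq[of "u *\<^sub>R (x - (x $ i) *\<^sub>R axis i 1)"] by (metis abs_of_nonneg norm_scaleR)
qed

lemma nrm_le_norm: "nrm i y \<le> norm y"
proof -
  have "(nrm i y)\<^sup>2 = (norm y)\<^sup>2 - (y $ i)\<^sup>2"
    unfolding nrm_def power2_norm_eq_inner
    by (simp add: inner_diff_left inner_diff_right inner_axis inner_commute[of "axis i 1" y] inner_axis_axis power2_eq_square algebra_simps)
  then have "(nrm i y)\<^sup>2 \<le> (norm y)\<^sup>2" by simp
  then show ?thesis by (rule power2_le_imp_le) simp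
qed

lemma continuous_on_nrm [continuous_intros]: "continuous_on S (nrm i)"
  unfolding nrm_def[abs_def] by (intro continuous_intros)

lemma orthogonal_fixing_axis:
  fixes f :: "real^'n \<Rightarrow> real^'n"
  assumes f: "orthogonal_transformation f" "f (axis i 1) = axis i 1"
  shows "f y $ i = y $ i" "nrm i (f y) = nrm i y"
proof -
  have lin: "linear f" using f(1) by (rule orthogonal_transformation_linear)
  have "f y \<bullet> f (axis i 1) = y \<bullet> axis i 1" using f(1) by (simp add: orthogonal_transformation_def)
  then show 1: "f y $ i = y $ i" by (simp add: f(2) inner_axis)
  have "f y - (f y $ i) *\<^sub>R axis i 1 = f (y - (y $ i) *\<^sub>R axis i 1)"
    by (simp add: 1 linear_diff[OF lin] linear_scale[OF lin] f(2))
  then show "nrm i (f y) = nrm i y"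
    by (simp add: nrm_def orthogonal_transformation_norm[OF f(1)])
qed

lemma revolution_aboutI:
  fixes L :: "(real^'n) set"
  assumes "\<And>f y. orthogonal_transformation f \<Longrightarrow> f (axis i 1) = axis i 1 \<Longrightarrow> f y \<in> L \<longleftrightarrow> y \<in> L"
  shows "revolution_about i L"
  unfolding revolution_about_def
proof (intro allI impI)
  fix f :: "real^'n \<Rightarrow> real^'n"
  assume f: "orthogonal_transformation f \<and> f (axis i 1) = axis i 1"
  then have *: "f y \<in> L \<longleftrightarrow> y \<in> L" for y using assms by blast
  have "surj f" using f orthogonal_transformation_surj by blast
  then show "f ` L = L" using * by (auto simp: image_iff) (metis surjD)
qed

lemma revolution_imp_body_of_revolution:
  "revolution_about i L \<Longrightarrow> body_of_revolution L"
  unfolding revolution_about_def body_of_revolution_def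
  by (intro exI[of _ "axis i 1"]) (auto simp: axis_eq_0_iff span_base)

lemma revolution_about_cball:
  fixes i :: "'n::finite"
  shows "revolution_about i (cball (\<tau> *\<^sub>R axis i 1) r)"
proof (rule revolution_aboutI)
  fix f :: "real^'n \<Rightarrow> real^'n" and y
  assume f: "orthogonal_transformation f" "f (axis i 1) = axis i 1"
  have lin: "linear f" using f(1) by (rule orthogonal_transformation_linear)
  have "norm (\<tau> *\<^sub>R axis i 1 - f y) = norm (f (\<tau> *\<^sub>R axis i 1 - y))"
    by (simp add: linear_diff[OF lin] linear_scale[OF lin] f(2))
  then show "f y \<in> cball (\<tau> *\<^sub>R axis i 1) r \<longleftrightarrow> y \<in> cball (\<tau> *\<^sub>R axis i 1) r"
    by (simp add: dist_norm orthogonal_transformation_norm[OF f(1)])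
qed

lemma vec1_in_cball:
  assumes "0 \<le> r"
  shows "vec1 i z x \<in> cball (\<tau> *\<^sub>R axis i 1) r \<longleftrightarrow> (z - \<tau>)\<^sup>2 + sq (UNIV - {i}) x \<le> r\<^sup>2"
proof -
  have "vec1 i z x - \<tau> *\<^sub>R axis i 1 = vec1 i (z - \<tau>) x"
    by (auto simp: vec1_def vec_eq_iff axis_def)
  then have "vec1 i z x \<in> cball (\<tau> *\<^sub>R axis i 1) r \<longleftrightarrow> norm (vec1 i (z - \<tau>) x) \<le> r"
    by (simp add: dist_norm norm_minus_commute)
  also have "\<dots> \<longleftrightarrow> (norm (vec1 i (z - \<tau>) x))\<^sup>2 \<le> r\<^sup>2"
    using assms by (simp add: abs_le_square_iff[symmetric])
  finally show ?thesis by (simp add: norm_vec1_sq)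
qed

text \<open>The conditions on a height function that make its body of revolution compact and convex.
  The distance from the axis is a convex function, so concavity of the height has to be paired with
  antitonicity for the composition to be concave.\<close>

definition cap :: "(real \<Rightarrow> real) \<Rightarrow> bool" where
  "cap f \<longleftrightarrow> continuous_on {0..1} f \<and> (\<forall>r. 0 \<le> r \<and> r \<le> 1 \<longrightarrow> 0 \<le> f r) \<and>
     (\<forall>r r'. 0 \<le> r \<and> r \<le> r' \<and> r' \<le> 1 \<longrightarrow> f r' \<le> f r) \<and>
     (\<forall>r r' u v. 0 \<le> r \<and> r \<le> 1 \<and> 0 \<le> r' \<and> r' \<le> 1 \<and> 0 \<le> u \<and> 0 \<le> v \<and> u + v = 1
        \<longrightarrow> u * f r + v * f r' \<le> f (u * r + v * r'))"

definition rbody :: "'n::finite \<Rightarrow> (real \<Rightarrow> real) \<Rightarrow> (real \<Rightarrow> real) \<Rightarrow> (real^'n) set" where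
  "rbody i f g = {y. nrm i y \<le> 1 \<and> - g (nrm i y) \<le> y $ i \<and> y $ i \<le> f (nrm i y)}"

lemma vec1_in_rbody:
  "vec1 i z x \<in> rbody i f g \<longleftrightarrow> sq (UNIV - {i}) x \<le> 1 \<and>
     - g (sqrt (sq (UNIV - {i}) x)) \<le> z \<and> z \<le> f (sqrt (sq (UNIV - {i}) x))"
  by (simp add: rbody_def nrm_vec1) (simp add: vec1_def)

lemma revolution_about_rbody: "revolution_about i (rbody i f g)"
  by (rule revolution_aboutI) (simp add: rbody_def orthogonal_fixing_axis)

lemma compact_rbody:
  assumes f: "cap f" and g: "cap g"
  shows "compact (rbody i f g)"
proof -
  \<comment> \<open>Continuity of a cap is known on the unit interval only, hence the truncation by
    1, which does not affect points of the body.\<close>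
  have cont: "continuous_on UNIV (\<lambda>y. h (min 1 (nrm i y)))" if "cap h" for h
    by (rule continuous_on_compose2[of "{0..1}" h]) (use that in \<open>auto simp: cap_def intro!: continuous_intros\<close>)
  have "rbody i f g = {y. nrm i y \<le> 1} \<inter> {y. - g (min 1 (nrm i y)) \<le> y $ i} \<inter> {y. y $ i \<le> f (min 1 (nrm i y))}"
    by (auto simp: rbody_def)
  also have "closed \<dots>"
    by (intro closed_Int closed_Collect_le continuous_intros cont f g)
  finally have cl: "closed (rbody i f g)" .
  have "norm y \<le> 1 + (f 0 + g 0)" if "y \<in> rbody i f g" for y
  proof -
    have y: "nrm i y \<le> 1" "- g (nrm i y) \<le> y $ i" "y $ i \<le> f (nrm i y)"
      using that by (auto simp: rbody_def)
    have "f (nrm i y) \<le> f 0" "g (nrm i y) \<le> g 0" "0 \<le> f 0" "0 \<le> g 0"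
      using y(1) f g by (auto simp: cap_def)
    then have "\<bar>y $ i\<bar> \<le> f 0 + g 0" using y by linarith
    moreover have "norm y \<le> nrm i y + norm ((y $ i) *\<^sub>R (axis i 1 :: real^'a))"
      unfolding nrm_def using norm_triangle_ineq[of "y - (y $ i) *\<^sub>R axis i 1" "(y $ i) *\<^sub>R axis i 1"] by simp
    ultimately show ?thesis using y(1) by simp
  qed
  then have "bounded (rbody i f g)" by (rule boundedI)
  with cl show ?thesis by (simp add: compact_eq_bounded_closed)
qed

lemma convex_rbody:
  assumes f: "cap f" and g: "cap g"
  shows "convex (rbody i f g)"
proof (rule convexI)
  fix x y :: "real^'a" and u v :: real
  assume x: "x \<in> rbody i f g" and y: "y \<in> rbody i f g" and uv: "0 \<le> u" "0 \<le> v" "u + v = 1"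
  let ?z = "u *\<^sub>R x + v *\<^sub>R y"
  have xy: "nrm i x \<le> 1" "nrm i y \<le> 1" using x y by (auto simp: rbody_def)
  have le: "nrm i ?z \<le> u * nrm i x + v * nrm i y" using uv by (intro nrm_convex)
  have le1: "u * nrm i x + v * nrm i y \<le> 1" using xy uv convex_bound_le[of "nrm i x" 1 "nrm i y" u v] by simp
  have h: "u * h (nrm i x) + v * h (nrm i y) \<le> h (nrm i ?z)" if "cap h" for h
  proof -
    have "u * h (nrm i x) + v * h (nrm i y) \<le> h (u * nrm i x + v * nrm i y)"
      using that xy uv unfolding cap_def by simp
    also have "\<dots> \<le> h (nrm i ?z)"
      using that le le1 unfolding cap_def by simp
    finally show ?thesis .
  qed
  have "?z $ i \<le> u * f (nrm i x) + v * f (nrm i y)"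
    using x y uv by (auto simp: rbody_def intro!: add_mono mult_left_mono)
  moreover have "- (u * g (nrm i x) + v * g (nrm i y)) \<le> ?z $ i"
  proof -
    have "u * - g (nrm i x) + v * - g (nrm i y) \<le> u * x $ i + v * y $ i"
      using x y uv by (intro add_mono mult_left_mono) (auto simp: rbody_def)
    then show ?thesis by simp
  qed
  ultimately show "?z \<in> rbody i f g"
    using le le1 h[OF f] h[OF g] unfolding rbody_def by auto
qed

lemma interior_rbody:
  assumes f: "cap f" "0 < f (1/2)" and g: "cap g" "0 < g (1/2)"
  shows "0 \<in> interior (rbody i f g)"
proof -
  define d where "d = min (1/2) (min (f (1/2)) (g (1/2)))"
  have "ball 0 d \<subseteq> rbody i f g"
  proof
    fix y :: "real^'a" assume "y \<in> ball 0 d"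
    then have y: "norm y < d" by simp
    have "nrm i y \<le> 1/2" using nrm_le_norm[of i y] y by (simp add: d_def)
    moreover have "\<bar>y $ i\<bar> \<le> norm y" by (rule component_le_norm_cart)
    moreover have "f (1/2) \<le> f (nrm i y)" "g (1/2) \<le> g (nrm i y)"
      using f(1) g(1) \<open>nrm i y \<le> 1/2\<close> unfolding cap_def by auto
    ultimately show "y \<in> rbody i f g" using y by (auto simp: rbody_def d_def)
  qed
  moreover have "0 < d" using f g by (simp add: d_def)
  ultimately show ?thesis by (auto simp: mem_interior)
qed

lemma emeasure_rbody:
  assumes f: "cap f" and g: "cap g"
  shows "emeasure lborel (rbody i f g)
    = (\<integral>\<^sup>+x. ennreal (f (sqrt (sq (UNIV - {i}) x)) + g (sqrt (sq (UNIV - {i}) x))) * indicator {x. sq (UNIV - {i}) x \<le> 1} x \<partial>EM (UNIV - {i}))"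
proof -
  have [measurable]: "rbody i f g \<in> sets borel" using compact_rbody[OF f g] by (rule borel_compact)
  have "emeasure lborel (rbody i f g) = (\<integral>\<^sup>+y. indicator (rbody i f g) y \<partial>lborel)" by simp
  also have "\<dots> = (\<integral>\<^sup>+x. (\<integral>\<^sup>+z. indicator (rbody i f g) (vec1 i z x) \<partial>lborel) \<partial>EM (UNIV - {i}))"
    by (rule nn_integral_lborel_vec1) measurable
  also have "\<dots> = (\<integral>\<^sup>+x. ennreal (f (sqrt (sq (UNIV - {i}) x)) + g (sqrt (sq (UNIV - {i}) x))) * indicator {x. sq (UNIV - {i}) x \<le> 1} x \<partial>EM (UNIV - {i}))"
  proof (rule nn_integral_cong)
    fix x
    let ?h = "sqrt (sq (UNIV - {i}) x)"
    show "(\<integral>\<^sup>+z. indicator (rbody i f g) (vec1 i z x) \<partial>lborel) = ennreal (f ?h + g ?h) * indicator {x. sq (UNIV - {i}) x \<le> 1} x"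
    proof (cases "sq (UNIV - {i}) x \<le> 1")
      case True
      then have "?h \<le> 1" by simp
      then have "0 \<le> f ?h" "0 \<le> g ?h" using f g by (auto simp: cap_def)
      moreover have "(\<integral>\<^sup>+z. indicator (rbody i f g) (vec1 i z x) \<partial>lborel) = (\<integral>\<^sup>+z. indicator {- g ?h..f ?h} z \<partial>lborel)"
        using True by (intro nn_integral_cong) (simp add: indicator_def vec1_in_rbody)
      ultimately show ?thesis using True by simp
    qed (simp add: indicator_def vec1_in_rbody)
  qed
  finally show ?thesis .
qed

text \<open>The opposite equator points \<open>e\<close> and \<open>- e\<close> are reflected to
  \<open>2 *\<^sub>R p - e\<close> and \<open>2 *\<^sub>R p + e\<close>. Both stay within distance 1
  of the axis, so the parallelogram law kills the component \<open>q\<close> of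
  \<open>2 *\<^sub>R p\<close> orthogonal to the axis. The images then lie on the unit cylinder,
  where the heights vanish; hence \<open>p = 0\<close>, and the two poles would have to be at equal
  heights.\<close>

lemma not_centrally_symmetric_rbody:
  assumes ij: "i \<noteq> j" and f: "cap f" "f 1 = 0" and g: "cap g" "g 1 = 0" and ne: "f 0 \<noteq> g 0"
  shows "\<not> centrally_symmetric_about p (rbody i f g)"
proof
  assume "centrally_symmetric_about p (rbody i f g)"
  then have S: "(\<lambda>x. x - p) ` rbody i f g = uminus ` (\<lambda>x. x - p) ` rbody i f g"
    by (simp add: centrally_symmetric_about_def origin_symmetric_def)
  have refl: "2 *\<^sub>R p - y \<in> rbody i f g" if "y \<in> rbody i f g" for y
  proof -
    have "- (y - p) \<in> (\<lambda>x. x - p) ` rbody i f g" using that S by blast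
    then obtain y' where "y' \<in> rbody i f g" "- (y - p) = y' - p" by auto
    moreover from this(2) have "y' = 2 *\<^sub>R p - y" by (simp add: algebra_simps scaleR_2)
    ultimately show ?thesis by simp
  qed
  define e where "e = (axis j 1 :: real^'a)"
  have ei: "e $ i = 0" "norm e = 1" using ij by (simp_all add: e_def) (simp add: axis_def)
  have "e \<in> rbody i f g" "- e \<in> rbody i f g"
    using ei f g by (auto simp: rbody_def nrm_def)
  then have mem: "2 *\<^sub>R p - e \<in> rbody i f g" "2 *\<^sub>R p + e \<in> rbody i f g" using refl[of e] refl[of "- e"] by auto
  define q where "q = 2 *\<^sub>R p - ((2 *\<^sub>R p) $ i) *\<^sub>R axis i 1"
  have n: "nrm i (2 *\<^sub>R p - e) = norm (q - e)" "nrm i (2 *\<^sub>R p + e) = norm (q + e)"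
    using ei by (simp_all add: nrm_def q_def algebra_simps)
  then have "norm (q - e) \<le> 1" "norm (q + e) \<le> 1" using mem by (auto simp: rbody_def)
  then have "(norm (q - e))\<^sup>2 \<le> 1" "(norm (q + e))\<^sup>2 \<le> 1" by (simp_all add: power_le_one)
  moreover have "(norm (q - e))\<^sup>2 + (norm (q + e))\<^sup>2 = 2 * (norm q)\<^sup>2 + 2 * (norm e)\<^sup>2"
    by (simp add: power2_norm_eq_inner inner_diff_left inner_diff_right inner_add_left inner_add_right algebra_simps)
  moreover have "(norm e)\<^sup>2 = 1" using ei by simp
  ultimately have "(norm q)\<^sup>2 \<le> 0" by linarith
  then have q0: "q = 0" by simp
  then have "nrm i (2 *\<^sub>R p - e) = 1" using n ei by simp
  then have "(2 *\<^sub>R p) $ i = 0" using mem(1) f g ei by (auto simp: rbody_def)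
  then have "p = 0" using q0 by (simp add: q_def)
  then have sym: "- y \<in> rbody i f g" if "y \<in> rbody i f g" for y using refl[OF that] by simp
  have nax: "nrm i (h *\<^sub>R axis i 1) = 0" for h
    by (simp add: nrm_def)
  have pos: "0 \<le> f 0" "0 \<le> g 0" using f g by (auto simp: cap_def)
  then have "f 0 *\<^sub>R axis i 1 \<in> rbody i f g" "(- g 0) *\<^sub>R axis i 1 \<in> rbody i f g"
    unfolding rbody_def mem_Collect_eq nax by simp_all
  from sym[OF this(1)] sym[OF this(2)] have "(- f 0) *\<^sub>R axis i 1 \<in> rbody i f g" "g 0 *\<^sub>R axis i 1 \<in> rbody i f g"
    by simp_all
  then have "f 0 \<le> g 0" "g 0 \<le> f 0"
    unfolding rbody_def mem_Collect_eq nax by simp_all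
  then show False using ne by simp
qed

text \<open>Continuity is proved for the square, which is Lipschitz by
  \<open>\<psi>_sq_mono\<close>; the height itself need not be Lipschitz at radius 1, as the
  ellipsoid shows.\<close>

lemma (in profile) cap_\<psi>: "cap \<psi>"
proof -
  have lip: "\<bar>(\<psi> x)\<^sup>2 - (\<psi> y)\<^sup>2\<bar> \<le> 2 * \<beta>\<^sup>2 * (y - x)" if xy: "0 \<le> x" "x \<le> y" "y \<le> 1" for x y
  proof -
    have "(\<psi> y)\<^sup>2 \<le> (\<psi> x)\<^sup>2"
      using \<psi>_antimono[OF xy] \<psi>_nonneg[of y] by (intro power_mono)
    moreover have "(\<psi> x)\<^sup>2 - (\<psi> y)\<^sup>2 \<le> \<beta>\<^sup>2 * (y\<^sup>2 - x\<^sup>2)"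
      using \<psi>_sq_mono[OF xy] by (simp add: algebra_simps)
    moreover have "y\<^sup>2 - x\<^sup>2 \<le> 2 * (y - x)"
    proof -
      have "(y + x) * (y - x) \<le> 2 * (y - x)" using xy by (intro mult_right_mono) auto
      then show ?thesis by (simp add: power2_eq_square algebra_simps)
    qed
    then have "\<beta>\<^sup>2 * (y\<^sup>2 - x\<^sup>2) \<le> \<beta>\<^sup>2 * (2 * (y - x))" by (intro mult_left_mono) auto
    moreover have "\<beta>\<^sup>2 * (2 * (y - x)) = 2 * \<beta>\<^sup>2 * (y - x)" by simp
    ultimately show ?thesis by linarith
  qed
  have "(2 * \<beta>\<^sup>2)-lipschitz_on {0..1} (\<lambda>r. (\<psi> r)\<^sup>2)"
  proof (rule lipschitz_onI)
    fix x y :: real assume xy: "x \<in> {0..1}" "y \<in> {0..1}"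
    show "dist ((\<psi> x)\<^sup>2) ((\<psi> y)\<^sup>2) \<le> 2 * \<beta>\<^sup>2 * dist x y"
      using lip[of x y] lip[of y x] xy by (cases "x \<le> y") (auto simp: dist_real_def abs_minus_commute)
  qed simp
  then have "continuous_on {0..1} (\<lambda>r. sqrt ((\<psi> r)\<^sup>2))"
    by (intro continuous_intros lipschitz_on_continuous_on)
  then have "continuous_on {0..1} \<psi>" using \<psi>_nonneg by simp
  then show ?thesis
    unfolding cap_def using \<psi>_nonneg \<psi>_antimono \<psi>_concave by simp
qed

section \<open>The profiles\<close>

text \<open>\<open>upper\<close> is a profile for height 1; enlarging the height lets both halves of
  the body obey the tilting estimate with the same constant.\<close>

lemma profile_weaken:
  assumes "profile a \<beta>" "\<beta> \<le> \<beta>'"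
  shows "profile a \<beta>'"
proof -
  interpret profile a \<beta> by fact
  show ?thesis
  proof
    show "p / sqrt (\<beta>'\<^sup>2 + p\<^sup>2) \<le> a p" if "0 < p" for p
    proof -
      have "sqrt (\<beta>\<^sup>2 + p\<^sup>2) \<le> sqrt (\<beta>'\<^sup>2 + p\<^sup>2)"
        using \<beta> assms(2) by (simp add: power_mono)
      moreover have "0 < sqrt (\<beta>\<^sup>2 + p\<^sup>2)" using \<beta> by (simp add: add_pos_nonneg)
      ultimately have "p / sqrt (\<beta>'\<^sup>2 + p\<^sup>2) \<le> p / sqrt (\<beta>\<^sup>2 + p\<^sup>2)"
        using that by (intro divide_left_mono) (auto intro: mult_pos_pos)
      then show ?thesis using a_ge[OF that] by simp
    qed
  qed (use \<beta> assms(2) a_mono a_le_1 in auto)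
qed

definition ell :: "real \<Rightarrow> real \<Rightarrow> real" where
  "ell b p = p / sqrt (b + p\<^sup>2)"

lemma ell_measurable [measurable]: "ell b \<in> borel_measurable borel"
  unfolding ell_def[abs_def] by measurable

lemma ell_bounds:
  assumes "0 < b" "0 < p"
  shows "0 < ell b p" "ell b p < 1"
proof -
  have "sqrt (p\<^sup>2) < sqrt (b + p\<^sup>2)" using assms by (intro real_sqrt_less_mono) simp
  then show "0 < ell b p" "ell b p < 1" using assms by (auto simp: ell_def add_pos_nonneg)
qed

lemma ell_antimono:
  assumes "0 < b" "b \<le> b'" "0 < p"
  shows "ell b' p \<le> ell b p"
  unfolding ell_def using assms
  by (intro divide_left_mono mult_pos_pos) (auto simp: add_pos_nonneg)

lemma ell_less:
  assumes "0 < b" "b < b'" "0 < p"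
  shows "ell b' p < ell b p"
  unfolding ell_def using assms
  by (intro divide_strict_left_mono mult_pos_pos) (auto simp: add_pos_nonneg)

lemma ell_deriv:
  assumes "0 < b"
  shows "(ell b has_real_derivative b / sqrt (b + p\<^sup>2) ^ 3) (at p)"
proof -
  have pos: "0 < b + p\<^sup>2" using assms by (simp add: add_pos_nonneg)
  define h where "h = sqrt (b + p\<^sup>2)"
  have h: "0 < h" "h\<^sup>2 = b + p\<^sup>2" using pos by (auto simp: h_def)
  have "(ell b has_real_derivative (h - p * (p / h)) / h\<^sup>2) (at p)"
    unfolding ell_def[abs_def] h_def using pos
    by (auto intro!: derivative_eq_intros simp: field_simps power2_eq_square)
  also have "(h - p * (p / h)) / h\<^sup>2 = (h\<^sup>2 - p\<^sup>2) / h ^ 3"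
    using h(1) by (simp add: field_simps power2_eq_square power3_eq_cube)
  also have "\<dots> = b / h ^ 3" by (simp add: h(2))
  finally show ?thesis by (simp add: h_def)
qed

lemma ell_mono:
  assumes "0 < b" "p \<le> q"
  shows "ell b p \<le> ell b q"
proof (rule DERIV_nonneg_imp_nondecreasing[OF assms(2)])
  fix x
  show "\<exists>y. (ell b has_real_derivative y) (at x) \<and> 0 \<le> y"
    using ell_deriv[OF assms(1), of x] assms(1) by (intro exI conjI) auto
qed

lemma profile_ell:
  assumes "0 < \<beta>"
  shows "profile (ell (\<beta>\<^sup>2)) \<beta>"
proof
  have b: "0 < \<beta>\<^sup>2" using assms by simp
  show "ell (\<beta>\<^sup>2) p \<le> ell (\<beta>\<^sup>2) q" if "p \<le> q" for p q
    using b that by (rule ell_mono)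
  show "ell (\<beta>\<^sup>2) p \<le> 1" if "0 < p" for p using ell_bounds(2)[OF b that] by simp
  show "p / sqrt (\<beta>\<^sup>2 + p\<^sup>2) \<le> ell (\<beta>\<^sup>2) p" for p by (simp add: ell_def)
qed (use assms in auto)

lemma \<psi>_ell:
  assumes "0 < \<beta>" "0 \<le> r" "r \<le> 1"
  shows "profile.\<psi> (ell (\<beta>\<^sup>2)) r = \<beta> * sqrt (1 - r\<^sup>2)"
proof -
  interpret profile "ell (\<beta>\<^sup>2)" \<beta> using assms(1) by (rule profile_ell)
  have "ennreal (\<psi> r) = ennreal (\<beta> * sqrt (1 - r\<^sup>2))"
    unfolding ennreal_\<psi>[OF assms(2,3)] ell_def by (rule ellipse_profile_integral[OF assms])
  moreover have "0 \<le> \<beta> * sqrt (1 - r\<^sup>2)" using assms by (simp add: power_le_one)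
  ultimately show ?thesis using \<psi>_nonneg by (simp only: ennreal_inj)
qed

text \<open>The profile whose \<open>m\<close>-th power averages with that of the half ellipsoid of height
  \<open>sqrt (3/2)\<close> to the \<open>m\<close>-th power of the profile of the ball.\<close>

definition upper :: "nat \<Rightarrow> real \<Rightarrow> real" where
  "upper m p = root m (2 * ell 1 p ^ m - ell (3/2) p ^ m)"

lemma upper_radicand_ge:
  assumes "0 < p"
  shows "ell 1 p ^ m \<le> 2 * ell 1 p ^ m - ell (3/2) p ^ m"
proof -
  have "ell (3/2) p ^ m \<le> ell 1 p ^ m"
    using assms ell_antimono[of 1 "3/2" p] ell_bounds[of "3/2" p] by (intro power_mono) auto
  then show ?thesis by simp
qed

text \<open>The derivative compares \<open>3/2\<close> over a larger cube with twice 1 over a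
  smaller one, so the squared height being at most 2 decides. The remaining factors are ordered by
  \<open>ell_antimono\<close>.\<close>

lemma upper_radicand_mono:
  assumes m: "0 < m" and pq: "0 < p" "p \<le> q"
  shows "2 * ell 1 p ^ m - ell (3/2) p ^ m \<le> 2 * ell 1 q ^ m - ell (3/2) q ^ m"
proof (rule DERIV_nonneg_imp_nondecreasing[OF pq(2)])
  fix x assume "p \<le> x" "x \<le> q"
  then have x: "0 < x" using pq by simp
  let ?A = "1 / sqrt (1 + x\<^sup>2) ^ 3" and ?B = "(3/2) / sqrt (3/2 + x\<^sup>2) ^ 3"
  have d: "((\<lambda>p. 2 * ell 1 p ^ m - ell (3/2) p ^ m) has_real_derivative
      2 * (real m * ell 1 x ^ (m - 1) * ?A) - real m * ell (3/2) x ^ (m - 1) * ?B) (at x)"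
    by (auto intro!: derivative_eq_intros ell_deriv)
  have s: "0 < sqrt (1 + x\<^sup>2)" "sqrt (1 + x\<^sup>2) \<le> sqrt (3/2 + x\<^sup>2)" by (simp_all add: add_pos_nonneg)
  have B: "?B \<le> 2 * ?A"
  proof -
    have "sqrt (1 + x\<^sup>2) ^ 3 \<le> sqrt (3/2 + x\<^sup>2) ^ 3" using s by (intro power_mono) auto
    then have "?B \<le> (3/2) / sqrt (1 + x\<^sup>2) ^ 3" using s by (intro divide_left_mono) auto
    also have "\<dots> \<le> 2 / sqrt (1 + x\<^sup>2) ^ 3" using s by (intro divide_right_mono) auto
    finally show ?thesis by simp
  qed
  have "ell (3/2) x ^ (m - 1) * ?B \<le> ell 1 x ^ (m - 1) * (2 * ?A)"
  proof (rule mult_mono[OF power_mono B])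
    show "ell (3/2) x \<le> ell 1 x" using x by (intro ell_antimono) auto
    show "0 \<le> ell (3/2) x" using ell_bounds(1)[of "3/2" x] x by simp
    show "0 \<le> ell 1 x ^ (m - 1)" using ell_bounds(1)[of 1 x] x by simp
    show "0 \<le> ?B" by simp
  qed
  from mult_left_mono[OF this, of "real m"]
  have "0 \<le> 2 * (real m * ell 1 x ^ (m - 1) * ?A) - real m * ell (3/2) x ^ (m - 1) * ?B"
    by (simp add: mult_ac)
  with d show "\<exists>y. ((\<lambda>p. 2 * ell 1 p ^ m - ell (3/2) p ^ m) has_real_derivative y) (at x) \<and> 0 \<le> y"
    by blast
qed

text \<open>The radicand is nondecreasing and tends to \<open>2 - 1 = 1\<close>.\<close>

lemma upper_radicand_le_1:
  assumes m: "0 < m" and p: "0 < p"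
  shows "2 * ell 1 p ^ m - ell (3/2) p ^ m \<le> 1"
proof -
  have e: "(ell b \<longlongrightarrow> 1) at_top" if "0 < b" for b
    unfolding ell_def[abs_def] using that by real_asymp
  have "((\<lambda>p. 2 * ell 1 p ^ m - ell (3/2) p ^ m) \<longlongrightarrow> 2 * 1 ^ m - 1 ^ m) at_top"
    by (intro tendsto_intros e) auto
  then have lim: "((\<lambda>p. 2 * ell 1 p ^ m - ell (3/2) p ^ m) \<longlongrightarrow> 1) at_top" by simp
  show ?thesis
  proof (rule tendsto_lowerbound[OF lim])
    show "\<forall>\<^sub>F q in at_top. 2 * ell 1 p ^ m - ell (3/2) p ^ m \<le> 2 * ell 1 q ^ m - ell (3/2) q ^ m"
      using eventually_ge_at_top[of p] by eventually_elim (rule upper_radicand_mono[OF m p])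
  qed simp
qed

lemma upper_pow:
  assumes "0 < m" "0 < p"
  shows "upper m p ^ m = 2 * ell 1 p ^ m - ell (3/2) p ^ m"
proof -
  have "0 \<le> ell 1 p ^ m" using ell_bounds(1)[of 1 p] assms by simp
  then have "0 \<le> 2 * ell 1 p ^ m - ell (3/2) p ^ m" using upper_radicand_ge[OF assms(2), of m] by linarith
  then show ?thesis unfolding upper_def using assms by (simp add: real_root_pow_pos2)
qed

lemma upper_ge:
  assumes "0 < m" "0 < p"
  shows "ell 1 p \<le> upper m p"
proof -
  have "ell 1 p = root m (ell 1 p ^ m)"
    using ell_bounds(1)[of 1 p] assms by (simp add: real_root_power_cancel)
  also have "\<dots> \<le> upper m p"
    unfolding upper_def using upper_radicand_ge[OF assms(2)] assms by (intro real_root_le_mono)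
  finally show ?thesis .
qed

lemma profile_upper:
  assumes m: "0 < m"
  shows "profile (upper m) 1"
proof
  have "continuous_on UNIV (root m)" by (intro continuous_on_real_root continuous_intros)
  then have [measurable]: "root m \<in> borel_measurable borel" by (rule borel_measurable_continuous_onI)
  show "upper m \<in> borel_measurable borel" unfolding upper_def[abs_def] by measurable
  show "upper m p \<le> upper m q" if "0 < p" "p \<le> q" for p q
    unfolding upper_def using upper_radicand_mono[OF m that] m by (intro real_root_le_mono)
  show "upper m p \<le> 1" if "0 < p" for p
    unfolding upper_def using upper_radicand_le_1[OF m that] m by simp
  show "p / sqrt (1\<^sup>2 + p\<^sup>2) \<le> upper m p" if "0 < p" for p
    using upper_ge[OF m that] by (simp add: ell_def)
qed simp

text \<open>At slope \<open>1/4\<close> the ball has radius at most \<open>1/4\<close>, so the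
  radicand is below \<open>1/2\<close>. A profile value below 1 is what gives the upper half
  positive height in \<open>\<psi>_half_pos\<close>.\<close>

lemma upper_less_1:
  assumes m: "0 < m"
  shows "upper m (1/4) < 1"
proof (rule ccontr)
  assume "\<not> upper m (1/4) < 1"
  then have "1 \<le> upper m (1/4) ^ m" by (intro one_le_power) simp
  moreover have "0 < ell (3/2) (1/4) ^ m" by (intro zero_less_power ell_bounds) auto
  moreover have "ell 1 (1/4) ^ m \<le> 1/4"
  proof -
    have "(1/4) / sqrt (1 + (1/4)\<^sup>2) \<le> (1/4) / (1::real)"
      by (intro divide_left_mono) (auto simp: power2_eq_square)
    then have "ell 1 (1/4) \<le> 1/4" by (simp add: ell_def)
    moreover have "ell 1 (1/4) ^ m \<le> ell 1 (1/4) ^ 1"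
      using m ell_bounds[of 1 "1/4"] by (intro power_decreasing) auto
    ultimately show ?thesis by simp
  qed
  ultimately show False using upper_pow[OF m, of "1/4"] by simp
qed

lemma (in profile) \<psi>_half_pos:
  assumes "0 < q" "a q < 1"
  shows "0 < \<psi> (1/2)"
proof -
  have "0 < ennreal ((1 - max (1/2) (a q)) * q)" using assms by simp
  also have "\<dots> = (\<integral>\<^sup>+p. ennreal (1 - max (1/2) (a q)) * indicator {0<..q} p \<partial>lborel)"
    using assms by (simp add: nn_integral_cmult ennreal_mult)
  also have "\<dots> \<le> ennreal (\<psi> (1/2))"
  proof (subst ennreal_\<psi>, simp, simp, intro nn_integral_mono)
    fix p :: real
    show "ennreal (1 - max (1/2) (a q)) * indicator {0<..q} p \<le> ennreal (1 - max (1/2) (a p)) * indicator {0<..} p"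
    proof (cases "p \<in> {0<..q}")
      case True
      then have "a p \<le> a q" using a_mono by auto
      then show ?thesis using True by (auto intro!: ennreal_leI)
    qed simp
  qed
  finally show ?thesis by simp
qed

text \<open>Strict convexity of \<open>t\<close> to the power \<open>(m + 1) / m\<close>, in
  algebraic form: the tangent inequality at \<open>b\<close> is Bernoulli's inequality for
  \<open>b / z\<close>, and adding it for \<open>x\<close> and \<open>y\<close> makes the terms with
  \<open>b\<close> combine by \<open>eq\<close>. Strictness is taken from \<open>y\<close>.\<close>

lemma power_mean_strict:
  fixes x y b :: real
  assumes x: "0 < x" and y: "0 < y" and b: "0 < b" and m: "0 < m"
    and eq: "x ^ m + y ^ m = 2 * b ^ m" and ne: "y \<noteq> b"
  shows "2 * b ^ Suc m < x ^ Suc m + y ^ Suc m"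
proof -
  \<comment> \<open>Strict Bernoulli from the weak one for \<open>n - 1\<close>: multiplying by
    \<open>1 + t\<close> produces the positive surplus
    \<open>real (n - 1) * t\<^sup>2\<close>.\<close>
  have bern: "1 + real n * t < (1 + t) ^ n \<or> n \<le> 1 \<or> t = 0" if "-1 < t" for t :: real and n
  proof (cases "n \<le> 1 \<or> t = 0")
    case False
    have "1 + real (n - 1) * t \<le> (1 + t) ^ (n - 1)"
      using that by (intro Bernoulli_inequality) simp
    then have "(1 + real (n - 1) * t) * (1 + t) \<le> (1 + t) ^ (n - 1) * (1 + t)"
      using that by (intro mult_right_mono) auto
    moreover have "(1 + t) ^ (n - 1) * (1 + t) = (1 + t) ^ n"
      using False by (cases n) auto
    moreover have "(1 + real (n - 1) * t) * (1 + t) = 1 + real n * t + real (n - 1) * t\<^sup>2"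
      using False by (simp add: of_nat_diff algebra_simps power2_eq_square)
    moreover have "0 < real (n - 1) * t\<^sup>2" using False by simp
    ultimately show ?thesis by linarith
  qed simp
  have tangent: "real (Suc m) * b * z ^ m \<le> real m * z ^ Suc m + b ^ Suc m"
    and tangent_strict: "z \<noteq> b \<Longrightarrow> real (Suc m) * b * z ^ m < real m * z ^ Suc m + b ^ Suc m"
    if z: "0 < z" for z
  proof -
    define t where "t = b / z - 1"
    have t: "-1 < t" "t = 0 \<longleftrightarrow> z = b" using z b by (auto simp: t_def field_simps)
    have id1: "z ^ Suc m * (1 + real (Suc m) * t) = real (Suc m) * b * z ^ m - real m * z ^ Suc m"
      using z by (simp add: t_def field_simps)
    have id2: "z ^ Suc m * (1 + t) ^ Suc m = b ^ Suc m"
      using z by (simp add: t_def power_divide del: power_Suc)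
    have zp: "0 < z ^ Suc m" using z by simp
    show "real (Suc m) * b * z ^ m \<le> real m * z ^ Suc m + b ^ Suc m"
    proof -
      have "1 + real (Suc m) * t \<le> (1 + t) ^ Suc m" using t by (intro Bernoulli_inequality) simp
      from mult_left_mono[OF this less_imp_le[OF zp]] show ?thesis unfolding id1 id2 by simp
    qed
    show "real (Suc m) * b * z ^ m < real m * z ^ Suc m + b ^ Suc m" if "z \<noteq> b"
    proof -
      have "1 + real (Suc m) * t < (1 + t) ^ Suc m" using bern[OF t(1), of "Suc m"] t that m by auto
      from mult_strict_left_mono[OF this zp] show ?thesis unfolding id1 id2 by simp
    qed
  qed
  have "real (Suc m) * b * x ^ m + real (Suc m) * b * y ^ m
      < real m * x ^ Suc m + b ^ Suc m + (real m * y ^ Suc m + b ^ Suc m)"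
    using tangent[OF x] tangent_strict[OF y ne] by (rule add_le_less_mono)
  moreover have "real (Suc m) * b * x ^ m + real (Suc m) * b * y ^ m = 2 * real (Suc m) * b ^ Suc m"
  proof -
    have "real (Suc m) * b * x ^ m + real (Suc m) * b * y ^ m = real (Suc m) * b * (x ^ m + y ^ m)"
      by (simp add: algebra_simps)
    then show ?thesis by (simp add: eq)
  qed
  ultimately have "real m * (2 * b ^ Suc m) < real m * (x ^ Suc m + y ^ Suc m)"
    by (simp add: algebra_simps)
  then show ?thesis using m by simp
qed

section \<open>Comparison with the ball\<close>

lemma (in profile) J_measurable [measurable]: "J c s \<in> borel_measurable borel"
proof -
  have [measurable]: "(\<lambda>(u, \<tau>). indicator {0..sqrt (1 - u)} \<tau> :: ennreal) \<in> borel_measurable (borel \<Otimes>\<^sub>M borel)"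
    unfolding indicator_def by (simp, measurable)
  show ?thesis unfolding J_def[abs_def] by measurable
qed

lemma (in profile) J_eq_0: "1 < u \<Longrightarrow> J c s u = 0"
proof -
  assume "1 < u"
  then have "sqrt (1 - u) < 0" by simp
  then show ?thesis unfolding J_def by simp
qed

text \<open>For \<open>c = 0\<close> the maximised quantity is the height alone, which is largest at
  \<open>t = 0\<close>. Thus the shadow along a direction orthogonal to the axis is bounded by the
  section through the axis.\<close>

lemma (in profile) J_vertical_le:
  assumes u: "0 \<le> u" "u \<le> 1"
  shows "J 0 1 u \<le> ennreal (\<psi> (sqrt u))"
proof -
  obtain t where t: "0 \<le> t" "t \<le> sqrt (1 - u)"
    and J: "ennreal (0 * t + 1 * \<psi> (sqrt (t\<^sup>2 + u))) = ennreal (0 * sqrt (1 - u)) + J 0 1 u"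
    using width_attained[OF u, of 0 1] by auto
  have "t\<^sup>2 \<le> (sqrt (1 - u))\<^sup>2" using t by (intro power_mono)
  then have "sqrt (t\<^sup>2 + u) \<le> 1" using u by simp
  then have "\<psi> (sqrt (t\<^sup>2 + u)) \<le> \<psi> (sqrt u)" using u by (intro \<psi>_antimono) auto
  then have "ennreal (\<psi> (sqrt (t\<^sup>2 + u))) \<le> ennreal (\<psi> (sqrt u))" by (rule ennreal_leI)
  then show ?thesis using J by simp
qed

text \<open>Moving out by \<open>t * c\<close> lowers the squared height by at most
  \<open>\<beta>\<^sup>2 * (t * c)\<^sup>2\<close>, by \<open>\<psi>_sq_mono\<close>, so at least
  \<open>t\<^sup>2 * D\<^sup>2 - \<beta>\<^sup>2 * (t * c)\<^sup>2 = (t * s)\<^sup>2\<close>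
  remains. A tilted chord is therefore at least \<open>1 / D\<close> times the vertical one.\<close>

lemma (in profile) chord_in_graph:
  assumes u: "0 \<le> u" "u \<le> 1" and t: "0 \<le> t" "t * D \<le> \<psi> (sqrt u)"
    and D: "D\<^sup>2 = s\<^sup>2 + \<beta>\<^sup>2 * c\<^sup>2" "0 \<le> D"
  shows "(t * c)\<^sup>2 + u \<le> 1" "t * s \<le> \<psi> (sqrt ((t * c)\<^sup>2 + u))"
proof -
  have "0 \<le> t * D" using t D by simp
  then have "(t * D)\<^sup>2 \<le> (\<psi> (sqrt u))\<^sup>2" using t by (intro power_mono)
  then have tD: "t\<^sup>2 * s\<^sup>2 + \<beta>\<^sup>2 * (t * c)\<^sup>2 \<le> (\<psi> (sqrt u))\<^sup>2"
    by (simp add: power_mult_distrib D algebra_simps)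
  have "(\<psi> (sqrt u))\<^sup>2 \<le> (\<beta> * sqrt (1 - (sqrt u)\<^sup>2))\<^sup>2"
    using \<psi>_le[of "sqrt u"] u \<psi>_nonneg by (intro power_mono) auto
  also have "\<dots> = \<beta>\<^sup>2 * (1 - u)" using u by (simp add: power_mult_distrib)
  finally have le: "(\<psi> (sqrt u))\<^sup>2 \<le> \<beta>\<^sup>2 * (1 - u)" .
  moreover have "0 \<le> t\<^sup>2 * s\<^sup>2" by simp
  ultimately have "\<beta>\<^sup>2 * (t * c)\<^sup>2 \<le> \<beta>\<^sup>2 * (1 - u)" using tD by linarith
  then have "(t * c)\<^sup>2 \<le> 1 - u" using \<beta> by simp
  then show 1: "(t * c)\<^sup>2 + u \<le> 1" by simp
  have "(\<psi> (sqrt u))\<^sup>2 + \<beta>\<^sup>2 * u \<le> (\<psi> (sqrt ((t * c)\<^sup>2 + u)))\<^sup>2 + \<beta>\<^sup>2 * ((t * c)\<^sup>2 + u)"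
    using \<psi>_sq_mono[of "sqrt u" "sqrt ((t * c)\<^sup>2 + u)"] u 1 by simp
  then have "(t * s)\<^sup>2 \<le> (\<psi> (sqrt ((t * c)\<^sup>2 + u)))\<^sup>2"
    using tD by (simp add: power_mult_distrib algebra_simps)
  then show "t * s \<le> \<psi> (sqrt ((t * c)\<^sup>2 + u))"
    by (rule power2_le_imp_le) (rule \<psi>_nonneg)
qed

section \<open>The body \<open>L\<close>, its volume and its total shadow width\<close>

locale oval =
  fixes i j :: "'n::finite"
  assumes ij: "i \<noteq> j"
begin

text \<open>The coordinates left after the axis \<open>i\<close> and the direction \<open>j\<close>
  of tilting; the set is empty in the plane.\<close>

definition I :: "'n set" where "I = UNIV - {i, j}"
definition m :: nat where "m = Suc (card I)"

lemma I: "finite I" "j \<notin> I" "i \<notin> I" "insert j I = UNIV - {i}"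
  using ij by (auto simp: I_def)

lemma m: "0 < m" "card (UNIV - {i}) = m"
proof -
  show "0 < m" by (simp add: m_def)
  show "card (UNIV - {i}) = m" using card_insert_disjoint[OF I(1,2)] by (simp only: I(4) m_def)
qed

lemma sqE: "sq (UNIV - {i}) x = (x j)\<^sup>2 + sq I x"
  using sq_insert[OF I(1,2)] I(4) by simp

text \<open>\<open>N\<close> and \<open>S\<close> are the upper and the lower half of the body,
  \<open>B\<close> is either half of the unit ball. \<open>N\<close> is taken with the height bound
  of \<open>S\<close>, so that one factor \<open>D\<close> serves both halves in
  \<open>section_ge\<close>.\<close>

sublocale N: profile "upper m" "sqrt (3/2)"
  by (rule profile_weaken[OF profile_upper[OF m(1)]]) simp

sublocale S: profile "ell (3/2)" "sqrt (3/2)"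
  using profile_ell[of "sqrt (3/2)"] by simp

sublocale B: profile "ell 1" 1
  using profile_ell[of 1] by simp

definition L :: "(real^'n) set" where "L = rbody i N.\<psi> S.\<psi>"

lemma compact_L: "compact L" and convex_L: "convex L" and revolution_L: "revolution_about i L"
  unfolding L_def by (intro compact_rbody convex_rbody revolution_about_rbody N.cap_\<psi> S.cap_\<psi>)+

lemma interior_L: "0 \<in> interior L"
  unfolding L_def
proof (intro interior_rbody N.cap_\<psi> S.cap_\<psi>)
  show "0 < N.\<psi> (1/2)" using N.\<psi>_half_pos[of "1/4"] upper_less_1[OF m(1)] by simp
  show "0 < S.\<psi> (1/2)" using S.\<psi>_half_pos[of 1] ell_bounds[of "3/2" 1] by simp
qed

lemma \<psi>_B: "0 \<le> r \<Longrightarrow> r \<le> 1 \<Longrightarrow> B.\<psi> r = sqrt (1 - r\<^sup>2)"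
  using \<psi>_ell[of 1 r] by simp

lemma not_centrally_symmetric_L: "\<not> centrally_symmetric_about p L"
  unfolding L_def
proof (rule not_centrally_symmetric_rbody[OF ij N.cap_\<psi> N.\<psi>_1 S.cap_\<psi> S.\<psi>_1])
  interpret N1: profile "upper m" 1 by (rule profile_upper[OF m(1)])
  have "N.\<psi> 0 \<le> 1" using N1.\<psi>_le[of 0] by simp
  moreover have "S.\<psi> 0 = sqrt (3/2)" using \<psi>_ell[of "sqrt (3/2)" 0] by simp
  moreover have "1 < sqrt (3/2 :: real)" by simp
  ultimately show "N.\<psi> 0 \<noteq> S.\<psi> 0" by linarith
qed

lemma emeasure_rbody_profiles:
  assumes "profile a \<beta>" "profile a' \<beta>'"
  defines "v \<equiv> \<lambda>a p. vball (UNIV - {i}) * ennreal ((1 - a p ^ Suc m) / real (Suc m)) * indicator {0<..} p"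
  shows "emeasure lborel (rbody i (profile.\<psi> a) (profile.\<psi> a'))
    = (\<integral>\<^sup>+p. (v a p + v a' p) \<partial>lborel)"
proof -
  interpret A: profile a \<beta> by fact
  interpret A': profile a' \<beta>' by fact
  let ?E = "UNIV - {i}"
  let ?h = "\<lambda>x. sqrt (sq ?E x)" and ?D = "{x. sq ?E x \<le> 1}"
  have jE: "j \<in> ?E" using ij by simp
  have meas: "(\<lambda>x. ennreal (f (sqrt (sq ?E x))) * indicator ?D x) \<in> borel_measurable (EM ?E)" if "cap f" for f
  proof -
    \<comment> \<open>Extended constantly beyond the unit interval, the cap becomes continuous on
      the line and hence Borel.\<close>
    have "continuous_on UNIV (\<lambda>r. f (max 0 (min 1 r)))"
      by (rule continuous_on_compose2[of "{0..1}" f]) (use that in \<open>auto simp: cap_def intro!: continuous_intros\<close>)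
    then have [measurable]: "(\<lambda>r. f (max 0 (min 1 r))) \<in> borel_measurable borel"
      by (rule borel_measurable_continuous_onI)
    have "(\<lambda>x. ennreal (f (?h x)) * indicator ?D x)
        = (\<lambda>x. if sq ?E x \<le> 1 then ennreal (f (max 0 (min 1 (?h x)))) else 0)"
      by (auto simp: indicator_def fun_eq_iff)
    also have "\<dots> \<in> borel_measurable (EM ?E)" by measurable
    finally show ?thesis .
  qed
  have "emeasure lborel (rbody i A.\<psi> A'.\<psi>)
      = (\<integral>\<^sup>+x. (ennreal (A.\<psi> (?h x)) * indicator ?D x + ennreal (A'.\<psi> (?h x)) * indicator ?D x) \<partial>EM ?E)"
    unfolding emeasure_rbody[OF A.cap_\<psi> A'.cap_\<psi>]
    by (simp add: A.\<psi>_nonneg A'.\<psi>_nonneg distrib_right)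
  also have "\<dots> = (\<integral>\<^sup>+x. ennreal (A.\<psi> (?h x)) * indicator ?D x \<partial>EM ?E)
      + (\<integral>\<^sup>+x. ennreal (A'.\<psi> (?h x)) * indicator ?D x \<partial>EM ?E)"
    by (intro nn_integral_add meas A.cap_\<psi> A'.cap_\<psi>)
  also have "\<dots> = (\<integral>\<^sup>+p. v a p \<partial>lborel) + (\<integral>\<^sup>+p. v a' p \<partial>lborel)"
    unfolding A.nn_integral_\<psi>[OF finite jE] A'.nn_integral_\<psi>[OF finite jE] v_def m(2) ..
  also have "\<dots> = (\<integral>\<^sup>+p. (v a p + v a' p) \<partial>lborel)"
    unfolding v_def by (intro nn_integral_add[symmetric]) measurable
  finally show ?thesis .
qed

lemma cball_eq_rbody: "cball 0 1 = rbody i B.\<psi> B.\<psi>"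
proof (intro set_eqI iffI)
  have sq: "(nrm i y)\<^sup>2 = (norm y)\<^sup>2 - (y $ i)\<^sup>2" for y :: "real^'n"
  proof -
    have "vec1 i (y $ i) (\<lambda>k. y $ k) = y" by (simp add: vec1_def vec_eq_iff)
    then show ?thesis
      using norm_vec1_sq[of i "y $ i" "\<lambda>k. y $ k"] nrm_vec1[of i "y $ i" "\<lambda>k. y $ k"] by simp
  qed
  fix y :: "real^'n"
  have iff: "y \<in> cball 0 1 \<longleftrightarrow> (y $ i)\<^sup>2 + (nrm i y)\<^sup>2 \<le> 1"
    using abs_square_le_1[of "norm y"] by (simp add: sq)
  have key: "(y $ i)\<^sup>2 \<le> 1 - (nrm i y)\<^sup>2 \<longleftrightarrow> \<bar>y $ i\<bar> \<le> sqrt (1 - (nrm i y)\<^sup>2)"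
    using real_sqrt_le_iff[of "(y $ i)\<^sup>2" "1 - (nrm i y)\<^sup>2"] by simp
  {
    assume "y \<in> cball 0 1"
    then have *: "(y $ i)\<^sup>2 + (nrm i y)\<^sup>2 \<le> 1" by (simp only: iff)
    then have "(nrm i y)\<^sup>2 \<le> 1" using zero_le_power2[of "y $ i"] by linarith
    then have "nrm i y \<le> 1" by (simp add: abs_square_le_1)
    moreover have "\<bar>y $ i\<bar> \<le> sqrt (1 - (nrm i y)\<^sup>2)" using * key by linarith
    ultimately show "y \<in> rbody i B.\<psi> B.\<psi>" by (auto simp: rbody_def \<psi>_B abs_le_iff)
  next
    assume "y \<in> rbody i B.\<psi> B.\<psi>"
    then have "\<bar>y $ i\<bar> \<le> sqrt (1 - (nrm i y)\<^sup>2)" by (auto simp: rbody_def \<psi>_B abs_le_iff)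
    then show "y \<in> cball 0 1" unfolding iff using key by linarith
  }
qed

lemma upper_power: "0 < p \<Longrightarrow> upper m p ^ m + ell (3/2) p ^ m = 2 * ell 1 p ^ m"
  using upper_pow[OF m(1)] by simp

lemma volume_less: "emeasure lborel L < emeasure lborel (cball (0::real^'n) 1)"
proof -
  let ?V = "vball (UNIV - {i})"
  let ?v = "\<lambda>a p. ?V * ennreal ((1 - a p ^ Suc m) / real (Suc m)) * indicator {0<..} p"
  have L: "emeasure lborel L = (\<integral>\<^sup>+p. (?v (upper m) p + ?v (ell (3/2)) p) \<partial>lborel)"
    unfolding L_def by (rule emeasure_rbody_profiles[OF N.profile_axioms S.profile_axioms])
  have B: "emeasure lborel (cball (0::real^'n) 1) = (\<integral>\<^sup>+p. (?v (ell 1) p + ?v (ell 1) p) \<partial>lborel)"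
    unfolding cball_eq_rbody by (rule emeasure_rbody_profiles[OF B.profile_axioms B.profile_axioms])
  have less: "?v (upper m) p + ?v (ell (3/2)) p < ?v (ell 1) p + ?v (ell 1) p" if p: "0 < p" for p
  proof -
    let ?d = "\<lambda>a. (1 - a ^ Suc m) / real (Suc m)"
    have d: "0 \<le> ?d a" if "0 \<le> a" "a \<le> 1" for a :: real
      using power_le_one[OF that, of "Suc m"] by (simp del: power_Suc of_nat_Suc)
    have "0 < upper m p" using upper_ge[OF m(1) p] ell_bounds(1)[of 1 p] p by linarith
    then have "2 * ell 1 p ^ Suc m < upper m p ^ Suc m + ell (3/2) p ^ Suc m"
      using p m(1) ell_less[of 1 "3/2" p] by (intro power_mean_strict upper_power ell_bounds) auto
    then have "?d (upper m p) + ?d (ell (3/2) p) < ?d (ell 1 p) + ?d (ell 1 p)"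
      unfolding add_divide_distrib[symmetric] by (intro divide_strict_right_mono) (auto simp del: power_Suc)
    moreover have "0 \<le> ?d (upper m p)" "0 \<le> ?d (ell (3/2) p)" "0 \<le> ?d (ell 1 p)"
      using N.a_nonneg[OF p] N.a_le_1[OF p] S.a_nonneg[OF p] S.a_le_1[OF p] B.a_nonneg[OF p] B.a_le_1[OF p]
      by (intro d; simp)+
    ultimately have "ennreal (?d (upper m p)) + ennreal (?d (ell (3/2) p)) < ennreal (?d (ell 1 p)) + ennreal (?d (ell 1 p))"
      by (simp add: ennreal_plus[symmetric] ennreal_less_iff del: ennreal_plus power_Suc of_nat_Suc)
    moreover have "0 < ?V" "?V < top" using vball_pos[of "UNIV - {i}"] vball_finite[of "UNIV - {i}"] by simp_all
    ultimately have "?V * (ennreal (?d (upper m p)) + ennreal (?d (ell (3/2) p))) < ?V * (ennreal (?d (ell 1 p)) + ennreal (?d (ell 1 p)))"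
      by (intro ennreal_mult_strict_left_mono)
    then show ?thesis using p by (simp add: distrib_left del: power_Suc of_nat_Suc)
  qed
  have fin: "emeasure lborel L < \<infinity>" using compact_L by (intro emeasure_bounded_finite compact_imp_bounded)
  show ?thesis
    unfolding L B
  proof (rule nn_integral_less)
    show "(\<integral>\<^sup>+p. (?v (upper m) p + ?v (ell (3/2)) p) \<partial>lborel) \<noteq> \<infinity>" using fin unfolding L by simp
    have "?v (upper m) p + ?v (ell (3/2)) p \<le> ?v (ell 1) p + ?v (ell 1) p" for p
      using less[of p] by (cases "0 < p") (auto intro: less_imp_le)
    then show "AE p in lborel. ?v (upper m) p + ?v (ell (3/2)) p \<le> ?v (ell 1) p + ?v (ell 1) p"
      by (rule AE_I2)
    show "\<not> (AE p in lborel. ?v (ell 1) p + ?v (ell 1) p \<le> ?v (upper m) p + ?v (ell (3/2)) p)"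
    proof
      assume "AE p in lborel. ?v (ell 1) p + ?v (ell 1) p \<le> ?v (upper m) p + ?v (ell (3/2)) p"
      then have "AE p in lborel. p \<notin> {0<..<1::real}"
        by (rule AE_mp) (intro AE_I2 impI notI, use less in \<open>auto simp: not_le[symmetric] simp del: power_Suc of_nat_Suc\<close>)
      then have "{0<..<1::real} \<in> null_sets lborel" by (subst AE_iff_null_sets) auto
      then show False by (simp add: null_sets_def)
    qed
  qed measurable
qed

text \<open>The right side is the sum of the maximal widths of both halves of \<open>L\<close>. By
  \<open>nn_integral_J\<close> and \<open>upper_power\<close> its \<open>J\<close> terms may be
  replaced by those of the ball (\<open>JE\<close>). For the ball any single graph point bounds the
  width from below, and the best one gives exactly the slices of a unit ball.\<close>

lemma shadow_integral:
  assumes cs: "0 \<le> c" "0 \<le> s" "c\<^sup>2 + s\<^sup>2 = 1"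
  shows "vball (UNIV - {i}) \<le> (\<integral>\<^sup>+w. ((ennreal (c * sqrt (1 - sq I w)) + N.J c s (sq I w))
      + (ennreal (c * sqrt (1 - sq I w)) + S.J c s (sq I w))) \<partial>EM I)"
proof -
  let ?J = "insert j I"
  note [measurable] = cone_measurable[OF insertI1]
  have finJ: "finite ?J" using I by simp
  interpret E: sigma_finite_measure "EM ?J" using finJ by (rule sigma_finite_EM)
  define C where "C p = (\<integral>\<^sup>+x. cone ?J j c s p x \<partial>EM ?J)" for p
  have [measurable]: "C \<in> borel_measurable borel" unfolding C_def by measurable
  define q where "q = (\<lambda>w. ennreal (c * sqrt (1 - sq I w)))"
  have [measurable]: "q \<in> borel_measurable (EM I)" unfolding q_def by measurable
  have JE: "(\<integral>\<^sup>+w. N.J c s (sq I w) \<partial>EM I) + (\<integral>\<^sup>+w. S.J c s (sq I w) \<partial>EM I)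
      = (\<integral>\<^sup>+w. B.J c s (sq I w) \<partial>EM I) + (\<integral>\<^sup>+w. B.J c s (sq I w) \<partial>EM I)"
  proof -
    have "(\<integral>\<^sup>+w. N.J c s (sq I w) \<partial>EM I) + (\<integral>\<^sup>+w. S.J c s (sq I w) \<partial>EM I)
      = (\<integral>\<^sup>+p. (ennreal (1 - upper m p ^ m) * C p * indicator {0<..} p
          + ennreal (1 - ell (3/2) p ^ m) * C p * indicator {0<..} p) \<partial>lborel)"
      unfolding N.nn_integral_J[OF I(1,2) cs(1,2)] S.nn_integral_J[OF I(1,2) cs(1,2)] C_def[symmetric] m_def[symmetric]
      by (rule nn_integral_add[symmetric]) measurable
    also have "\<dots> = (\<integral>\<^sup>+p. (ennreal (1 - ell 1 p ^ m) * C p * indicator {0<..} p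
          + ennreal (1 - ell 1 p ^ m) * C p * indicator {0<..} p) \<partial>lborel)"
    proof (rule nn_integral_cong)
      fix p :: real
      show "ennreal (1 - upper m p ^ m) * C p * indicator {0<..} p
          + ennreal (1 - ell (3/2) p ^ m) * C p * indicator {0<..} p
        = ennreal (1 - ell 1 p ^ m) * C p * indicator {0<..} p
          + ennreal (1 - ell 1 p ^ m) * C p * indicator {0<..} p"
      proof (cases "0 < p")
        case p: True
        have pos: "0 \<le> 1 - upper m p ^ m" "0 \<le> 1 - ell (3/2) p ^ m" "0 \<le> 1 - ell 1 p ^ m"
          using N.a_nonneg[OF p] N.a_le_1[OF p] S.a_nonneg[OF p] S.a_le_1[OF p] B.a_nonneg[OF p] B.a_le_1[OF p]
          by (simp_all add: power_le_one)
        have "ennreal (1 - upper m p ^ m) + ennreal (1 - ell (3/2) p ^ m) = ennreal (1 - ell 1 p ^ m) + ennreal (1 - ell 1 p ^ m)"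
          using pos upper_power[OF p] by (simp add: ennreal_plus[symmetric] del: ennreal_plus)
        then have "(ennreal (1 - upper m p ^ m) + ennreal (1 - ell (3/2) p ^ m)) * C p
            = (ennreal (1 - ell 1 p ^ m) + ennreal (1 - ell 1 p ^ m)) * C p" by simp
        then show ?thesis using p by (simp add: distrib_right)
      qed simp
    qed
    also have "\<dots> = (\<integral>\<^sup>+w. B.J c s (sq I w) \<partial>EM I) + (\<integral>\<^sup>+w. B.J c s (sq I w) \<partial>EM I)"
      unfolding B.nn_integral_J[OF I(1,2) cs(1,2)] C_def[symmetric] m_def[symmetric]
      by (rule nn_integral_add) measurable
    finally show ?thesis .
  qed
  have ball: "ennreal (sqrt (1 - sq I w)) \<le> q w + B.J c s (sq I w)" for w
  proof (cases "sq I w \<le> 1")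
    case True
    define u where "u = sq I w"
    have u: "0 \<le> u" "u \<le> 1" using True by (auto simp: u_def)
    define \<rho> where "\<rho> = sqrt (1 - u)"
    have \<rho>: "0 \<le> \<rho>" "\<rho>\<^sup>2 = 1 - u" using u by (auto simp: \<rho>_def)
    have "c\<^sup>2 \<le> 1\<^sup>2" using cs(3) zero_le_power2[of s] unfolding one_power2 by linarith
    then have c1: "c \<le> 1" by (rule power2_le_imp_le) simp
    have tle: "c * \<rho> \<le> \<rho>" using c1 \<rho> by (simp add: mult_left_le_one_le cs)
    have e: "1 - ((c * \<rho>)\<^sup>2 + u) = (s * \<rho>)\<^sup>2"
    proof -
      have "1 - ((c * \<rho>)\<^sup>2 + u) = \<rho>\<^sup>2 * (1 - c\<^sup>2)" by (simp add: \<rho>(2) power_mult_distrib algebra_simps)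
      also have "1 - c\<^sup>2 = s\<^sup>2" using cs(3) by simp
      finally show ?thesis by (simp add: power_mult_distrib mult.commute)
    qed
    then have le1: "(c * \<rho>)\<^sup>2 + u \<le> 1" using zero_le_power2[of "s * \<rho>"] by linarith
    \<comment> \<open>The slice of the ball is a disc of radius \<open>\<rho>\<close>; its extreme
      point in direction \<open>(c, s)\<close> has \<open>t = c * \<rho>\<close> and height
      \<open>s * \<rho>\<close>.\<close>
    have "B.\<psi> (sqrt ((c * \<rho>)\<^sup>2 + u)) = s * \<rho>"
      using le1 u e cs \<rho> by (simp add: \<psi>_B)
    then have "c * (c * \<rho>) + s * B.\<psi> (sqrt ((c * \<rho>)\<^sup>2 + u)) = (c\<^sup>2 + s\<^sup>2) * \<rho>"
      by (simp add: power2_eq_square algebra_simps)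
    then have "c * (c * \<rho>) + s * B.\<psi> (sqrt ((c * \<rho>)\<^sup>2 + u)) = \<rho>" by (simp add: cs)
    then show ?thesis
      using B.width_le[OF u(1), of "c * \<rho>" c s] cs tle \<rho>(1) by (simp add: q_def \<rho>_def u_def)
  next
    case False
    then show ?thesis by (simp add: ennreal_neg)
  qed
  have "vball (UNIV - {i}) = (\<integral>\<^sup>+w. ennreal (2 * sqrt (1 - sq I w)) \<partial>EM I)"
    using vball_insert[OF I(1,2)] I(4) by simp
  also have "\<dots> = (\<integral>\<^sup>+w. (ennreal (sqrt (1 - sq I w)) + ennreal (sqrt (1 - sq I w))) \<partial>EM I)"
  proof (rule nn_integral_cong)
    fix w show "ennreal (2 * sqrt (1 - sq I w)) = ennreal (sqrt (1 - sq I w)) + ennreal (sqrt (1 - sq I w))"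
      by (cases "sq I w \<le> 1") (simp_all add: ennreal_neg ennreal_plus[symmetric] del: ennreal_plus)
  qed
  also have "\<dots> \<le> (\<integral>\<^sup>+w. ((q w + B.J c s (sq I w)) + (q w + B.J c s (sq I w))) \<partial>EM I)"
    using ball by (intro nn_integral_mono add_mono)
  also have "\<dots> = (\<integral>\<^sup>+w. q w \<partial>EM I) + (\<integral>\<^sup>+w. q w \<partial>EM I)
      + ((\<integral>\<^sup>+w. B.J c s (sq I w) \<partial>EM I) + (\<integral>\<^sup>+w. B.J c s (sq I w) \<partial>EM I))"
    by (simp add: nn_integral_add add_ac)
  also have "\<dots> = (\<integral>\<^sup>+w. ((q w + N.J c s (sq I w)) + (q w + S.J c s (sq I w))) \<partial>EM I)"
    unfolding JE[symmetric] by (simp add: nn_integral_add add_ac)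
  finally show ?thesis by (simp add: q_def)
qed

end

section \<open>Lower bounds for shadows and sections of \<open>L\<close>\<close>

context oval
begin

lemma upd_space: "w \<in> space (EM I) \<Longrightarrow> w(j := t) \<in> space (EM (UNIV - {i}))"
  unfolding I(4)[symmetric] by (auto simp: space_PiM PiE_iff extensional_def)

lemma sq_updE: "sq (UNIV - {i}) (x(j := t)) = t\<^sup>2 + sq I x"
  using I(2) by (simp add: sqE)

text \<open>In each slice \<open>width_attained\<close> supplies a point of the upper half and,
  mirrored in \<open>j\<close>, a point of the lower half. The segment between them lies in
  \<open>L\<close> by convexity, and its shadow is the interval from \<open>lo\<close> to
  \<open>hi\<close>, whose length is the integrand of \<open>shadow_integral\<close>.\<close>

lemma shadow_ge:
  assumes cs: "0 \<le> c" "0 \<le> s" "c\<^sup>2 + s\<^sup>2 = 1"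
  defines "X \<equiv> {x \<in> space (EM (UNIV - {i})). \<exists>z. vec1 i (z * c + x j * s) (x(j := x j * c - z * s)) \<in> L}"
  assumes X: "X \<in> sets (EM (UNIV - {i}))"
  shows "vball (UNIV - {i}) \<le> emeasure (EM (UNIV - {i})) X"
proof -
  note shadow_integral[OF cs]
  also have "(\<integral>\<^sup>+w. ((ennreal (c * sqrt (1 - sq I w)) + N.J c s (sq I w))
      + (ennreal (c * sqrt (1 - sq I w)) + S.J c s (sq I w))) \<partial>EM I) \<le> emeasure (EM (insert j I)) X"
  proof (rule emeasure_ge_slices[OF I(1,2)])
    show "X \<in> sets (EM (insert j I))" unfolding I(4) by (rule X)
    fix w assume w: "w \<in> space (EM I)"
    define u where "u = sq I w"
    show "\<exists>l r. (\<forall>t. l \<le> t \<and> t \<le> r \<longrightarrow> w(j := t) \<in> X) \<and>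
      (ennreal (c * sqrt (1 - sq I w)) + N.J c s (sq I w)) + (ennreal (c * sqrt (1 - sq I w)) + S.J c s (sq I w)) \<le> ennreal (r - l)"
    proof (cases "u \<le> 1")
      case False
      then have "c * sqrt (1 - u) \<le> 0" using cs by (simp add: mult_nonneg_nonpos)
      then have "ennreal (c * sqrt (1 - u)) = 0" by (rule ennreal_neg)
      then show ?thesis
        using False N.J_eq_0[of u c s] S.J_eq_0[of u c s] unfolding u_def[symmetric]
        by - (rule exI[of _ 1], rule exI[of _ 0], auto)
    next
      case True
      have u: "0 \<le> u" "u \<le> 1" using True by (auto simp: u_def)
      obtain a where a: "0 \<le> a" "a \<le> sqrt (1 - u)"
        and Na: "ennreal (c * a + s * N.\<psi> (sqrt (a\<^sup>2 + u))) = ennreal (c * sqrt (1 - u)) + N.J c s u"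
        using N.width_attained[OF u cs(1,2)] by blast
      obtain b where b: "0 \<le> b" "b \<le> sqrt (1 - u)"
        and Sb: "ennreal (c * b + s * S.\<psi> (sqrt (b\<^sup>2 + u))) = ennreal (c * sqrt (1 - u)) + S.J c s u"
        using S.width_attained[OF u cs(1,2)] by blast
      define f where "f = N.\<psi> (sqrt (a\<^sup>2 + u))"
      define g where "g = S.\<psi> (sqrt (b\<^sup>2 + u))"
      define hi where "hi = c * a + s * f"
      define lo where "lo = - (c * b + s * g)"
      have fg: "0 \<le> f" "0 \<le> g" by (auto simp: f_def g_def N.\<psi>_nonneg S.\<psi>_nonneg)
      have pos: "0 \<le> c * a + s * f" "0 \<le> c * b + s * g" using cs a b fg by auto
      have sqle: "x\<^sup>2 + u \<le> 1" if "0 \<le> x" "x \<le> sqrt (1 - u)" for x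
      proof -
        have "x\<^sup>2 \<le> (sqrt (1 - u))\<^sup>2" using that by (intro power_mono)
        then show ?thesis using u by simp
      qed
      have PN: "vec1 i f (w(j := a)) \<in> L"
        using sqle[OF a] fg by (simp add: L_def vec1_in_rbody sq_updE u_def[symmetric] f_def N.\<psi>_nonneg S.\<psi>_nonneg)
          (use S.\<psi>_nonneg N.\<psi>_nonneg in \<open>smt (verit)\<close>)
      have PS: "vec1 i (- g) (w(j := - b)) \<in> L"
        using sqle[OF b] fg by (simp add: L_def vec1_in_rbody sq_updE u_def[symmetric] g_def)
          (use S.\<psi>_nonneg N.\<psi>_nonneg in \<open>smt (verit)\<close>)
      have mem: "w(j := t) \<in> X" if t: "lo \<le> t" "t \<le> hi" for t
      proof -
        have "t \<in> closed_segment lo hi" using t by (simp add: closed_segment_eq_real_ivl)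
        then obtain \<kappa> where \<kappa>: "0 \<le> \<kappa>" "\<kappa> \<le> 1" and t': "t = (1 - \<kappa>) * lo + \<kappa> * hi"
          by (auto simp: closed_segment_def)
        \<comment> \<open>The coordinate along the projection direction, interpolated between its
          values at the two extreme points.\<close>
        define z where "z = (1 - \<kappa>) * (- g * c + b * s) + \<kappa> * (f * c - a * s)"
        have s2: "s\<^sup>2 = 1 - c\<^sup>2" using cs(3) by simp
        have z1: "z * c + t * s = (1 - \<kappa>) * (- g) + \<kappa> * f"
        proof -
          have "z * c + t * s = ((1 - \<kappa>) * (- g) + \<kappa> * f) * (c\<^sup>2 + s\<^sup>2)"
            by (simp add: z_def t' lo_def hi_def power2_eq_square algebra_simps)
          then show ?thesis by (simp add: cs(3))
        qed
        have z2: "t * c - z * s = (1 - \<kappa>) * (- b) + \<kappa> * a"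
        proof -
          have "t * c - z * s = ((1 - \<kappa>) * (- b) + \<kappa> * a) * (c\<^sup>2 + s\<^sup>2)"
            by (simp add: z_def t' lo_def hi_def power2_eq_square algebra_simps)
          then show ?thesis by (simp add: cs(3))
        qed
        have "(1 - \<kappa>) *\<^sub>R vec1 i (- g) (w(j := - b)) + \<kappa> *\<^sub>R vec1 i f (w(j := a)) \<in> L"
          using \<kappa> by (intro convexD[OF convex_L PS PN]) auto
        also have "(1 - \<kappa>) *\<^sub>R vec1 i (- g) (w(j := - b)) + \<kappa> *\<^sub>R vec1 i f (w(j := a))
            = vec1 i (z * c + t * s) (w(j := t * c - z * s))"
          unfolding z1 z2 by (auto simp: vec1_def vec_eq_iff algebra_simps)
        finally show ?thesis
          using upd_space[OF w] unfolding X_def by auto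
      qed
      have "(ennreal (c * sqrt (1 - u)) + N.J c s u) + (ennreal (c * sqrt (1 - u)) + S.J c s u) = ennreal (hi - lo)"
        unfolding Na[symmetric] Sb[symmetric] f_def[symmetric] g_def[symmetric] hi_def lo_def
        using pos by (simp add: ennreal_plus[symmetric] del: ennreal_plus)
      then show ?thesis unfolding u_def[symmetric] using mem by - (rule exI[of _ lo], rule exI[of _ hi], auto)
    qed
  qed
  finally show ?thesis unfolding I(4) .
qed

text \<open>Over each \<open>w\<close> the tilted section contains the axial slice from
  \<open>-g\<close> to \<open>f\<close> shrunk by \<open>1 / D\<close>, by
  \<open>chord_in_graph\<close>. The axial slices are bounded below by the shadow with
  \<open>c = 0\<close> and \<open>s = 1\<close>, hence by \<open>shadow_integral\<close>. Only the
  \<open>j\<close> direction shrinks, so the factor occurs to the first power.\<close>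

lemma section_ge:
  assumes cs: "0 \<le> c" "0 \<le> s" "c\<^sup>2 + s\<^sup>2 = 1"
  defines "X \<equiv> {x \<in> space (EM (UNIV - {i})). vec1 i (x j * s) (x(j := x j * c)) \<in> L}"
  assumes X: "X \<in> sets (EM (UNIV - {i}))"
  shows "ennreal (1 / sqrt (s\<^sup>2 + 3/2 * c\<^sup>2)) * vball (UNIV - {i}) \<le> emeasure (EM (UNIV - {i})) X"
proof -
  define D where "D = sqrt (s\<^sup>2 + 3/2 * c\<^sup>2)"
  have "s\<^sup>2 + 3/2 * c\<^sup>2 = 1 + c\<^sup>2 / 2" using cs(3) by simp
  then have D0: "0 < s\<^sup>2 + 3/2 * c\<^sup>2" using zero_le_power2[of c] by linarith
  then have D: "0 < D" "D\<^sup>2 = s\<^sup>2 + (sqrt (3/2))\<^sup>2 * c\<^sup>2" by (auto simp: D_def)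
  let ?f = "\<lambda>w. (ennreal (0 * sqrt (1 - sq I w)) + N.J 0 1 (sq I w)) + (ennreal (0 * sqrt (1 - sq I w)) + S.J 0 1 (sq I w))"
  have "ennreal (1 / D) * vball (UNIV - {i}) \<le> ennreal (1 / D) * (\<integral>\<^sup>+w. ?f w \<partial>EM I)"
    by (intro mult_left_mono shadow_integral) auto
  also have "\<dots> = (\<integral>\<^sup>+w. ennreal (1 / D) * ?f w \<partial>EM I)"
    by (rule nn_integral_cmult[symmetric]) measurable
  also have "\<dots> \<le> emeasure (EM (insert j I)) X"
  proof (rule emeasure_ge_slices[OF I(1,2)])
    show "X \<in> sets (EM (insert j I))" unfolding I(4) by (rule X)
    fix w assume w: "w \<in> space (EM I)"
    define u where "u = sq I w"
    show "\<exists>l r. (\<forall>t. l \<le> t \<and> t \<le> r \<longrightarrow> w(j := t) \<in> X) \<and> ennreal (1 / D) * ?f w \<le> ennreal (r - l)"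
    proof (cases "u \<le> 1")
      case False
      then show ?thesis
        using N.J_eq_0[of u 0 1] S.J_eq_0[of u 0 1] unfolding u_def[symmetric]
        by - (rule exI[of _ 1], rule exI[of _ 0], auto)
    next
      case True
      have u: "0 \<le> u" "u \<le> 1" using True by (auto simp: u_def)
      define f where "f = N.\<psi> (sqrt u)"
      define g where "g = S.\<psi> (sqrt u)"
      have fg: "0 \<le> f" "0 \<le> g" by (auto simp: f_def g_def N.\<psi>_nonneg S.\<psi>_nonneg)
      have JN: "N.J 0 1 u \<le> ennreal f" and JS: "S.J 0 1 u \<le> ennreal g"
        unfolding f_def g_def using u by (rule N.J_vertical_le, rule S.J_vertical_le)
      have mem: "w(j := t) \<in> X" if t: "- (g / D) \<le> t" "t \<le> f / D" for t
      proof -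
        have "vec1 i (t * s) (w(j := t * c)) \<in> L"
        proof (cases "0 \<le> t")
          case True
          then have "t * D \<le> N.\<psi> (sqrt u)" using t D by (simp add: f_def field_simps)
          note ch = N.chord_in_graph[OF u True this D(2) less_imp_le[OF D(1)]]
          moreover have "0 \<le> t * s" using True cs by simp
          ultimately show ?thesis
            using S.\<psi>_nonneg[of "sqrt ((t * c)\<^sup>2 + u)"] by (simp add: L_def vec1_in_rbody sq_updE u_def[symmetric])
        next
          case False
          then have t0: "0 \<le> - t" by simp
          have "- t * D \<le> S.\<psi> (sqrt u)" using t D by (simp add: g_def field_simps)
          note ch = S.chord_in_graph[OF u t0 this D(2) less_imp_le[OF D(1)]]
          moreover have "t * s \<le> 0" using False cs by (simp add: mult_nonpos_nonneg)
          ultimately show ?thesis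
            using N.\<psi>_nonneg[of "sqrt ((t * c)\<^sup>2 + u)"] by (simp add: L_def vec1_in_rbody sq_updE u_def[symmetric])
        qed
        then show ?thesis using upd_space[OF w] unfolding X_def by simp
      qed
      have "ennreal (1 / D) * ?f w \<le> ennreal (1 / D) * (ennreal f + ennreal g)"
        unfolding u_def[symmetric] using JN JS by (intro mult_left_mono) (auto intro: add_mono)
      also have "\<dots> = ennreal (f / D - - (g / D))"
        using fg D by (simp add: ennreal_plus[symmetric] ennreal_mult[symmetric] add_divide_distrib del: ennreal_plus)
      finally show ?thesis using mem by - (rule exI[of _ "- (g / D)"], rule exI[of _ "f / D"], auto)
    qed
  qed
  finally show ?thesis unfolding I(4) D_def .
qed

section \<open>Comparison with the shifted ball\<close>

lemma emeasure_ball_coords: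
  "0 < \<rho> \<Longrightarrow> emeasure (EM (UNIV - {i})) {x \<in> space (EM (UNIV - {i})). (x j - d)\<^sup>2 + sq I x \<le> \<rho>\<^sup>2}
     = ennreal (\<rho> ^ m) * vball (UNIV - {i})"
  using emeasure_shifted_ball[OF I(1,2), of \<rho> d] unfolding I(4) m_def[symmetric] .

lemma finite_coords:
  assumes "X \<subseteq> {x \<in> space (EM (UNIV - {i})). (x j)\<^sup>2 + sq I x \<le> R\<^sup>2}" "0 < R"
  shows "emeasure (EM (UNIV - {i})) X < top"
proof -
  have ms: "{x \<in> space (EM (UNIV - {i})). (x j - 0)\<^sup>2 + sq I x \<le> R\<^sup>2} \<in> sets (EM (UNIV - {i}))"
    unfolding diff_0_right sqE[symmetric] by measurable
  have "emeasure (EM (UNIV - {i})) X \<le> emeasure (EM (UNIV - {i})) {x \<in> space (EM (UNIV - {i})). (x j - 0)\<^sup>2 + sq I x \<le> R\<^sup>2}"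
    using assms(1) by (intro emeasure_mono ms) simp
  also have "\<dots> < top"
    unfolding emeasure_ball_coords[OF assms(2)] using vball_finite[of "UNIV - {i}"] by (simp add: ennreal_mult_less_top)
  finally show ?thesis .
qed

text \<open>The shadows of the ball have volume \<open>r ^ m\<close> times that of the unit ball,
  those of \<open>L\<close> at least the latter. For sections the distance \<open>r / sqrt 2\<close>
  is matched to \<open>D\<close>: \<open>\<rho>\<^sup>2\<close> is
  \<open>r\<^sup>2 * (1 - c\<^sup>2 / 2)\<close>, while \<open>D\<^sup>2\<close> is
  \<open>1 + c\<^sup>2 / 2\<close>.\<close>

lemma smaller:
  assumes r: "0 < r" "r < 1"
  shows "smaller_sections_and_projections (cball ((r / sqrt 2) *\<^sub>R axis i 1) r) L"
  unfolding smaller_sections_and_projections_def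
proof (intro ballI conjI)
  fix \<xi> :: "real^'n" assume "\<xi> \<in> sphere 0 1"
  then have \<xi>: "norm \<xi> = 1" by simp
  let ?E = "EM (UNIV - {i})"
  let ?K = "cball ((r / sqrt 2) *\<^sub>R axis i 1) r :: (real^'n) set"
  define \<tau> where "\<tau> = r / sqrt 2"
  have \<tau>: "\<tau>\<^sup>2 = r\<^sup>2 / 2" by (simp add: \<tau>_def power_divide)
  have K: "compact ?K" "revolution_about i ?K" by (auto intro: revolution_about_cball)
  obtain R where R: "\<And>y. y \<in> L \<Longrightarrow> norm y \<le> R" "0 < R"
    using compact_imp_bounded[OF compact_L] by (auto simp: bounded_pos)
  obtain V where V: "vball (UNIV - {i}) = ennreal V" "0 < V"
    using vball_pos[of "UNIV - {i}"] vball_finite[of "UNIV - {i}"] by (cases "vball (UNIV - {i})") auto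
  from revolution_volumes[OF ij \<xi>]
  obtain c s :: real where cs: "0 \<le> c" "0 \<le> s" "c\<^sup>2 + s\<^sup>2 = 1"
    and sec: "\<And>L. compact L \<Longrightarrow> revolution_about i L \<Longrightarrow>
       {x \<in> space ?E. vec1 i (x j * s) (x(j := x j * c)) \<in> L} \<in> sets ?E \<and>
       subspace_volume ({\<xi>}\<^sup>\<bottom>) (L \<inter> {\<xi>}\<^sup>\<bottom>) = measure ?E
         {x \<in> space ?E. vec1 i (x j * s) (x(j := x j * c)) \<in> L}"
    and proj: "\<And>L. compact L \<Longrightarrow> revolution_about i L \<Longrightarrow>
       {x \<in> space ?E. \<exists>z. vec1 i (z * c + x j * s) (x(j := x j * c - z * s)) \<in> L} \<in> sets ?E \<and>
       subspace_volume ({\<xi>}\<^sup>\<bottom>) (orth_projection ({\<xi>}\<^sup>\<bottom>) L) = measure ?E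
         {x \<in> space ?E. \<exists>z. vec1 i (z * c + x j * s) (x(j := x j * c - z * s)) \<in> L}"
    by blast
  have bound: "(x j)\<^sup>2 + sq I x \<le> R\<^sup>2" if "vec1 i (z * c + x j * s) (x(j := x j * c - z * s)) \<in> L" for x z
  proof -
    have "(z * c + x j * s)\<^sup>2 + (x j * c - z * s)\<^sup>2 + sq I x \<le> R\<^sup>2"
      using power_mono[OF R(1)[OF that], of 2] by (simp add: norm_vec1_sq sq_updE add.assoc)
    moreover have "(z * c + x j * s)\<^sup>2 + (x j * c - z * s)\<^sup>2 = (z\<^sup>2 + (x j)\<^sup>2) * (c\<^sup>2 + s\<^sup>2)"
      by (simp add: power2_eq_square algebra_simps)
    ultimately have "z\<^sup>2 + (x j)\<^sup>2 + sq I x \<le> R\<^sup>2" using cs(3) by simp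
    then show ?thesis using zero_le_power2[of z] by linarith
  qed
  show "subspace_volume ({\<xi>}\<^sup>\<bottom>) (?K \<inter> {\<xi>}\<^sup>\<bottom>) < subspace_volume ({\<xi>}\<^sup>\<bottom>) (L \<inter> {\<xi>}\<^sup>\<bottom>)"
  proof -
    let ?X = "{x \<in> space ?E. vec1 i (x j * s) (x(j := x j * c)) \<in> L}"
    let ?Y = "{x \<in> space ?E. vec1 i (x j * s) (x(j := x j * c)) \<in> ?K}"
    define D where "D = sqrt (s\<^sup>2 + 3/2 * c\<^sup>2)"
    define \<rho> where "\<rho> = sqrt (r\<^sup>2 - c\<^sup>2 * \<tau>\<^sup>2)"
    have c2: "0 \<le> c\<^sup>2" "c\<^sup>2 \<le> 1" using cs(3) zero_le_power2[of s] by (simp_all, linarith)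
    have rr: "r\<^sup>2 - c\<^sup>2 * \<tau>\<^sup>2 = r\<^sup>2 * (1 - c\<^sup>2 / 2)" by (simp add: \<tau> algebra_simps)
    have \<rho>: "0 < \<rho>" "\<rho>\<^sup>2 = r\<^sup>2 - c\<^sup>2 * \<tau>\<^sup>2"
      using r c2 unfolding \<rho>_def rr by auto
    have DD: "s\<^sup>2 + 3/2 * c\<^sup>2 = 1 + c\<^sup>2 / 2" using cs(3) by simp
    moreover have "0 < 1 + c\<^sup>2 / 2" using c2 by linarith
    ultimately have D: "0 < D" "D\<^sup>2 = 1 + c\<^sup>2 / 2" by (simp_all add: D_def)
    have r2: "r\<^sup>2 < 1" using r by (simp add: abs_square_less_1)
    \<comment> \<open>A difference of squares. For \<open>c = 0\<close> nothing is gained from the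
      shift, and strictness comes from \<open>r < 1\<close>.\<close>
    have "(\<rho> * D)\<^sup>2 = r\<^sup>2 * (1 - (c\<^sup>2 / 2)\<^sup>2)"
      by (simp add: power_mult_distrib \<rho>(2) rr D(2)) (simp add: power2_eq_square algebra_simps)
    also have "\<dots> \<le> r\<^sup>2 * 1" by (intro mult_left_mono) auto
    also have "\<dots> < 1\<^sup>2" using r2 by simp
    finally have "\<rho> * D < 1" by (rule power2_less_imp_less) simp
    then have \<rho>D: "\<rho> < 1 / D" using D by (simp add: field_simps)
    have "r\<^sup>2 * (1 - c\<^sup>2 / 2) \<le> r\<^sup>2 * 1" using c2 by (intro mult_left_mono) auto
    then have "\<rho>\<^sup>2 \<le> 1" using r2 unfolding \<rho>(2) rr by linarith
    then have "\<rho> \<le> 1" using \<rho>(1) by (simp add: abs_square_le_1)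
    \<comment> \<open>The bound for \<open>L\<close> has only the first power of
      \<open>1 / D\<close>; since \<open>\<rho> \<le> 1\<close> and \<open>m \<ge> 1\<close>, the
      power \<open>m\<close> on the side of the ball only helps.\<close>
    then have "\<rho> ^ m \<le> \<rho> ^ 1" using \<rho> m(1) by (intro power_decreasing) auto
    then have \<rho>m: "\<rho> ^ m < 1 / D" using \<rho>D by simp
    have Y: "?Y = {x \<in> space ?E. (x j - \<tau> * s)\<^sup>2 + sq I x \<le> \<rho>\<^sup>2}"
    proof -
      have "vec1 i (x j * s) (x(j := x j * c)) \<in> ?K \<longleftrightarrow> (x j - \<tau> * s)\<^sup>2 + sq I x \<le> \<rho>\<^sup>2" for x
      proof -
        have "vec1 i (x j * s) (x(j := x j * c)) \<in> ?K \<longleftrightarrow> (x j * s - \<tau>)\<^sup>2 + ((x j * c)\<^sup>2 + sq I x) \<le> r\<^sup>2"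
          using r unfolding \<tau>_def by (subst vec1_in_cball) (simp_all add: sq_updE)
        moreover have "(x j * s - \<tau>)\<^sup>2 + ((x j * c)\<^sup>2 + sq I x) - r\<^sup>2
            = (x j - \<tau> * s)\<^sup>2 + sq I x - \<rho>\<^sup>2"
        proof -
          have "(x j * s - \<tau>)\<^sup>2 + (x j * c)\<^sup>2 = (x j)\<^sup>2 * (c\<^sup>2 + s\<^sup>2) - 2 * (\<tau> * s) * x j + \<tau>\<^sup>2"
            by (simp add: power2_eq_square algebra_simps)
          moreover have "(x j - \<tau> * s)\<^sup>2 = (x j)\<^sup>2 - 2 * (\<tau> * s) * x j + \<tau>\<^sup>2 * s\<^sup>2"
            by (simp add: power2_eq_square algebra_simps)
          moreover have "\<tau>\<^sup>2 = \<tau>\<^sup>2 * s\<^sup>2 + c\<^sup>2 * \<tau>\<^sup>2"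
            using cs(3) by (metis add.commute distrib_left mult.commute mult.right_neutral)
          ultimately show ?thesis unfolding \<rho>(2) cs(3) by simp
        qed
        ultimately show ?thesis by linarith
      qed
      then show ?thesis by simp
    qed
    have "measure ?E ?Y = \<rho> ^ m * V"
      unfolding Y measure_def emeasure_ball_coords[OF \<rho>(1)] V(1) using \<rho> V by (simp add: ennreal_mult[symmetric])
    also have "\<dots> < 1 / D * V" by (rule mult_strict_right_mono[OF \<rho>m V(2)])
    also have "\<dots> \<le> measure ?E ?X"
    proof -
      have fin: "emeasure ?E ?X < top"
        using bound[of 0] R(2) by (intro finite_coords[of _ R]) auto
      have "ennreal (1 / D * V) \<le> emeasure ?E ?X"
        using section_ge[OF cs] sec[OF compact_L revolution_L] V D unfolding D_def[symmetric]
        by (simp add: ennreal_mult[symmetric])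
      also have "\<dots> = ennreal (measure ?E ?X)"
        using fin by (intro emeasure_eq_ennreal_measure) simp
      finally show ?thesis using V D by (simp add: ennreal_le_iff)
    qed
    finally show ?thesis using sec[OF K] sec[OF compact_L revolution_L] by simp
  qed
  show "subspace_volume ({\<xi>}\<^sup>\<bottom>) (orth_projection ({\<xi>}\<^sup>\<bottom>) ?K) < subspace_volume ({\<xi>}\<^sup>\<bottom>) (orth_projection ({\<xi>}\<^sup>\<bottom>) L)"
  proof -
    let ?X = "{x \<in> space ?E. \<exists>z. vec1 i (z * c + x j * s) (x(j := x j * c - z * s)) \<in> L}"
    let ?Y = "{x \<in> space ?E. \<exists>z. vec1 i (z * c + x j * s) (x(j := x j * c - z * s)) \<in> ?K}"
    have Y: "?Y = {x \<in> space ?E. (x j - \<tau> * s)\<^sup>2 + sq I x \<le> r\<^sup>2}"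
    proof -
      have *: "vec1 i (z * c + x j * s) (x(j := x j * c - z * s)) \<in> ?K \<longleftrightarrow> (z - \<tau> * c)\<^sup>2 + (x j - \<tau> * s)\<^sup>2 + sq I x \<le> r\<^sup>2" for x z
      proof -
        have "vec1 i (z * c + x j * s) (x(j := x j * c - z * s)) \<in> ?K
            \<longleftrightarrow> (z * c + x j * s - \<tau>)\<^sup>2 + ((x j * c - z * s)\<^sup>2 + sq I x) \<le> r\<^sup>2"
          using r unfolding \<tau>_def by (subst vec1_in_cball) (simp_all add: sq_updE)
        moreover have "(z * c + x j * s - \<tau>)\<^sup>2 + ((x j * c - z * s)\<^sup>2 + sq I x)
            = (z - \<tau> * c)\<^sup>2 + (x j - \<tau> * s)\<^sup>2 + sq I x"
        proof -
          have "(z * c + x j * s - \<tau>)\<^sup>2 + (x j * c - z * s)\<^sup>2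
              = (z\<^sup>2 + (x j)\<^sup>2) * (c\<^sup>2 + s\<^sup>2) - 2 * \<tau> * (z * c + x j * s) + \<tau>\<^sup>2"
            by (simp add: power2_eq_square algebra_simps)
          moreover have "(z - \<tau> * c)\<^sup>2 + (x j - \<tau> * s)\<^sup>2
              = z\<^sup>2 + (x j)\<^sup>2 - 2 * \<tau> * (z * c + x j * s) + \<tau>\<^sup>2 * (c\<^sup>2 + s\<^sup>2)"
            by (simp add: power2_eq_square algebra_simps)
          ultimately show ?thesis unfolding cs(3) by simp
        qed
        ultimately show ?thesis by simp
      qed
      have "(\<exists>z. (z - \<tau> * c)\<^sup>2 + (x j - \<tau> * s)\<^sup>2 + sq I x \<le> r\<^sup>2) \<longleftrightarrow> (x j - \<tau> * s)\<^sup>2 + sq I x \<le> r\<^sup>2" for x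
      proof
        assume "\<exists>z. (z - \<tau> * c)\<^sup>2 + (x j - \<tau> * s)\<^sup>2 + sq I x \<le> r\<^sup>2"
        then obtain z where "(z - \<tau> * c)\<^sup>2 + (x j - \<tau> * s)\<^sup>2 + sq I x \<le> r\<^sup>2" ..
        then show "(x j - \<tau> * s)\<^sup>2 + sq I x \<le> r\<^sup>2" using zero_le_power2[of "z - \<tau> * c"] by linarith
      qed (auto intro: exI[of _ "\<tau> * c"])
      then show ?thesis unfolding * by simp
    qed
    have "measure ?E ?Y = r ^ m * V"
      unfolding Y measure_def emeasure_ball_coords[OF r(1)] V(1) using r V by (simp add: ennreal_mult[symmetric])
    also have "\<dots> < 1 * V" using r V m(1) by (intro mult_strict_right_mono) (simp_all add: power_less_one_iff)
    also have "\<dots> \<le> measure ?E ?X"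
    proof -
      have fin: "emeasure ?E ?X < top"
        using bound R(2) by (intro finite_coords[of _ R]) auto
      have "ennreal V \<le> emeasure ?E ?X"
        using shadow_ge[OF cs] proj[OF compact_L revolution_L] V by simp
      also have "\<dots> = ennreal (measure ?E ?X)"
        using fin by (intro emeasure_eq_ennreal_measure) simp
      finally show ?thesis using V by (simp add: ennreal_le_iff)
    qed
    finally show ?thesis using proj[OF K] proj[OF compact_L revolution_L] by simp
  qed
qed

lemma exists_radius:
  obtains r :: real where "0 < r" "r < 1" "\<And>p. measure lebesgue L < measure lebesgue (cball (p :: real^'n) r)"
proof -
  define u where "u = measure lebesgue (cball (0::real^'n) 1)"
  define l where "l = measure lebesgue L"
  have cb: "measure lebesgue (cball p r) = r ^ CARD('n) * u" if "0 \<le> r" for p :: "real^'n" and r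
    using that by (simp add: u_def content_cball)
  have fin: "emeasure lborel L < top" "emeasure lborel (cball (0::real^'n) 1) < top"
    using compact_L by (auto intro!: emeasure_bounded_finite[unfolded infinity_ennreal_def] compact_imp_bounded)
  have "L \<in> sets borel" using compact_L by (rule borel_compact)
  then have "emeasure lborel L = ennreal l"
    using emeasure_eq_ennreal_measure[OF less_imp_neq[OF fin(1)]] by (simp add: l_def)
  moreover have "emeasure lborel (cball (0::real^'n) 1) = ennreal u"
    using emeasure_eq_ennreal_measure[OF less_imp_neq[OF fin(2)]] by (simp add: u_def)
  ultimately have "ennreal l < ennreal u" using volume_less by simp
  then have lu: "l < u" "0 \<le> l" by (auto simp: l_def ennreal_less_iff)
  \<comment> \<open>Midway between the volume ratio and 1; \<open>q\<close> becomes the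
    \<open>n\<close>-th power of the radius.\<close>
  define q where "q = (l / u + 1) / 2"
  have q: "0 < q" "q < 1" "l < q * u" using lu by (auto simp: q_def field_simps)
  show ?thesis
  proof (rule that[of "root CARD('n) q"])
    show "0 < root CARD('n) q" using q by simp
    show "root CARD('n) q < 1" using q by simp
    show "measure lebesgue L < measure lebesgue (cball p (root CARD('n) q))" for p :: "real^'n"
      using q by (subst cb) (simp_all add: l_def[symmetric] real_root_pow_pos2)
  qed
qed

end

section \<open>Failure of symmetry and choice of the pair\<close>

lemma origin_symmetric_imp_centrally_symmetric:
  "origin_symmetric L \<Longrightarrow> centrally_symmetric_about 0 L"
  by (simp add: centrally_symmetric_about_def)

lemma not_origin_symmetric_cball:
  fixes p :: "'a::euclidean_space"
  assumes "0 \<le> r" "p \<noteq> 0"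
  shows "\<not> origin_symmetric (cball p r)"
proof
  assume "origin_symmetric (cball p r)"
  then have sym: "cball p r = uminus ` cball p r" by (simp add: origin_symmetric_def)
  \<comment> \<open>The point of the ball farthest from the origin; its negative has distance
    \<open>2 * norm p + r\<close> from the centre.\<close>
  define q where "q = (1 + r / norm p) *\<^sub>R p"
  have "p - q = (- (r / norm p)) *\<^sub>R p" by (simp add: q_def algebra_simps)
  then have "norm (p - q) = r" using assms by simp
  then have "q \<in> cball p r" by (simp add: dist_norm)
  then have "- q \<in> cball p r" using sym by blast
  then have "norm (p + q) \<le> r" by (simp add: dist_norm)
  moreover have "p + q = (2 + r / norm p) *\<^sub>R p" by (simp add: q_def algebra_simps flip: scaleR_2)
  moreover have "norm ((2 + r / norm p) *\<^sub>R p) = 2 * norm p + r" using assms by (simp add: field_simps)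
  ultimately show False using assms by simp
qed

theorem theorem1p2:
  assumes "2 \<le> CARD('n::finite)"
  shows "(\<exists>K L :: (real ^ 'n) set.
            convex_body K \<and> convex_body L \<and>
            body_of_revolution K \<and> body_of_revolution L \<and>
            0 \<in> interior K \<and> 0 \<in> interior L \<and>
            \<not> origin_symmetric K \<and> \<not> origin_symmetric L \<and>
            smaller_sections_and_projections K L \<and>
            measure lebesgue K > measure lebesgue L)
       \<and> (\<exists>K L :: (real ^ 'n) set.
            convex_body K \<and> convex_body L \<and>
            body_of_revolution K \<and> body_of_revolution L \<and>
            0 \<in> interior K \<and> 0 \<in> interior L \<and>
            \<not> origin_symmetric K \<and> \<not> origin_symmetric L \<and>
            smaller_sections_and_projections K L \<and>
            measure lebesgue K > measure lebesgue L \<and>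
            (\<exists>c r. c \<noteq> 0 \<and> r > 0 \<and> K = (\<lambda>x. c + x) ` cball 0 r) \<and>
            (\<nexists>p. centrally_symmetric_about p L))"
proof -
  have "\<not> (\<forall>i j :: 'n. i = j)"
  proof
    assume "\<forall>i j :: 'n. i = j"
    then have "CARD('n) \<le> 1" by (intro card_le_Suc0_iff_eq[THEN iffD2, unfolded One_nat_def[symmetric]]) auto
    then show False using assms by simp
  qed
  then obtain i j :: 'n where "i \<noteq> j" by blast
  then interpret oval i j by unfold_locales
  obtain r where r: "0 < r" "r < 1" and vol: "\<And>p. measure lebesgue L < measure lebesgue (cball (p :: real^'n) r)"
    using exists_radius by blast
  define p where "p = (r / sqrt 2) *\<^sub>R (axis i 1 :: real^'n)"
  define K where "K = cball p r"
  have p: "p \<noteq> 0" using r by (simp add: p_def axis_eq_0_iff)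
  \<comment> \<open>The shift is shorter than the radius, so the origin stays inside the
    ball.\<close>
  have "r / sqrt 2 < r / 1" using r by (intro divide_strict_left_mono) auto
  then have "norm p < r" using r by (simp add: p_def)
  then have "0 \<in> ball p r" by (simp add: dist_norm)
  then have K0: "0 \<in> interior K" by (simp add: K_def interior_cball)
  have "convex_body K" using K0 r by (auto simp: convex_body_def K_def)
  moreover have "convex_body L" using compact_L convex_L interior_L by (auto simp: convex_body_def)
  moreover have "body_of_revolution K"
    unfolding K_def p_def by (rule revolution_imp_body_of_revolution[OF revolution_about_cball])
  moreover have "body_of_revolution L" by (rule revolution_imp_body_of_revolution[OF revolution_L])
  moreover have "\<not> origin_symmetric K" unfolding K_def using p r by (intro not_origin_symmetric_cball) auto
  moreover have "\<not> origin_symmetric L"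
    using origin_symmetric_imp_centrally_symmetric not_centrally_symmetric_L by blast
  moreover have "smaller_sections_and_projections K L"
    unfolding K_def p_def using r by (rule smaller)
  moreover have "measure lebesgue K > measure lebesgue L" unfolding K_def by (rule vol)
  moreover have "\<exists>c r. c \<noteq> 0 \<and> r > 0 \<and> K = (\<lambda>x. c + x) ` cball 0 r"
    using p r cball_translation[of p 0 r] by (intro exI[of _ p] exI[of _ r]) (auto simp: K_def)
  moreover have "\<nexists>p. centrally_symmetric_about p L" using not_centrally_symmetric_L by blast
  ultimately show ?thesis using K0 interior_L by blast
qed

end
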